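(* For all integers $n\ge 4$, the minimal number of black stones that must be placed on an otherwise empty Hex board of size $4\times n$ to create a virtual connection between Black's edges is exactly $\lceil \tfrac{2}{3}n-2\rceil$.
   Context: Hex is played on a parallelogram-shaped board of hexagonal cells, with the usual hexagonal adjacency. A board of size $4\times n$ consists of $n$ columns of $4$ cells each; Black's two edges are the two short sides of the board (bordering the first and last columns, respectively), and White's two edges are the two long sides. Players alternately place a stone of their color on an empty cell; Black wins if at the end (board full) there is a chain of adjacent black stones connecting Black's two edges, otherwise White wins (exactly one player wins). A placement of black stones on the board (all other cells empty) is a virtual connection for Black if Black wins from that position even when White moves first, i.e., Black has a second-player winning strategy from it. *)

theory Defs
  imports Complex_Main
begin

text \<open>Hex on a 4 x n parallelogram board. A cell is a pair (r, c) with row r < 4 and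
column c < n. Black's edges are the first column (c = 0) and the last column (c = n - 1);
White's edges are the rows r = 0 and r = 3.\<close>

type_synonym cell = "nat \<times> nat"

definition hex_cells :: "nat \<Rightarrow> cell set" where
  "hex_cells n = {(r, c). r < 4 \<and> c < n}"

definition hex_adj :: "cell \<Rightarrow> cell \<Rightarrow> bool" where
  "hex_adj p q = (let (r, c) = p; (r', c') = q; dr = int r' - int r; dc = int c' - int c in
      (dr, dc) \<in> {(0, 1), (0, -1), (1, 0), (-1, 0), (1, -1), (-1, 1)})"

definition black_connected :: "nat \<Rightarrow> cell set \<Rightarrow> bool" where
  "black_connected n B = (\<exists>p. p \<noteq> [] \<and> set p \<subseteq> B \<and> set p \<subseteq> hex_cells n \<and>
      snd (hd p) = 0 \<and> snd (last p) = n - 1 \<and>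
      (\<forall>i. Suc i < length p \<longrightarrow> hex_adj (p ! i) (p ! Suc i)))"

text \<open>Game values. \<open>black_wins_bm n B W\<close>: Black wins from the position with black stones B
and white stones W, Black to move.  \<open>black_wins_wm n B W\<close>: same, White to move.
The game ends when the board is full; Black wins iff then the black stones connect
Black's edges.  Since the game is finite, the least fixed point gives the game value.\<close>

inductive black_wins_bm :: "nat \<Rightarrow> cell set \<Rightarrow> cell set \<Rightarrow> bool"
  and black_wins_wm :: "nat \<Rightarrow> cell set \<Rightarrow> cell set \<Rightarrow> bool"
  for n :: nat where
  full_bm: "B \<union> W = hex_cells n \<Longrightarrow> black_connected n B \<Longrightarrow> black_wins_bm n B W"
| full_wm: "B \<union> W = hex_cells n \<Longrightarrow> black_connected n B \<Longrightarrow> black_wins_wm n B W"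
| move_b: "x \<in> hex_cells n \<Longrightarrow> x \<notin> B \<Longrightarrow> x \<notin> W \<Longrightarrow>
           black_wins_wm n (insert x B) W \<Longrightarrow> black_wins_bm n B W"
| move_w: "B \<union> W \<noteq> hex_cells n \<Longrightarrow>
           (\<forall>x. x \<in> hex_cells n \<and> x \<notin> B \<and> x \<notin> W \<longrightarrow> black_wins_bm n B (insert x W)) \<Longrightarrow>
           black_wins_wm n B W"

definition virtual_connection :: "nat \<Rightarrow> cell set \<Rightarrow> bool" where
  "virtual_connection n B = (B \<subseteq> hex_cells n \<and> black_wins_wm n B {})"

end

theory Submission
  imports Defs
begin

text \<open>
  Upper bound: stones in the two middle rows, consecutive ones joined by bridges, reach the short
  sides through a ziggurat or a bridge; the links have disjoint carriers, so Black answers inside the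
  carrier in which White plays.

  Lower bound: there are finitely many shapes of at most ten columns in which White, moving first,
  connects the long sides whatever Black does. A virtual connection has a stone in every translate
  of every such shape. Reading the board column by column and remembering which shapes still need a
  stone gives a finite automaton, whose states bound how far the number of stones so far can fall
  short of two per three columns: by at most two stones. The shapes, White's strategies and the
  states come from a computer search.
\<close>

section \<open>Maker-Breaker games\<close>

text \<open>Both colours play one abstract game, and their strategies are assembled by the AND and
  OR rules of H-search: links that meet in an own stone can be answered independently if their
  carriers are disjoint, and threats cannot all be stopped by one move if no cell lies in all of
  them. Verifying a strategy is then a computation of carriers, with no search through the game
  tree. The topological input is that a white chain excludes a black one, shown by the parity of
  crossings.

  The rate 2/3 comes from bridges in the middle rows, which advance by one and by two columns in
  turn. The lower bound is an amortised count: sparse stretches are possible locally and have to be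
  paid for later, so the deficit is carried along with the shapes that are still open. Nothing
  special happens at the ends of the board. Shapes that stick out are ignored, and the deficit of up
  to two stones that may be left after the last column is the 2 subtracted in the formula.\<close>

text \<open>Maker owns the stones \<open>S\<close>, plays inside \<open>C\<close> and wants to own a set satisfying \<open>G\<close>.\<close>

inductive wins_first :: "('a set \<Rightarrow> bool) \<Rightarrow> 'a set \<Rightarrow> 'a set \<Rightarrow> bool"
  and wins_second :: "('a set \<Rightarrow> bool) \<Rightarrow> 'a set \<Rightarrow> 'a set \<Rightarrow> bool"
  for G :: "'a set \<Rightarrow> bool" where
  done_first: "G S \<Longrightarrow> wins_first G S C"
| done_second: "G S \<Longrightarrow> wins_second G S C"
| play: "x \<in> C \<Longrightarrow> wins_second G (insert x S) (C - {x}) \<Longrightarrow> wins_first G S C"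
| reply: "C \<noteq> {} \<Longrightarrow> (\<And>y. y \<in> C \<Longrightarrow> wins_first G S (C - {y})) \<Longrightarrow> wins_second G S C"

section \<open>Monotonicity and transport of strategies\<close>

lemma wins_carrier_mono:
  shows "wins_first G S C \<Longrightarrow> C \<subseteq> D \<Longrightarrow> wins_first G S D"
    and "wins_second G S C \<Longrightarrow> C \<subseteq> D \<Longrightarrow> wins_second G S D"
proof (induction arbitrary: D and D rule: wins_first_wins_second.inducts)
  case (play x C S)
  have "wins_second G (insert x S) (D - {x})" using play by blast
  then show ?case using play by (meson subsetD wins_first_wins_second.play)
next
  case (reply C S)
  \<comment> \<open>The move z stands in for a Breaker move outside C. It exists because
    \<open>reply\<close> demands a nonempty carrier, without which an empty carrier would count as
    won.\<close>
  obtain z where z: "z \<in> C" using reply by blast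
  show ?case
  proof (rule wins_first_wins_second.reply)
    show "D \<noteq> {}" using reply by blast
    fix y assume "y \<in> D"
    show "wins_first G S (D - {y})"
    proof (cases "y \<in> C")
      case True
      then show ?thesis using reply by blast
    next
      case False
      then have "C - {z} \<subseteq> D - {y}" using reply by blast
      then show ?thesis using reply z by blast
    qed
  qed
qed (auto intro: wins_first_wins_second.intros)

text \<open>Maker pretends that Breaker has already spent a move on some cell of the carrier; giving
  that cell back is harmless.\<close>

lemma wins_second_imp_first:
  assumes "wins_second G S C" shows "wins_first G S C"
  using assms
proof cases
  case reply
  then show ?thesis by (meson Diff_subset ex_in_conv wins_carrier_mono(1))
qed (rule done_first)

text \<open>The added stones may lie in C as well: \<open>play\<close> does not forbid a move onto
  an own stone, which is then a pass.\<close>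

lemma wins_stones_mono:
  assumes G: "\<And>X Y. G X \<Longrightarrow> X \<subseteq> Y \<Longrightarrow> G Y"
  shows "wins_first G S C \<Longrightarrow> S \<subseteq> T \<Longrightarrow> wins_first G T C"
    and "wins_second G S C \<Longrightarrow> S \<subseteq> T \<Longrightarrow> wins_second G T C"
proof (induction arbitrary: T and T rule: wins_first_wins_second.inducts)
  case (play x C S)
  then show ?case by (meson insert_mono wins_first_wins_second.play)
qed (auto intro: wins_first_wins_second.intros G)

lemma wins_goal_mono:
  assumes "\<And>X. G X \<Longrightarrow> H X"
  shows "wins_first G S C \<Longrightarrow> wins_first H S C"
    and "wins_second G S C \<Longrightarrow> wins_second H S C"
  by (induction rule: wins_first_wins_second.inducts)
    (auto intro: wins_first_wins_second.intros assms)

text \<open>Maker never owns cells outside \<open>S \<union> C\<close>, so the goal has to be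
  transported only for subsets of U. With \<open>id\<close> as the map this also exchanges goals
  that can be compared only on the board.\<close>

lemma wins_image:
  assumes "inj_on f U" and "\<And>X. X \<subseteq> U \<Longrightarrow> G X \<Longrightarrow> H (f ` X)"
  shows "wins_first G S C \<Longrightarrow> S \<union> C \<subseteq> U \<Longrightarrow> wins_first H (f ` S) (f ` C)"
    and "wins_second G S C \<Longrightarrow> S \<union> C \<subseteq> U \<Longrightarrow> wins_second H (f ` S) (f ` C)"
proof (induction rule: wins_first_wins_second.inducts)
  case (play x C S)
  have "f ` C - {f x} = f ` (C - {x})"
    using inj_on_image_set_diff[OF assms(1), of C "{x}"] play by auto
  moreover have "wins_second H (insert (f x) (f ` S)) (f ` (C - {x}))"
    using play by auto
  ultimately show ?case using play(1) by (metis image_eqI wins_first_wins_second.play)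
next
  case (reply C S)
  show ?case
  proof (rule wins_first_wins_second.reply)
    fix z assume "z \<in> f ` C"
    then obtain y where y: "y \<in> C" "z = f y" by blast
    have "f ` C - {z} = f ` (C - {y})"
      using inj_on_image_set_diff[OF assms(1), of C "{y}"] reply y by auto
    moreover have "S \<union> (C - {y}) \<subseteq> U" using reply by blast
    ultimately show "wins_first H (f ` S) (f ` C - {z})" using reply y by simp
  qed (use reply in auto)
qed (auto intro: done_first done_second assms(2))

text \<open>Carriers and stones may overlap. A Maker move on the own stone x is a pass and can be
  omitted by \<open>wins_second_imp_first\<close>; if x is the only cell of the carrier, Breaker can
  take it without effect, so the goal must already hold.\<close>

lemma wins_drop_own:
  shows "wins_first G S C \<Longrightarrow> x \<in> S \<Longrightarrow> wins_first G S (C - {x})"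
    and "wins_second G S C \<Longrightarrow> x \<in> S \<Longrightarrow> wins_second G S (C - {x})"
proof (induction rule: wins_first_wins_second.inducts)
  case (play z C S)
  show ?case
  proof (cases "z = x")
    case True
    then show ?thesis using play by (metis insert_absorb wins_second_imp_first)
  next
    case False
    have "C - {x} - {z} = C - {z} - {x}" by blast
    then have "wins_second G (insert z S) (C - {x} - {z})" using play by simp
    then show ?thesis using play False by (intro wins_first_wins_second.play[of z]) auto
  qed
next
  case (reply C S)
  show ?case
  proof (cases "C - {x} = {}")
    case True
    then have "C = {x}" using reply by blast
    then have "wins_first G S {}" using reply by fastforce
    then have "G S" by cases auto
    then show ?thesis by (rule done_second)
  next
    case False
    show ?thesis
    proof (rule wins_first_wins_second.reply[OF False])
      fix y assume "y \<in> C - {x}"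
      then have "wins_first G S (C - {y} - {x})" using reply by blast
      moreover have "C - {x} - {y} = C - {y} - {x}" by blast
      ultimately show "wins_first G S (C - {x} - {y})" by simp
    qed
  qed
qed (auto intro: done_first done_second)

section \<open>The OR rule and the AND rule\<close>

text \<open>The OR rule. Whatever Breaker takes, some threat does not involve that cell, and Maker
  carries it out. The move \<open>x i\<close> belongs to the cells of its threat because Breaker
  could occupy it.\<close>

lemma wins_second_threats:
  assumes "I \<noteq> {}" "\<And>i. i \<in> I \<Longrightarrow> wins_second G (insert (x i) S) (C i)"
    and "(\<Inter>i\<in>I. insert (x i) (C i)) = {}"
  shows "wins_second G S (\<Union>i\<in>I. insert (x i) (C i))"
proof (rule reply)
  show "(\<Union>i\<in>I. insert (x i) (C i)) \<noteq> {}" using assms(1) by blast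
  fix y assume "y \<in> (\<Union>i\<in>I. insert (x i) (C i))"
  obtain i where i: "i \<in> I" "y \<notin> insert (x i) (C i)" using assms(3) by blast
  have "wins_second G (insert (x i) S) (insert (x i) (C i) - {x i})"
    using wins_drop_own(2)[OF assms(2)[OF i(1)], of "x i"] by simp
  then have "wins_first G S (insert (x i) (C i))" by (intro play) auto
  then show "wins_first G S ((\<Union>i\<in>I. insert (x i) (C i)) - {y})"
    by (rule wins_carrier_mono) (use i in blast)
qed

text \<open>The moment after Breaker has moved in the carrier of G: Maker is on the move there,
  while the game for H is untouched. The induction hypothesis enters as \<open>IH\<close> and
  \<open>same\<close>, so that the argument serves for either carrier.\<close>

lemma wins_conj_aux:
  assumes "\<And>X Y. G X \<Longrightarrow> X \<subseteq> Y \<Longrightarrow> G Y" "\<And>X Y. H X \<Longrightarrow> X \<subseteq> Y \<Longrightarrow> H Y"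
    and IH: "\<And>x S. x \<in> C \<Longrightarrow> wins_second G S (C - {x}) \<Longrightarrow> wins_second H S D
       \<Longrightarrow> wins_second (\<lambda>X. G X \<and> H X) S ((C - {x}) \<union> D)"
    and same: "wins_second G S C \<Longrightarrow> wins_second (\<lambda>X. G X \<and> H X) S (C \<union> D)"
    and G: "wins_first G S C" and H: "wins_second H S D" and disj: "C \<inter> D = {}"
  shows "wins_first (\<lambda>X. G X \<and> H X) S (C \<union> D)"
  using G
proof cases
  \<comment> \<open>G is already reached, so Maker can be regarded as second player in both
    games.\<close>
  case done_first
  then show ?thesis using same wins_second_imp_first done_second by metis
next
  case (play x)
  have "wins_second H (insert x S) D" by (rule wins_stones_mono(2)[OF _ H]) (use assms(2) in auto)
  then have "wins_second (\<lambda>X. G X \<and> H X) (insert x S) ((C - {x}) \<union> D)" using IH play by blast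
  moreover have "(C - {x}) \<union> D = C \<union> D - {x}" using disj play by blast
  ultimately show ?thesis using play by (metis UnI1 wins_first_wins_second.play)
qed

text \<open>The AND rule. Breaker's move lies in only one carrier, and Maker answers there. Both
  goals are judged on all stones, so by upward closure an answer in one carrier can only help the
  other.\<close>

lemma wins_second_conj:
  assumes "\<And>X Y. G X \<Longrightarrow> X \<subseteq> Y \<Longrightarrow> G Y" "\<And>X Y. H X \<Longrightarrow> X \<subseteq> Y \<Longrightarrow> H Y"
    and "finite C" "finite D" "C \<inter> D = {}" "wins_second G S C" "wins_second H S D"
  shows "wins_second (\<lambda>X. G X \<and> H X) S (C \<union> D)"
  using assms(3-)
\<comment> \<open>Breaker decides in which order the two games progress, so the induction is on the
  total size of the carriers and not on either derivation.\<close>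
proof (induction "card C + card D" arbitrary: C D S rule: less_induct)
  case less
  have replies: "wins_first G S (C - {y})" if "wins_second G S C" "y \<in> C"
    for G :: "'a set \<Rightarrow> bool" and S C y
    using that by (blast elim: wins_second.cases intro: done_first)
  show ?case
  proof (cases "C \<union> D = {}")
    case True
    \<comment> \<open>With an empty carrier \<open>reply\<close> is impossible, so both goals hold
      already.\<close>
    then have "wins_second G S {}" "wins_second H S {}" using less.prems by auto
    then have "G S" "H S" by (blast elim: wins_second.cases)+
    then show ?thesis by (simp add: done_second)
  next
    case False
    show ?thesis
    proof (rule reply[OF False])
      fix y assume "y \<in> C \<union> D"
      then consider "y \<in> C" | "y \<in> D" by blast
      then show "wins_first (\<lambda>X. G X \<and> H X) S (C \<union> D - {y})"
      proof cases
        case 1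
        have c: "card (C - {y}) < card C" using 1 less.prems by (meson card_Diff1_less)
        have "wins_first (\<lambda>X. G X \<and> H X) S ((C - {y}) \<union> D)"
        proof (rule wins_conj_aux[OF assms(1,2)])
          fix x S assume "x \<in> C - {y}" "wins_second G S (C - {y} - {x})" "wins_second H S D"
          moreover have "card (C - {y} - {x}) \<le> card (C - {y})"
            by (simp add: card_mono less.prems)
          ultimately show "wins_second (\<lambda>X. G X \<and> H X) S ((C - {y} - {x}) \<union> D)"
            using c less.prems by (intro less.hyps) auto
        next
          assume "wins_second G S (C - {y})"
          then show "wins_second (\<lambda>X. G X \<and> H X) S ((C - {y}) \<union> D)"
            using c less.prems by (intro less.hyps) auto
        next
          show "wins_first G S (C - {y})" using replies less.prems 1 by blast
        qed (use less.prems in auto)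
        moreover have "(C - {y}) \<union> D = C \<union> D - {y}" using 1 less.prems by blast
        ultimately show ?thesis by simp
      next
        case 2
        have c: "card (D - {y}) < card D" using 2 less.prems by (meson card_Diff1_less)
        have sw: "(\<lambda>X. G X \<and> H X) = (\<lambda>X. H X \<and> G X)" by auto
        have "wins_first (\<lambda>X. H X \<and> G X) S ((D - {y}) \<union> C)"
        proof (rule wins_conj_aux[OF assms(2,1)])
          fix x S assume "x \<in> D - {y}" "wins_second H S (D - {y} - {x})" "wins_second G S C"
          moreover have "card (D - {y} - {x}) \<le> card (D - {y})"
            by (simp add: card_mono less.prems)
          ultimately show "wins_second (\<lambda>X. H X \<and> G X) S ((D - {y} - {x}) \<union> C)"
            unfolding sw[symmetric] Un_commute[of _ C]
            using c less.prems by (intro less.hyps) auto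
        next
          assume "wins_second H S (D - {y})"
          then show "wins_second (\<lambda>X. H X \<and> G X) S ((D - {y}) \<union> C)"
            unfolding sw[symmetric] Un_commute[of _ C]
            using c less.prems by (intro less.hyps) auto
        next
          show "wins_first H S (D - {y})" using replies less.prems 2 by blast
        qed (use less.prems in auto)
        moreover have "(D - {y}) \<union> C = C \<union> D - {y}" using 2 less.prems by blast
        ultimately show ?thesis by (simp add: sw)
      qed
    qed
  qed
qed

section \<open>Hex as a Maker-Breaker game\<close>

lemma finite_hex_cells [simp]: "finite (hex_cells n)"
proof -
  have "hex_cells n = {..<4} \<times> {..<n}" by (auto simp: hex_cells_def)
  then show ?thesis by simp
qed

lemma black_connected_mono: "black_connected n B \<Longrightarrow> B \<subseteq> B' \<Longrightarrow> black_connected n B'"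
  unfolding black_connected_def by (meson order_trans)

text \<open>The game names a winner only on a full board, whereas a strategy stops once its goal is
  reached. In between, arbitrary moves keep the chain.\<close>

lemma black_connected_wins:
  assumes "black_connected n B" "B \<union> W \<subseteq> hex_cells n"
  shows "black_wins_bm n B W \<and> black_wins_wm n B W"
  using assms
proof (induction "card (hex_cells n - B - W)" arbitrary: B W rule: less_induct)
  case less
  show ?case
  proof (cases "B \<union> W = hex_cells n")
    case True
    then show ?thesis using less by (auto intro: full_bm full_wm)
  next
    case False
    have smaller: "card (hex_cells n - insert x B - W) < card (hex_cells n - B - W)"
      "card (hex_cells n - B - insert x W) < card (hex_cells n - B - W)"
      if "x \<in> hex_cells n" "x \<notin> B" "x \<notin> W" for x
      using that by (auto intro!: psubset_card_mono simp del: card_Diff_insert)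
    have "black_wins_wm n B W"
    proof (rule move_w[OF False], intro allI impI, elim conjE)
      fix x assume x: "x \<in> hex_cells n" "x \<notin> B" "x \<notin> W"
      then show "black_wins_bm n B (insert x W)" using less.hyps[OF smaller(2)] less.prems by blast
    qed
    moreover obtain x where "x \<in> hex_cells n" "x \<notin> B" "x \<notin> W"
      using False less.prems by blast
    moreover from this have "black_wins_wm n (insert x B) W"
      using less.hyps[OF smaller(1)] less.prems black_connected_mono[of n B "insert x B"] by blast
    ultimately show ?thesis by (auto intro: move_b)
  qed
qed

text \<open>The carrier consists of all empty cells, so moves in the carrier and moves in the game
  coincide.\<close>

lemma black_strategy:
  shows "wins_first (black_connected n) B C \<Longrightarrow>
      B \<union> W \<subseteq> hex_cells n \<Longrightarrow> C = hex_cells n - B - W \<Longrightarrow> black_wins_bm n B W"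
    and "wins_second (black_connected n) B C \<Longrightarrow>
      B \<union> W \<subseteq> hex_cells n \<Longrightarrow> C = hex_cells n - B - W \<Longrightarrow> black_wins_wm n B W"
proof (induction arbitrary: W and W rule: wins_first_wins_second.inducts)
  case (play x C B)
  have "black_wins_wm n (insert x B) W" using play by (intro play.IH) auto
  then show ?case using play by (auto intro: move_b)
next
  case (reply C B)
  show ?case
  proof (rule move_w)
    show "B \<union> W \<noteq> hex_cells n" using reply by blast
    show "\<forall>x. x \<in> hex_cells n \<and> x \<notin> B \<and> x \<notin> W \<longrightarrow> black_wins_bm n B (insert x W)"
    proof (intro allI impI, elim conjE)
      fix x assume x: "x \<in> hex_cells n" "x \<notin> B" "x \<notin> W"
      show "black_wins_bm n B (insert x W)"
        by (rule reply.IH[of x]) (use x reply.prems in auto)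
    qed
  qed
qed (simp_all add: black_connected_wins)

section \<open>White's strategies and blocking sets\<close>

text \<open>White wins by definition when Black fails, so the goal is phrased negatively. It is
  upward closed, which makes White a Maker too.\<close>

definition blocks :: "nat \<Rightarrow> cell set \<Rightarrow> bool" where
  "blocks n X \<longleftrightarrow> (\<forall>B. B \<inter> X = {} \<longrightarrow> \<not> black_connected n B)"

lemma blocks_mono: "blocks n X \<Longrightarrow> X \<subseteq> Y \<Longrightarrow> blocks n Y"
  unfolding blocks_def by blast

text \<open>Black never plays on W and W only grows, so a block persists until the board is full and
  contradicts the black chain required there.\<close>

lemma blocked_black_loses:
  shows "black_wins_bm n B W \<Longrightarrow> B \<union> W \<subseteq> hex_cells n \<Longrightarrow> B \<inter> W = {} \<Longrightarrow> \<not> blocks n W"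
    and "black_wins_wm n B W \<Longrightarrow> B \<union> W \<subseteq> hex_cells n \<Longrightarrow> B \<inter> W = {} \<Longrightarrow> \<not> blocks n W"
proof (induction rule: black_wins_bm_black_wins_wm.inducts)
  case (move_w B W)
  then obtain x where x: "x \<in> hex_cells n" "x \<notin> B" "x \<notin> W" by blast
  moreover have "B \<union> insert x W \<subseteq> hex_cells n" "B \<inter> insert x W = {}" using move_w x by auto
  ultimately have "\<not> blocks n (insert x W)" using move_w by blast
  then show ?case using blocks_mono by blast
qed (auto simp: blocks_def)

text \<open>A White win is the underivability of a Black win, so the game rules are inverted. While
  a cell is empty only \<open>move_b\<close> or \<open>move_w\<close> could have been applied, and
  the strategy refutes their premises.\<close>

lemma white_strategy:
  shows "wins_first (blocks n) W C \<Longrightarrow> B \<union> W \<subseteq> hex_cells n \<Longrightarrow> B \<inter> W = {} \<Longrightarrow>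
      C = hex_cells n - B - W \<Longrightarrow> \<not> black_wins_wm n B W"
    and "wins_second (blocks n) W C \<Longrightarrow> B \<union> W \<subseteq> hex_cells n \<Longrightarrow> B \<inter> W = {} \<Longrightarrow>
      C = hex_cells n - B - W \<Longrightarrow> \<not> black_wins_bm n B W"
proof (induction arbitrary: B and B rule: wins_first_wins_second.inducts)
  case (play x C W)
  have "\<not> black_wins_bm n B (insert x W)" by (rule play.IH) (use play in auto)
  moreover have "B \<union> W \<noteq> hex_cells n" using play by blast
  ultimately show ?case using play.prems \<open>x \<in> C\<close> by (subst black_wins_wm.simps) blast
next
  case (reply C W)
  have "\<not> black_wins_wm n (insert x B) W" if "x \<in> C" for x
    by (rule reply.IH[OF that]) (use reply that in auto)
  moreover have "B \<union> W \<noteq> hex_cells n" using reply by blast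
  ultimately show ?case using reply.prems by (subst black_wins_bm.simps) blast
qed (use blocked_black_loses in auto)

text \<open>The parity of the number of times the path crosses the ray that runs to the left just below
  the cell \<open>q\<close>; a path ending in the last row is continued downwards.\<close>

fun crossing :: "cell \<Rightarrow> cell list \<Rightarrow> bool" where
  "crossing q [] = False"
| "crossing q [u] = (fst u = 3 \<and> fst q = 3 \<and> snd u < snd q)"
| "crossing q (u # v # p) =
    (((fst u = fst q \<and> fst v = Suc (fst q) \<and> snd u < snd q) \<or>
      (fst v = fst q \<and> fst u = Suc (fst q) \<and> snd v < snd q)) \<noteq> crossing q (v # p))"

section \<open>Parity of crossings: a discrete Jordan curve argument\<close>

text \<open>The two rays differ only in the cell \<open>(r, c)\<close>, which the path
  avoids.\<close>

lemma crossing_right: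
  "(r, c) \<notin> set p \<Longrightarrow> crossing (r, c) p = crossing (r, Suc c) p"
  by (induction "(r, c)" p rule: crossing.induct) (auto simp: less_Suc_eq)

lemma hex_adj_iff:
  "hex_adj (r, c) (r', c') \<longleftrightarrow> r' = r \<and> (c' = Suc c \<or> c = Suc c') \<or>
     r' = Suc r \<and> (c' = c \<or> c = Suc c') \<or> r = Suc r' \<and> (c' = c \<or> c' = Suc c)"
proof -
  have "int a - int b = 0 \<longleftrightarrow> a = b" "int a - int b = 1 \<longleftrightarrow> a = Suc b" "int a - int b = -1 \<longleftrightarrow> b = Suc a"
    for a b by linarith+
  then show ?thesis by (simp add: hex_adj_def) blast
qed

lemma hex_adj_sym: "hex_adj p q \<longleftrightarrow> hex_adj q p"
  by (cases p; cases q) (auto simp: hex_adj_iff)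

text \<open>The rays below \<open>(r, c)\<close> and \<open>(Suc r, c')\<close> bound the strip of
  cells \<open>(Suc r, b)\<close> with b < c'. A step crosses exactly one of them iff it enters or
  leaves the strip; the avoided cells prevent it from slipping round the end of the strip.\<close>

lemma crossing_edge:
  assumes "hex_adj (a, b) (a', b')" "\<not> (a = r \<and> b = c)" "\<not> (a' = r \<and> b' = c)"
    "\<not> (a = Suc r \<and> b = c')" "\<not> (a' = Suc r \<and> b' = c')" "c' = c \<or> c = Suc c'"
  shows "((a = r \<and> a' = Suc r \<and> b < c \<or> a' = r \<and> a = Suc r \<and> b' < c) \<noteq>
      (a = Suc r \<and> a' = Suc (Suc r) \<and> b < c' \<or> a' = Suc r \<and> a = Suc (Suc r) \<and> b' < c'))
    = ((a = Suc r \<and> b < c') \<noteq> (a' = Suc r \<and> b' < c'))"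
proof -
  have 1: "b < c' \<longleftrightarrow> b' < c'" if "a' = Suc r" "a = Suc r"
    using assms that by (simp add: hex_adj_iff) linarith
  have 2: "b < c \<longleftrightarrow> b' < c'" if "a' = Suc r" "a = r"
    using assms that by (simp add: hex_adj_iff) linarith
  have 3: "b' < c \<longleftrightarrow> b < c'" if "a = Suc r" "a' = r"
    using assms that by (simp add: hex_adj_iff) linarith
  have "a = a' \<or> a' = Suc a \<or> a = Suc a'" using assms(1) by (auto simp: hex_adj_iff)
  then consider "a' = Suc r" "a = Suc r" | "a' = Suc r" "a = r" | "a = Suc r" "a' = r"
    | "a' = Suc r" "a = Suc (Suc r)" | "a = Suc r" "a' = Suc (Suc r)" | "a \<noteq> Suc r" "a' \<noteq> Suc r"
    by blast
  then show ?thesis by cases (simp_all add: 1 2 3)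
qed

text \<open>Summed along the path, \<open>crossing_edge\<close> telescopes and leaves the first
  cell. A last cell inside the strip, possible only for Suc r = 3, is cancelled by the continuation
  of the path below row 3.\<close>

lemma crossing_down:
  assumes "successively hex_adj p" "p \<noteq> []" "fst (last p) = 3" "r < 3"
    and "(r, c) \<notin> set p" "(Suc r, c') \<notin> set p" "c' = c \<or> c = Suc c'"
  shows "(crossing (r, c) p \<noteq> crossing (Suc r, c') p) \<longleftrightarrow>
    (fst (hd p) = Suc r \<and> snd (hd p) < c')"
  using assms
proof (induction p rule: induct_list012)
  case (3 u v p)
  obtain a b where u: "u = (a, b)" by force
  obtain a' b' where v: "v = (a', b')" by force
  have IH: "(crossing (r, c) (v # p) \<noteq> crossing (Suc r, c') (v # p)) \<longleftrightarrow> (a' = Suc r \<and> b' < c')"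
    using 3 v by auto
  have adj: "hex_adj (a, b) (a', b')" using 3 u v by simp
  have ne: "\<not> (a = r \<and> b = c)" "\<not> (a' = r \<and> b' = c)" "\<not> (a = Suc r \<and> b = c')"
    "\<not> (a' = Suc r \<and> b' = c')"
    using 3 u v by auto
  have edge: "((a = r \<and> a' = Suc r \<and> b < c \<or> a' = r \<and> a = Suc r \<and> b' < c) \<noteq>
      (a = Suc r \<and> a' = Suc (Suc r) \<and> b < c' \<or> a' = Suc r \<and> a = Suc (Suc r) \<and> b' < c'))
    = ((a = Suc r \<and> b < c') \<noteq> (a' = Suc r \<and> b' < c'))"
    by (rule crossing_edge[OF adj ne \<open>c' = c \<or> c = Suc c'\<close>])
  have "(x \<noteq> y) = m \<Longrightarrow> (e \<noteq> g) = (l \<noteq> m) \<Longrightarrow> ((e \<noteq> x) \<noteq> (g \<noteq> y)) = l" for x y e g l m :: bool by auto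
  from this[OF IH edge] show ?case
    unfolding u v crossing.simps fst_conv snd_conv list.sel .
qed auto

text \<open>All cells of the path in row r lie to the left, so every passage between row r and the
  row below meets the ray. The path ends below the board; hence the number of passages is odd iff it
  starts in row r or above.\<close>

lemma crossing_last_column:
  assumes "successively hex_adj p" "p \<noteq> []" "fst (last p) = 3" "r \<le> 3"
    and "(r, c) \<notin> set p" "\<forall>q\<in>set p. snd q \<le> c"
  shows "crossing (r, c) p \<longleftrightarrow> fst (hd p) \<le> r"
  using assms
proof (induction p rule: induct_list012)
  case (2 u)
  then show ?case by (cases u) (auto simp: le_less)
next
  case (3 u v p)
  obtain a b where u: "u = (a, b)" by force
  obtain a' b' where v: "v = (a', b')" by force
  have IH: "crossing (r, c) (v # p) \<longleftrightarrow> a' \<le> r" using 3 v by auto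
  have adj: "hex_adj (a, b) (a', b')" using 3 u v by simp
  have ne: "a = r \<Longrightarrow> b < c" "a' = r \<Longrightarrow> b' < c" using 3 u v by (auto simp: le_less)
  show ?case
    using IH adj ne unfolding u v hex_adj_iff by (auto simp: u v)
qed auto

text \<open>A path that starts in row 0 does not start in any strip below a cell, so the boundary
  term of \<open>crossing_down\<close> vanishes.\<close>

lemma crossing_adjacent:
  assumes "successively hex_adj p" "p \<noteq> []" "fst (hd p) = 0" "fst (last p) = 3"
    and "x \<notin> set p" "y \<notin> set p" "fst x < 4" "fst y < 4" "hex_adj x y"
  shows "crossing x p = crossing y p"
proof -
  obtain r c r' c' where xy: "x = (r, c)" "y = (r', c')" by (metis surj_pair)
  have down: "crossing (r, c) p = crossing (Suc r, c') p"
    if "r < 3" "(r, c) \<notin> set p" "(Suc r, c') \<notin> set p" "c' = c \<or> c = Suc c'" for r c c'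
    using crossing_down[OF assms(1,2,4) that] assms(3) by simp
  show ?thesis
    using assms(5-9) down crossing_right[of r c p] crossing_right[of r' c' p]
    unfolding xy hex_adj_iff by fastforce
qed

section \<open>Chains of adjacent cells\<close>

text \<open>The adjacency is a parameter because chains of cells and chains of cell codes are both
  used. A single cell in both A and B is a chain.\<close>

definition linked :: "('a \<Rightarrow> 'a \<Rightarrow> bool) \<Rightarrow> 'a set \<Rightarrow> 'a set \<Rightarrow> 'a set \<Rightarrow> bool" where
  "linked adj A B X \<longleftrightarrow>
    (\<exists>p. p \<noteq> [] \<and> hd p \<in> A \<and> last p \<in> B \<and> set p \<subseteq> X \<and> successively adj p)"

lemma linked_mono: "linked adj A B X \<Longrightarrow> X \<subseteq> Y \<Longrightarrow> linked adj A B Y"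
  unfolding linked_def by blast

lemma linked_trans:
  assumes "linked adj A {x} X" "linked adj {x} B X" shows "linked adj A B X"
proof -
  obtain p q where p: "p \<noteq> []" "hd p \<in> A" "last p = x" "set p \<subseteq> X" "successively adj p"
    and q: "q \<noteq> []" "hd q = x" "last q \<in> B" "set q \<subseteq> X" "successively adj q"
    using assms unfolding linked_def by auto
  obtain q' where q': "q = x # q'" using q by (cases q) auto
  have "successively adj (p @ q')"
    using p q q' by (auto simp: successively_append_iff successively_Cons)
  moreover have "last (p @ q') \<in> B" "hd (p @ q') \<in> A" "set (p @ q') \<subseteq> X"
    using p q q' by (auto simp: last_append split: if_splits)
  ultimately show ?thesis using p unfolding linked_def by (metis append_is_Nil_conv)
qed

lemma linked_image:
  assumes "linked adj A B X" and "\<And>x y. x \<in> X \<Longrightarrow> y \<in> X \<Longrightarrow> adj x y \<Longrightarrow> adj' (f x) (f y)"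
    and "f ` (A \<inter> X) \<subseteq> A'" "f ` (B \<inter> X) \<subseteq> B'"
  shows "linked adj' A' B' (f ` X)"
proof -
  obtain p where p: "p \<noteq> []" "hd p \<in> A" "last p \<in> B" "set p \<subseteq> X" "successively adj p"
    using assms(1) unfolding linked_def by auto
  have "successively adj' (map f p)"
    unfolding successively_map by (rule successively_mono[OF p(5)]) (use p(4) assms(2) in auto)
  moreover have "hd p \<in> A \<inter> X" "last p \<in> B \<inter> X"
    using p hd_in_set[OF p(1)] last_in_set[OF p(1)] by auto
  then have "hd (map f p) \<in> A'" "last (map f p) \<in> B'"
    using p(1) assms(3,4) by (simp_all add: hd_map last_map image_subset_iff)
  ultimately show ?thesis unfolding linked_def using p by (intro exI[of _ "map f p"]) auto
qed

lemma linked_sym: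
  assumes "linked adj A B X" "\<And>x y. adj x y \<Longrightarrow> adj y x" shows "linked adj B A X"
proof -
  obtain p where p: "p \<noteq> []" "hd p \<in> A" "last p \<in> B" "set p \<subseteq> X" "successively adj p"
    using assms(1) unfolding linked_def by auto
  have "successively adj (rev p)"
    unfolding successively_rev by (rule successively_mono[OF p(5)]) (use assms(2) in auto)
  then show ?thesis using p unfolding linked_def
    by (intro exI[of _ "rev p"]) (auto simp: hd_rev last_rev)
qed

lemma successively_nth:
  "successively P xs \<longleftrightarrow> (\<forall>i. Suc i < length xs \<longrightarrow> P (xs ! i) (xs ! Suc i))"
  by (induction P xs rule: successively.induct) (auto simp: nth_Cons split: nat.splits)

lemma black_connected_iff_linked:
  "black_connected n B \<longleftrightarrow>
    linked hex_adj {q. snd q = 0} {q. snd q = n - 1} (B \<inter> hex_cells n)"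
  unfolding black_connected_def linked_def successively_nth by auto

text \<open>Along a black chain that avoids p the parity of crossings is constant by
  \<open>crossing_adjacent\<close>. In column 0 nothing lies to the left, so it is even; in the last
  column it is odd.\<close>

lemma linked_top_bottom_blocks:
  assumes "linked hex_adj {q. fst q = 0} {q. fst q = 3} X" "X \<subseteq> hex_cells n"
  shows "blocks n X"
  unfolding blocks_def
proof (intro allI impI notI)
  fix B assume "B \<inter> X = {}" "black_connected n B"
  obtain p where p: "p \<noteq> []" "fst (hd p) = 0" "fst (last p) = 3" "set p \<subseteq> X"
    "successively hex_adj p"
    using assms(1) unfolding linked_def by auto
  obtain b where b: "b \<noteq> []" "snd (hd b) = 0" "snd (last b) = n - 1" "set b \<subseteq> hex_cells n"
    "set b \<subseteq> B" "successively hex_adj b"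
    using \<open>black_connected n B\<close> unfolding black_connected_iff_linked linked_def by auto
  have off: "x \<notin> set p" if "x \<in> set b" for x using that p b \<open>B \<inter> X = {}\<close> by blast
  have "crossing (hd b) p = crossing (last b) p"
    using b(1,4,6) off
  proof (induction b rule: induct_list012)
    case (3 u v b)
    have "crossing u p = crossing v p"
      by (rule crossing_adjacent) (use 3 p in \<open>auto simp: hex_cells_def\<close>)
    then show ?case using 3 by auto
  qed auto
  moreover have "\<not> crossing (hd b) p"
  proof -
    have "\<not> crossing (r, 0) q" for r q
      by (induction "(r, 0::nat)" q rule: crossing.induct) auto
    then show ?thesis using b(2) by (metis prod.collapse)
  qed
  moreover have "crossing (last b) p"
  proof -
    obtain r where l: "last b = (r, n - 1)" using b(3) by (metis prod.collapse)
    then have "r \<le> 3" "(r, n - 1) \<notin> set p"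
      using b off last_in_set[of b] by (auto simp: hex_cells_def)
    moreover have "\<forall>q\<in>set p. snd q \<le> n - 1" using p assms by (auto simp: hex_cells_def)
    ultimately show ?thesis using crossing_last_column[OF p(5,1,3), of r "n - 1"] p l by simp
  qed
  ultimately show False by blast
qed

text \<open>If B missed C, all of C would be empty, and White could open there and complete the
  chain.\<close>

lemma virtual_connection_hits_carrier:
  assumes "wins_first (linked hex_adj {q. fst q = 0} {q. fst q = 3}) {} C"
    and "C \<subseteq> hex_cells n" "virtual_connection n B"
  shows "B \<inter> C \<noteq> {}"
proof
  assume "B \<inter> C = {}"
  have "wins_first (blocks n) {} C"
    using wins_image(1)[of id C _ "blocks n", OF _ _ assms(1)] linked_top_bottom_blocks assms(2)
    by (auto simp: subset_trans)
  then have "wins_first (blocks n) {} (hex_cells n - B - {})"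
    by (rule wins_carrier_mono) (use assms \<open>B \<inter> C = {}\<close> in blast)
  then have "\<not> black_wins_wm n B {}"
    by (rule white_strategy) (use assms in \<open>auto simp: virtual_connection_def\<close>)
  then show False using assms by (simp add: virtual_connection_def)
qed

section \<open>A chain of bridges between two ziggurats\<close>

lemma linked_Cons:
  assumes "x \<in> X" "y \<in> B" "y \<in> X" "adj x y" shows "linked adj {x} B X"
  using assms by (auto simp: linked_def intro!: exI[of _ "[x, y]"])

lemma wins_pair:
  assumes "linked adj A B (insert x S)" "linked adj A B (insert y S)" "x \<noteq> y"
  shows "wins_second (linked adj A B) S {x, y}"
proof -
  have "wins_second (linked adj A B) S (\<Union>i\<in>{x, y}. insert (id i) {})"
    using assms by (intro wins_second_threats) (auto intro: done_second)
  then show ?thesis by (rule wins_carrier_mono) auto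
qed

lemma wins_bridge:
  assumes "p \<in> S" "q \<in> S" "adj p x" "adj x q" "adj p y" "adj y q" "x \<noteq> y"
  shows "wins_second (linked adj {p} {q}) S {x, y}"
proof (rule wins_pair)
  show "linked adj {p} {q} (insert x S)" "linked adj {p} {q} (insert y S)"
    unfolding linked_def using assms
    by (auto intro: exI[of _ "[p, x, q]"] exI[of _ "[p, y, q]"])
qed fact

lemma wins_edge_bridge:
  assumes "p \<in> S" "adj p x" "adj p y" "x \<in> A" "y \<in> A" "x \<noteq> y"
  shows "wins_second (linked adj {p} A) S {x, y}"
  by (rule wins_pair) (use assms in \<open>auto intro: linked_Cons\<close>)

lemma wins_linked_trans:
  assumes "wins_second (linked adj A {x}) S C" "wins_second (linked adj {x} B) S D"
    and "finite C" "finite D" "C \<inter> D = {}"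
  shows "wins_second (linked adj A B) S (C \<union> D)"
proof -
  have "wins_second (\<lambda>X. linked adj A {x} X \<and> linked adj {x} B X) S (C \<union> D)"
    using assms by (intro wins_second_conj) (auto intro: linked_mono)
  then show ?thesis by (rule wins_goal_mono(2)[rotated]) (auto intro: linked_trans)
qed

text \<open>The classical edge template. The threats use {u, e1, e2}, {v, e2, e3} and {w, u, g, e0,
  e1}: the first two share only e2, which the third avoids. The stone w is joined to p by the bridge
  {u, g}.\<close>

lemma wins_ziggurat:
  assumes "p \<in> S" "{e0, e1, e2, e3} \<subseteq> A" "distinct [u, v, w, g, e0, e1, e2, e3]"
    and "adj p u" "adj u e1" "adj u e2" "adj p v" "adj v e2" "adj v e3"
    and "adj p g" "adj g w" "adj u w" "adj w e0" "adj w e1"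
  shows "wins_second (linked adj {p} A) S {u, v, w, g, e0, e1, e2, e3}"
proof -
  define x where "x = (\<lambda>i::nat. if i = 0 then u else if i = 1 then v else w)"
  define C where "C = (\<lambda>i::nat. if i = 0 then {e1, e2} else if i = 1 then {e2, e3} else {u, g} \<union> {e0, e1})"
  have step: "wins_second (linked adj {p} {z}) (insert z S) {}" if "adj p z" for z
    using that assms(1) by (intro done_second linked_Cons) auto
  have "wins_second (linked adj {p} A) (insert u S) ({} \<union> {e1, e2})"
    using assms by (intro wins_linked_trans[OF step] wins_edge_bridge) auto
  moreover have "wins_second (linked adj {p} A) (insert v S) ({} \<union> {e2, e3})"
    using assms by (intro wins_linked_trans[OF step] wins_edge_bridge) auto
  moreover have "wins_second (linked adj {p} A) (insert w S) ({u, g} \<union> {e0, e1})"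
    using assms by (intro wins_linked_trans[of _ _ w] wins_edge_bridge wins_bridge) auto
  ultimately have "wins_second (linked adj {p} A) (insert (x i) S) (C i)" if "i \<in> {0, 1, 2}" for i
    using that by (auto simp: x_def C_def simp del: Un_insert_right Un_insert_left)
  moreover have "(\<Inter>i\<in>{0, 1, 2}. insert (x i) (C i)) = {}"
    using assms(3) by (auto simp: x_def C_def)
  ultimately have "wins_second (linked adj {p} A) S (\<Union>i\<in>{0, 1, 2}. insert (x i) (C i))"
    by (intro wins_second_threats) auto
  then show ?thesis by (rule wins_carrier_mono) (auto simp: x_def C_def)
qed

lemma wins_drop_stones:
  assumes "wins_second G S C" "finite S" shows "wins_second G S (C - S)"
proof -
  have "wins_second G S (C - T)" if "finite T" "T \<subseteq> S" for T
    using that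
  proof (induction T rule: finite_induct)
    case (insert x T)
    then have "wins_second G S (C - T - {x})" using wins_drop_own(2)[of G S "C - T" x] by simp
    moreover have "C - insert x T = C - T - {x}" by blast
    ultimately show ?case by simp
  qed (use assms in simp)
  then show ?thesis using assms by simp
qed

section \<open>The zigzag of stones\<close>

text \<open>The steps alternate between (1, 1) and (-1, 2), two bridge vectors that together span
  three columns and return to the same row. The chain starts in column 2, from where a ziggurat
  reaches column 0. The common neighbours of consecutive stones form \<open>gap\<close>.\<close>

definition stone :: "nat \<Rightarrow> cell" where
  "stone i = (if even i then (1, 3 * (i div 2) + 2) else (2, 3 * (i div 2) + 3))"

definition gap :: "nat \<Rightarrow> cell set" where
  "gap i = (if even i then {(1, 3 * (i div 2) + 3), (2, 3 * (i div 2) + 2)}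
     else {(1, 3 * (i div 2) + 4), (2, 3 * (i div 2) + 4)})"

text \<open>The cells u, v, w, g, e0, e1, e2, e3 of \<open>wins_ziggurat\<close> around the stone
  (1, 2), in this order.\<close>

definition left_ziggurat :: "cell set" where
  "left_ziggurat = {(1, 1), (2, 1), (0, 1), (0, 2), (0, 0), (1, 0), (2, 0), (3, 0)}"

lemma stone_simps [simp]:
  "stone (2 * j) = (1, 3 * j + 2)" "stone (Suc (2 * j)) = (2, 3 * j + 3)"
  by (simp_all add: stone_def)

lemma gap_simps [simp]:
  "gap (2 * j) = {(1, 3 * j + 3), (2, 3 * j + 2)}"
  "gap (Suc (2 * j)) = {(1, 3 * j + 4), (2, 3 * j + 4)}"
  by (simp_all add: gap_def)

lemma nat_even_odd_cases:
  obtains j where "i = 2 * j" | j where "i = Suc (2 * j)"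
  by (metis oddE evenE Suc_eq_plus1)

lemma gap_disjoint: "i \<noteq> l \<Longrightarrow> gap i \<inter> gap l = {}"
  by (cases i rule: nat_even_odd_cases; cases l rule: nat_even_odd_cases) (simp; presburger)+

lemma gap_left_ziggurat: "left_ziggurat \<inter> gap i = {}"
  by (cases i rule: nat_even_odd_cases) (auto simp: left_ziggurat_def)

lemma wins_gap:
  assumes "stone i \<in> S" "stone (Suc i) \<in> S"
  shows "wins_second (linked hex_adj {stone i} {stone (Suc i)}) S (gap i)"
proof (cases i rule: nat_even_odd_cases)
  case (1 j)
  then show ?thesis using assms by (auto intro!: wins_bridge simp: hex_adj_iff)
next
  case (2 j)
  have "stone (Suc i) = (1, 3 * j + 5)" using stone_simps(1)[of "Suc j"] 2 by simp
  then show ?thesis using 2 assms by (auto intro!: wins_bridge simp: hex_adj_iff)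
qed

lemma wins_chain:
  assumes "\<And>l. l \<le> i \<Longrightarrow> stone l \<in> S"
  shows "wins_second (linked hex_adj {q. snd q = 0} {stone i}) S (left_ziggurat \<union> (\<Union>l<i. gap l))"
  using assms
proof (induction i)
  case 0
  have "wins_second (linked hex_adj {(1, 2)} {q. snd q = 0}) S left_ziggurat"
    unfolding left_ziggurat_def using 0[of 0] stone_simps(1)[of 0]
    by (intro wins_ziggurat) (simp_all add: hex_adj_iff numeral_eq_Suc)
  \<comment> \<open>The template leads from the stone to the edge; the chain is read from left to
    right.\<close>
  then have "wins_second (linked hex_adj {q. snd q = 0} {(1, 2)}) S left_ziggurat"
    by (rule wins_goal_mono(2)[rotated]) (auto intro: linked_sym simp: hex_adj_sym)
  then show ?case using stone_simps(1)[of 0] by (simp add: numeral_eq_Suc)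
next
  case (Suc i)
  have "wins_second (linked hex_adj {q. snd q = 0} {stone (Suc i)}) S
      ((left_ziggurat \<union> (\<Union>l<i. gap l)) \<union> gap i)"
  proof (rule wins_linked_trans[OF Suc.IH wins_gap])
    show "finite (left_ziggurat \<union> (\<Union>l<i. gap l))" "finite (gap i)"
      by (auto simp: left_ziggurat_def gap_def)
    have "gap l \<inter> gap i = {}" if "l < i" for l using gap_disjoint that by simp
    then show "(left_ziggurat \<union> (\<Union>l<i. gap l)) \<inter> gap i = {}"
      using gap_left_ziggurat[of i] by blast
  qed (use Suc.prems in auto)
  then show ?case by (simp add: lessThan_Suc Un_ac)
qed

text \<open>The connection Y to the right edge is left open, since its form depends on n modulo
  3.\<close>

lemma virtual_connection_stones:
  assumes right: "wins_second (linked hex_adj {stone i} {q. snd q = n - 1}) (stone ` {..i}) Y"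
    and Y: "finite Y" "Y \<subseteq> hex_cells n" "Y \<inter> left_ziggurat = {}" "\<And>l. l < i \<Longrightarrow> Y \<inter> gap l = {}"
    and n: "snd (stone i) < n"
  shows "virtual_connection n (stone ` {..i})"
proof -
  let ?C = "left_ziggurat \<union> (\<Union>l<i. gap l)"
  have mono: "snd (stone l) \<le> snd (stone m)" if "l \<le> m" for l m
    using that by (cases l rule: nat_even_odd_cases; cases m rule: nat_even_odd_cases) auto
  have cells: "stone ` {..i} \<subseteq> hex_cells n"
  proof
    fix q assume "q \<in> stone ` {..i}"
    then obtain l where l: "l \<le> i" "q = stone l" by auto
    then have "snd (stone l) < n" using mono[of l i] n by simp
    moreover have "fst (stone l) < 4" by (simp add: stone_def)
    ultimately show "q \<in> hex_cells n" using l by (cases "stone l") (simp add: hex_cells_def)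
  qed
  have "?C \<subseteq> hex_cells n"
  proof -
    have "snd (stone 0) < n" using mono[of 0 i] n by simp
    then have "left_ziggurat \<subseteq> hex_cells n"
      by (auto simp: left_ziggurat_def hex_cells_def stone_def)
    moreover have "gap l \<subseteq> hex_cells n" if "l < i" for l
    proof -
      have "snd (stone (Suc l)) < n" using mono[of "Suc l" i] n that by simp
      then show ?thesis
        by (cases l rule: nat_even_odd_cases) (auto simp: hex_cells_def stone_def)
    qed
    ultimately show ?thesis by blast
  qed
  moreover have "wins_second (linked hex_adj {q. snd q = 0} {q. snd q = n - 1}) (stone ` {..i}) (?C \<union> Y)"
  proof (rule wins_linked_trans[OF wins_chain right])
    show "finite ?C" by (auto simp: left_ziggurat_def gap_def)
    show "?C \<inter> Y = {}" using Y by blast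
  qed (use Y in auto)
  ultimately have "wins_second (black_connected n) (id ` stone ` {..i}) (id ` (?C \<union> Y))"
    using cells Y by (intro wins_image(2)[where U = "hex_cells n"])
      (auto simp: black_connected_iff_linked Int_absorb2)
  then have "wins_second (black_connected n) (stone ` {..i}) (?C \<union> Y)" by simp
  \<comment> \<open>The carrier must consist of empty cells. Removing the stones from it spares a
    proof that they do not occur there.\<close>
  then have "wins_second (black_connected n) (stone ` {..i}) (?C \<union> Y - stone ` {..i})"
    by (rule wins_drop_stones) simp
  then have "wins_second (black_connected n) (stone ` {..i}) (hex_cells n - stone ` {..i} - {})"
    by (rule wins_carrier_mono) (use \<open>?C \<subseteq> hex_cells n\<close> Y in auto)
  then have "black_wins_wm n (stone ` {..i}) {}"
    by (rule black_strategy) (use cells in auto)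
  then show ?thesis using cells by (simp add: virtual_connection_def)
qed

lemma card_stones: "card (stone ` {..i}) = Suc i"
proof -
  have "inj stone"
    by (rule injI, rule ccontr) (auto simp: stone_def split: if_splits elim!: evenE oddE)
  then show ?thesis by (simp add: card_image inj_on_subset)
qed

text \<open>For n = 3 * j + 4 and n = 3 * j + 5 the last stone stands in the last column but one,
  and two edge cells suffice. For n = 3 * j + 6 it stands in the third column from the right and is
  joined by the left ziggurat turned by 180 degrees.\<close>

lemma upper_bound:
  assumes "n \<ge> 4"
  shows "\<exists>B. virtual_connection n B \<and> int (card B) = \<lceil>2 / 3 * real n - 2\<rceil>"
proof -
  define k where "k = (n - 1) div 3"
  have "k \<noteq> 0" using assms by (simp add: k_def div_eq_0_iff)
  then obtain j where j: "k = Suc j" using not0_implies_Suc by blast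
  have "n = 3 * k + 1 \<or> n = 3 * k + 2 \<or> n = 3 * k + 3" unfolding k_def using assms by presburger
  then consider "n = 3 * j + 4" | "n = 3 * j + 5" | "n = 3 * j + 6" using j by fastforce
  then show ?thesis
  proof cases
    case 1
    have "virtual_connection n (stone ` {..2 * j})"
    proof (rule virtual_connection_stones)
      have "(1, 3 * j + 2) \<in> stone ` {..2 * j}" using stone_simps(1)[of j] by (metis atMost_iff image_eqI order_refl)
      then show "wins_second (linked hex_adj {stone (2 * j)} {q. snd q = n - 1}) (stone ` {..2 * j})
        {(1, 3 * j + 3), (0, 3 * j + 3)}"
        unfolding stone_simps using 1 by (intro wins_edge_bridge) (simp_all add: hex_adj_iff)
      fix l assume "l < 2 * j"
      then show "{(1, 3 * j + 3), (0, 3 * j + 3)} \<inter> gap l = {}"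
        by (cases l rule: nat_even_odd_cases) auto
    qed (use 1 in \<open>auto simp: hex_cells_def left_ziggurat_def\<close>)
    moreover have "\<lceil>2 / 3 * real n - 2\<rceil> = 2 * int j + 1" using 1 by linarith
    ultimately show ?thesis using card_stones[of "2 * j"] by (intro exI conjI) auto
  next
    case 2
    have "virtual_connection n (stone ` {..Suc (2 * j)})"
    proof (rule virtual_connection_stones)
      have "(2, 3 * j + 3) \<in> stone ` {..Suc (2 * j)}" using stone_simps(2)[of j] by (metis atMost_iff image_eqI order_refl)
      then show "wins_second (linked hex_adj {stone (Suc (2 * j))} {q. snd q = n - 1}) (stone ` {..Suc (2 * j)})
        {(2, 3 * j + 4), (1, 3 * j + 4)}"
        unfolding stone_simps using 2 by (intro wins_edge_bridge) (simp_all add: hex_adj_iff)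
      fix l assume "l < Suc (2 * j)"
      then show "{(2, 3 * j + 4), (1, 3 * j + 4)} \<inter> gap l = {}"
        by (cases l rule: nat_even_odd_cases) (simp; presburger)+
    qed (use 2 in \<open>auto simp: hex_cells_def left_ziggurat_def\<close>)
    moreover have "\<lceil>2 / 3 * real n - 2\<rceil> = 2 * int j + 2" using 2 by linarith
    ultimately show ?thesis using card_stones[of "Suc (2 * j)"] by (intro exI conjI) auto
  next
    case 3
    have "virtual_connection n (stone ` {..Suc (2 * j)})"
    proof (rule virtual_connection_stones)
      have "(2, 3 * j + 3) \<in> stone ` {..Suc (2 * j)}" using stone_simps(2)[of j] by (metis atMost_iff image_eqI order_refl)
      then show "wins_second (linked hex_adj {stone (Suc (2 * j))} {q. snd q = n - 1}) (stone ` {..Suc (2 * j)})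
        {(2, 3 * j + 4), (1, 3 * j + 4), (3, 3 * j + 4), (3, 3 * j + 3),
         (3, 3 * j + 5), (2, 3 * j + 5), (1, 3 * j + 5), (0, 3 * j + 5)}"
        unfolding stone_simps using 3 by (intro wins_ziggurat) (simp_all add: hex_adj_iff)
      fix l assume "l < Suc (2 * j)"
      then show "{(2, 3 * j + 4), (1, 3 * j + 4), (3, 3 * j + 4), (3, 3 * j + 3),
         (3, 3 * j + 5), (2, 3 * j + 5), (1, 3 * j + 5), (0, 3 * j + 5)} \<inter> gap l = {}"
        by (cases l rule: nat_even_odd_cases) (simp; presburger)+
    qed (use 3 in \<open>auto simp: hex_cells_def left_ziggurat_def\<close>)
    moreover have "\<lceil>2 / 3 * real n - 2\<rceil> = 2 * int j + 2" using 3 by linarith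
    ultimately show ?thesis using card_stones[of "Suc (2 * j)"] by (intro exI conjI) auto
  qed
qed

section \<open>Checking strategies\<close>

text \<open>The cell \<open>(r, c)\<close> is coded as \<open>4 * c + r\<close>, a set of cells as the bits of a natural number.\<close>

definition code_adj :: "nat \<Rightarrow> nat \<Rightarrow> bool" where
  "code_adj k l \<longleftrightarrow> l = k + 4 \<or> k = l + 4 \<or> l = k + 1 \<and> k mod 4 \<noteq> 3 \<or> k = l + 1 \<and> l mod 4 \<noteq> 3 \<or>
     l = k + 3 \<and> k mod 4 \<noteq> 0 \<or> k = l + 3 \<and> l mod 4 \<noteq> 0"

definition bits :: "nat \<Rightarrow> nat set" where
  "bits m = {k. bit m k}"

text \<open>White's sides count as vertices that are always occupied, so linking the sides has the
  same form as linking two stones.\<close>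

datatype vertex = Top | Bottom | Cell nat

fun cells_of :: "vertex \<Rightarrow> nat set" where
  "cells_of Top = {k. k mod 4 = 0}"
| "cells_of Bottom = {k. k mod 4 = 3}"
| "cells_of (Cell k) = {k}"

fun occupied :: "nat set \<Rightarrow> vertex \<Rightarrow> bool" where
  "occupied S (Cell k) = (k \<in> S)"
| "occupied S _ = True"

text \<open>Contacts with a side are listed only in the direction from \<open>Top\<close> to
  \<open>Bottom\<close>, in which all strategies are read.\<close>

fun touching :: "vertex \<Rightarrow> vertex \<Rightarrow> bool" where
  "touching (Cell k) (Cell l) = code_adj k l"
| "touching Top (Cell k) = (k mod 4 = 0)"
| "touching (Cell k) Bottom = (k mod 4 = 3)"
| "touching _ _ = False"

text \<open>A strategy for linking two vertices as the second player: nothing is left to do, or the two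
  links to an own stone \<open>x\<close> are played independently, or there is a list of moves each of which
  creates such a position, and no cell disturbs all of them.\<close>

datatype strategy = Adj | Via nat strategy strategy | Threats "(nat \<times> strategy) list"

definition Join :: "nat \<Rightarrow> strategy \<Rightarrow> strategy \<Rightarrow> nat \<times> strategy" where
  "Join x t u = (x, Via x t u)"

definition Bridge :: "nat \<Rightarrow> nat \<Rightarrow> strategy" where
  "Bridge x y = Threats [Join x Adj Adj, Join y Adj Adj]"

text \<open>The carrier is an output. The result is \<open>None\<close> if the two halves of a
  \<open>Via\<close> overlap or all threats have a common cell. The accumulators i and u hold the
  intersection and the union of the threats read so far; both are initialised by the first threat,
  because an intersection of no sets has no bit mask.\<close>

fun carrier :: "nat list \<Rightarrow> vertex \<Rightarrow> vertex \<Rightarrow> strategy \<Rightarrow> nat option"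
  and threats :: "nat list \<Rightarrow> vertex \<Rightarrow> vertex \<Rightarrow> (nat \<times> strategy) list \<Rightarrow> nat \<Rightarrow> nat \<Rightarrow> nat option"
  where
  "carrier S a b Adj = (if touching a b then Some 0 else None)"
| "carrier S a b (Via x t u) = (if x \<in> set S then
     (case carrier S a (Cell x) t of None \<Rightarrow> None
      | Some m \<Rightarrow> (case carrier S (Cell x) b u of None \<Rightarrow> None
        | Some k \<Rightarrow> if and m k = 0 then Some (or m k) else None)) else None)"
| "carrier S a b (Threats []) = None"
| "carrier S a b (Threats ((x, t) # ts)) = (case carrier (x # S) a b t of None \<Rightarrow> None
     | Some m \<Rightarrow> threats S a b ts (or m (2 ^ x)) (or m (2 ^ x)))"
| "threats S a b [] i u = (if i = 0 then Some u else None)"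
| "threats S a b ((x, t) # ts) i u = (case carrier (x # S) a b t of None \<Rightarrow> None
     | Some m \<Rightarrow> threats S a b ts (and i (or m (2 ^ x))) (or u (or m (2 ^ x))))"

lemma bits_0 [simp]: "bits 0 = {}"
  and bits_or [simp]: "bits (or m k) = bits m \<union> bits k"
  and bits_and [simp]: "bits (and m k) = bits m \<inter> bits k"
  and bits_exp [simp]: "bits (2 ^ x) = {x}"
  by (auto simp: bits_def bit_or_iff bit_and_iff bit_exp_iff)

lemma finite_bits [simp]: "finite (bits m)"
proof (rule finite_subset)
  show "bits m \<subseteq> {..<m}"
  proof
    fix k assume "k \<in> bits m"
    then have "2 ^ k \<le> m" by (auto simp: bits_def bit_iff_odd intro!: leI dest: div_less)
    then show "k \<in> {..<m}" using less_exp[of k] by (simp only: lessThan_iff)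
  qed
qed simp

lemma linked_adjacent:
  assumes "touching a b" "occupied S a" "occupied S b"
  shows "linked code_adj (cells_of a) (cells_of b) S"
proof -
  consider k l where "a = Cell k" "b = Cell l" | k where "a = Top" "b = Cell k"
    | k where "a = Cell k" "b = Bottom"
    using assms(1) by (cases a; cases b) auto
  then show ?thesis
  proof cases
    case (1 k l)
    then show ?thesis using assms by (auto simp: linked_def intro!: exI[of _ "[k, l]"])
  next
    case (2 k)
    then show ?thesis using assms by (auto simp: linked_def intro!: exI[of _ "[k]"])
  next
    case (3 k)
    then show ?thesis using assms by (auto simp: linked_def intro!: exI[of _ "[k]"])
  qed
qed

lemma occupied_mono: "occupied S a \<Longrightarrow> S \<subseteq> T \<Longrightarrow> occupied T a"
  by (cases a) auto

text \<open>\<open>Via\<close> is an instance of the AND rule and \<open>Threats\<close> of the OR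
  rule. J collects the threats already read, and the accumulators are their common cells and their
  union.\<close>

lemma carrier_sound:
  shows "carrier S a b t = Some m \<Longrightarrow> occupied (set S) a \<Longrightarrow> occupied (set S) b \<Longrightarrow>
      wins_second (linked code_adj (cells_of a) (cells_of b)) (set S) (bits m)"
    and "threats S a b ts i u = Some m \<Longrightarrow> occupied (set S) a \<Longrightarrow> occupied (set S) b \<Longrightarrow>
      J \<noteq> {} \<Longrightarrow> (\<And>x C. (x, C) \<in> J \<Longrightarrow>
        wins_second (linked code_adj (cells_of a) (cells_of b)) (insert x (set S)) C) \<Longrightarrow>
      bits i = (\<Inter>(x, C)\<in>J. insert x C) \<Longrightarrow> bits u = (\<Union>(x, C)\<in>J. insert x C) \<Longrightarrow>
      wins_second (linked code_adj (cells_of a) (cells_of b)) (set S) (bits m)"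
proof (induction S a b t and S a b ts i u arbitrary: m and m J rule: carrier_threats.induct)
  case (1 S a b)
  then show ?case by (auto intro!: done_second linked_adjacent split: if_splits)
next
  case (2 S a b x t u)
  then obtain k l where kl: "x \<in> set S" "carrier S a (Cell x) t = Some k"
    "carrier S (Cell x) b u = Some l" "and k l = 0" "m = or k l"
    by (auto split: if_splits option.splits)
  have "bits k \<inter> bits l = {}" using kl(4) by (metis bits_0 bits_and)
  moreover have "wins_second (linked code_adj (cells_of a) {x}) (set S) (bits k)"
    "wins_second (linked code_adj {x} (cells_of b)) (set S) (bits l)"
    using 2 kl by auto
  ultimately have "wins_second (\<lambda>X. linked code_adj (cells_of a) {x} X \<and>
      linked code_adj {x} (cells_of b) X) (set S) (bits k \<union> bits l)"
    by (intro wins_second_conj) (auto intro: linked_mono)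
  then show ?case unfolding kl(5) bits_or
    by (rule wins_goal_mono(2)[rotated]) (auto intro: linked_trans)
next
  case (4 S a b x t ts)
  then obtain k where k: "carrier (x # S) a b t = Some k"
    "threats S a b ts (or k (2 ^ x)) (or k (2 ^ x)) = Some m"
    by (auto split: option.splits)
  have "wins_second (linked code_adj (cells_of a) (cells_of b)) (insert x (set S)) (bits k)"
    using 4 k by (auto intro: occupied_mono)
  \<comment> \<open>After the first threat both accumulators equal its carrier together with its
    move.\<close>
  then show ?case by (intro 4(2)[OF k(1,2), of "{(x, bits k)}"]) (use 4 in auto)
next
  case (5 S a b i u)
  then have "i = 0" "u = m" by (auto split: if_splits)
  then show ?case
    \<comment> \<open>Each threat serves as its own index: \<open>fst\<close> is the move,
      \<open>snd\<close> the carrier.\<close>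
    using wins_second_threats[of J _ fst "set S" snd] 5 by (force simp: case_prod_unfold)
next
  case (6 S a b x t ts i u)
  then obtain k where k: "carrier (x # S) a b t = Some k"
    "threats S a b ts (and i (or k (2 ^ x))) (or u (or k (2 ^ x))) = Some m"
    by (auto split: option.splits)
  have "wins_second (linked code_adj (cells_of a) (cells_of b)) (insert x (set S)) (bits k)"
    using 6 k by (auto intro: occupied_mono)
  then show ?case by (intro 6(2)[OF k(1,2), of "insert (x, bits k) J"]) (use 6 in auto)
qed auto

definition first_carrier :: "nat \<Rightarrow> strategy \<Rightarrow> nat option" where
  "first_carrier x t = map_option (or (2 ^ x)) (carrier [x] Top Bottom t)"

lemma first_carrier_sound:
  assumes "first_carrier x t = Some m"
  shows "wins_first (linked code_adj (cells_of Top) (cells_of Bottom)) {} (bits m)"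
proof -
  obtain k where k: "carrier [x] Top Bottom t = Some k" "m = or (2 ^ x) k"
    using assms by (auto simp: first_carrier_def)
  have "wins_second (linked code_adj (cells_of Top) (cells_of Bottom)) {x} (bits k)"
    using carrier_sound(1)[OF k(1)] by simp
  \<comment> \<open>\<open>play\<close> removes the opening cell from the carrier. It is an own
    stone by then, so the strategy survives.\<close>
  then have "wins_second (linked code_adj (cells_of Top) (cells_of Bottom)) {x} (bits m - {x})"
    using wins_drop_own(2)[of _ "{x}" "bits k" x] unfolding k by (simp add: insert_Diff_if)
  then show ?thesis by (intro play[of x]) (auto simp: k)
qed

text \<open>Opening and strategy are hidden, so that the whole family can be checked by looking up
  the number m.\<close>

definition winning :: "nat \<Rightarrow> bool" where
  "winning m \<longleftrightarrow> (\<exists>x t. first_carrier x t = Some m)"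

lemma winningI: "first_carrier x t = Some m \<Longrightarrow> winning m"
  by (auto simp: winning_def)

section \<open>Counting stones column by column\<close>

definition place :: "nat \<Rightarrow> nat \<Rightarrow> cell" where
  "place c k = (k mod 4, c + k div 4)"

text \<open>Vacuous if the copy of the shape \<open>s\<close> that starts in column \<open>c\<close> leaves the board.\<close>

definition due :: "nat \<Rightarrow> cell set \<Rightarrow> nat \<Rightarrow> nat \<Rightarrow> bool" where
  "due n B c s \<longleftrightarrow> (place c ` bits s \<subseteq> hex_cells n \<longrightarrow> B \<inter> place c ` bits s \<noteq> {})"

lemma inj_place: "inj (place c)"
  by (rule injI) (metis place_def add_left_cancel div_mult_mod_eq prod.inject)

lemma place_add: "r < 4 \<Longrightarrow> place c (4 * q + r) = (r, c + q)"
  by (simp add: place_def)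

lemma code_adj_place:
  assumes "code_adj k l" shows "hex_adj (place c k) (place c l)"
proof -
  have split: "\<exists>q r. i = 4 * q + r \<and> r < 4 \<and> i mod 4 = r" for i :: nat
    by (intro exI[of _ "i div 4"] exI[of _ "i mod 4"]) simp
  have 1: "hex_adj (place c i) (place c (i + 4))" for i
    by (simp add: place_def hex_adj_iff)
  have 2: "hex_adj (place c i) (place c (i + 1))" if ne: "i mod 4 \<noteq> 3" for i
  proof -
    obtain q r where i: "i = 4 * q + r" "r < 4" "r \<noteq> 3" using split[of i] ne by metis
    then have "i + 1 = 4 * q + (r + 1)" by simp
    then show ?thesis using i place_add[of r c q] place_add[of "r + 1" c q] by (simp add: hex_adj_iff)
  qed
  have 3: "hex_adj (place c i) (place c (i + 3))" if ne: "i mod 4 \<noteq> 0" for i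
  proof -
    obtain q r' where "i = 4 * q + r'" "r' < 4" "r' \<noteq> 0" using split[of i] ne by metis
    then obtain r where i: "i = 4 * q + Suc r" "Suc r < 4" by (cases r') auto
    have "i + 3 = 4 * (q + 1) + r" using i by simp
    then have "place c (i + 3) = (r, c + (q + 1))" using i by (simp only: place_add)
    moreover have "place c i = (Suc r, c + q)" using i by (simp only: place_add)
    ultimately show ?thesis by (simp add: hex_adj_iff)
  qed
  consider "l = k + 4" | "k = l + 4" | "l = k + 1" "k mod 4 \<noteq> 3" | "k = l + 1" "l mod 4 \<noteq> 3"
    | "l = k + 3" "k mod 4 \<noteq> 0" | "k = l + 3" "l mod 4 \<noteq> 0"
    using assms unfolding code_adj_def by blast
  then show ?thesis
    by cases (use 1[of k] 1[of l] 2[of k] 2[of l] 3[of k] 3[of l] in \<open>simp_all add: hex_adj_sym\<close>)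
qed

lemma wins_place:
  assumes "wins_first (linked code_adj (cells_of Top) (cells_of Bottom)) {} C"
  shows "wins_first (linked hex_adj {q. fst q = 0} {q. fst q = 3}) {} (place c ` C)"
proof -
  have "wins_first (linked hex_adj {q. fst q = 0} {q. fst q = 3}) (place c ` {}) (place c ` C)"
  proof (rule wins_image(1)[OF _ _ assms, where U = UNIV])
    fix X assume "linked code_adj (cells_of Top) (cells_of Bottom) X"
    then show "linked hex_adj {q. fst q = 0} {q. fst q = 3} (place c ` X)"
      by (rule linked_image) (auto simp: code_adj_place, auto simp: place_def)
  qed (auto simp: inj_place)
  then show ?thesis by simp
qed

text \<open>Shifting columns preserves adjacency and the rows 0 and 3, so White can play the
  strategy in every translate on the board. No bound on c is imposed, as \<open>due\<close> is
  vacuous for the others.\<close>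

lemma first_carrier_due:
  assumes "first_carrier x t = Some m" "virtual_connection n B"
  shows "due n B c m"
  unfolding due_def
  using virtual_connection_hits_carrier[OF wins_place[OF first_carrier_sound[OF assms(1)]] _ assms(2)]
  by blast

text \<open>Rotating the board by 180 degrees reverses the bits of a shape.\<close>

fun rev_bits :: "nat \<Rightarrow> nat \<Rightarrow> nat \<Rightarrow> nat" where
  "rev_bits 0 m a = a"
| "rev_bits (Suc i) m a = rev_bits i (m div 2) (2 * a + m mod 2)"

lemma rev_bits_numeral:
  "rev_bits (numeral i) m a = rev_bits (pred_numeral i) (m div 2) (2 * a + m mod 2)"
  by (simp add: numeral_eq_Suc)

lemma bit_rev_bits:
  "bit (rev_bits i m a) k \<longleftrightarrow> (if k < i then bit m (i - 1 - k) else bit a (k - i))"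
proof (induction i m a arbitrary: k rule: rev_bits.induct)
  case (2 i m a)
  note IH = 2
  have low: "bit (2 * a + m mod 2) 0 \<longleftrightarrow> bit m 0" by (simp add: bit_0)
  have high: "bit (2 * a + m mod 2) (Suc j) \<longleftrightarrow> bit a j" for j by (simp add: bit_Suc)
  consider "k < i" | "k = i" | "k > i" by linarith
  then show ?case
  proof cases
    case 1
    then have "i - k = Suc (i - 1 - k)" by simp
    then have "bit m (i - k) \<longleftrightarrow> bit (m div 2) (i - 1 - k)" by (simp only: bit_Suc)
    then show ?thesis using 1 IH by simp
  next
    case 2
    then show ?thesis using IH low by simp
  next
    case 3
    then have "k - i = Suc (k - Suc i)" by simp
    then show ?thesis using IH 3 high[of "k - Suc i"] by simp
  qed
qed auto

text \<open>The map f is the half turn of w columns: it preserves adjacency and exchanges White's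
  sides, so one strategy serves two shapes. The bound on m keeps all codes below 4 * w, where the
  subtraction is not truncated.\<close>

lemma first_carrier_due_rev:
  assumes "first_carrier x t = Some m" "virtual_connection n B" "m < 2 ^ (4 * w)"
  shows "due n B c (rev_bits (4 * w) m 0)"
proof -
  define f where "f k = 4 * w - 1 - k" for k
  have lt: "k < 4 * w" if "k \<in> bits m" for k
  proof (rule ccontr)
    assume "\<not> k < 4 * w"
    then have "(2::nat) ^ (4 * w) \<le> 2 ^ k" by (intro power_increasing) auto
    then have "m div 2 ^ k = 0" using assms(3) by (intro div_less) linarith
    then show False using that by (simp add: bits_def bit_iff_odd)
  qed
  have "f ` bits m = bits (rev_bits (4 * w) m 0)"
  proof (intro equalityI subsetI)
    fix k assume "k \<in> f ` bits m"
    then obtain j where j: "j \<in> bits m" "k = f j" by blast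
    have "4 * w - 1 - k = j" "k < 4 * w" using lt[OF j(1)] j(2) by (auto simp: f_def)
    then show "k \<in> bits (rev_bits (4 * w) m 0)" using j by (simp add: bits_def bit_rev_bits)
  next
    fix k assume "k \<in> bits (rev_bits (4 * w) m 0)"
    then have "k < 4 * w" "4 * w - 1 - k \<in> bits m"
      by (auto simp: bits_def bit_rev_bits split: if_splits)
    moreover from this have "k = f (4 * w - 1 - k)" by (auto simp: f_def)
    ultimately show "k \<in> f ` bits m" by blast
  qed
  moreover have "wins_first (linked code_adj (cells_of Top) (cells_of Bottom)) (f ` {}) (f ` bits m)"
  proof (rule wins_image(1)[OF _ _ first_carrier_sound[OF assms(1)], where U = "bits m"])
    show "inj_on f (bits m)"
    proof (rule inj_onI)
      fix k l assume "k \<in> bits m" "l \<in> bits m" "f k = f l"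
      then show "k = l" using lt[of k] lt[of l] unfolding f_def by linarith
    qed
  next
    fix X assume X: "X \<subseteq> bits m" "linked code_adj (cells_of Top) (cells_of Bottom) X"
    have sum: "4 * w = f k + k + 1" if "k < 4 * w" for k using that by (simp add: f_def)
    have edge: "f k mod 4 = 3 - k mod 4" if "k < 4 * w" for k
    proof -
      have "k = 4 * (k div 4) + k mod 4" "k mod 4 < 4" by simp_all
      moreover from this have "k div 4 < w" using that by linarith
      ultimately have "f k = 4 * (w - 1 - k div 4) + (3 - k mod 4)" unfolding f_def by linarith
      then show ?thesis by (metis mod_less mod_mult_self4 diff_less_Suc eval_nat_numeral(2) semiring_norm(26,27))
    qed
    have f_mod: "f i mod 4 \<noteq> 3 \<longleftrightarrow> i mod 4 \<noteq> 0" "f i mod 4 \<noteq> 0 \<longleftrightarrow> i mod 4 \<noteq> 3"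
      if "i < 4 * w" for i
    proof -
      have "i mod 4 < 4" by simp
      then show "f i mod 4 \<noteq> 3 \<longleftrightarrow> i mod 4 \<noteq> 0" "f i mod 4 \<noteq> 0 \<longleftrightarrow> i mod 4 \<noteq> 3"
        unfolding edge[OF that] by linarith+
    qed
    have adj: "code_adj (f k) (f l)" if "k < 4 * w" "l < 4 * w" "code_adj k l" for k l
    proof -
      have "f k + k = f l + l" using sum that by (metis add_right_cancel)
      moreover have "i mod 4 \<noteq> 3 \<Longrightarrow> (i + 1) mod 4 \<noteq> 0" "i mod 4 \<noteq> 0 \<Longrightarrow> (i + 3) mod 4 \<noteq> 3" for i :: nat
        by presburger+
      moreover note f_mod[OF that(1)] f_mod[OF that(2)]
      ultimately show ?thesis
        using that(3) unfolding code_adj_def by (elim disjE conjE) simp_all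
    qed
    \<comment> \<open>The rotated chain runs from \<open>Bottom\<close> to \<open>Top\<close> and is
      then read backwards.\<close>
    have "linked code_adj (cells_of Bottom) (cells_of Top) (f ` X)"
      using X(2)
    proof (rule linked_image)
      show "code_adj (f k) (f l)" if "k \<in> X" "l \<in> X" "code_adj k l" for k l
        using adj lt X(1) that by blast
      show "f ` (cells_of Top \<inter> X) \<subseteq> cells_of Bottom" "f ` (cells_of Bottom \<inter> X) \<subseteq> cells_of Top"
        using edge lt X(1) by (auto simp: subset_iff)
    qed
    then show "linked code_adj (cells_of Top) (cells_of Bottom) (f ` X)"
      by (rule linked_sym) (auto simp: code_adj_def)
  qed simp
  ultimately have
    "wins_first (linked code_adj (cells_of Top) (cells_of Bottom)) {} (bits (rev_bits (4 * w) m 0))"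
    by simp
  from virtual_connection_hits_carrier[OF wins_place[OF this] _ assms(2)] show ?thesis
    unfolding due_def by blast
qed

section \<open>The column automaton\<close>

definition column :: "cell set \<Rightarrow> nat \<Rightarrow> nat" where
  "column B c = of_bool ((0, c) \<in> B) + 2 * of_bool ((1, c) \<in> B) + 4 * of_bool ((2, c) \<in> B)
     + 8 * of_bool ((3, c) \<in> B)"

text \<open>A shape met by the column w is discharged. The others lose their four lowest bits, that
  is their first column, and are continued in the next column.\<close>

definition after :: "nat \<Rightarrow> nat list \<Rightarrow> nat list" where
  "after w ss = map (\<lambda>s. s div 16) (filter (\<lambda>s. and s w = 0) ss)"

definition stones :: "nat \<Rightarrow> nat" where
  "stones w = w mod 2 + w div 2 mod 2 + w div 4 mod 2 + w div 8 mod 2"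

fun covered :: "nat list \<Rightarrow> nat \<Rightarrow> bool" where
  "covered [] q = False"
| "covered (p # ps) q = (if and p q = p then True else covered ps q)"

text \<open>Every shape may start anew in every column. The predicate stays folded in the table
  checks, which rewrite with facts collected once per column instead of searching
  \<open>shapes\<close> for every entry.\<close>

definition fresh :: "nat list \<Rightarrow> nat \<Rightarrow> nat \<Rightarrow> bool" where
  "fresh shapes w q \<longleftrightarrow> covered (after w shapes) q"

lemma fresh_after: "list_all (fresh shapes w) (after w shapes)"
proof -
  have "covered ps q" if "q \<in> set ps" for ps q using that by (induction ps) auto
  then show ?thesis by (simp add: list_all_iff fresh_def)
qed

text \<open>In the state \<open>(e, Q)\<close> the shapes in \<open>Q\<close> are due and the stones placed so far fall short of the
  average \<open>2 / 3\<close> per column by at most \<open>e / 3\<close>. The number \<open>j\<close> names the state after a column with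
  stones \<open>w\<close>; it is \<open>0\<close> if such a column completes a due shape without touching it.\<close>

definition column_ok ::
  "nat list \<Rightarrow> (nat \<times> nat list) list \<Rightarrow> nat \<Rightarrow> nat \<times> nat list \<Rightarrow> nat \<Rightarrow> bool" where
  "column_ok shapes states w st j = (case st of (e, Q) \<Rightarrow>
     if e + 2 \<le> 3 * stones w then True
     else if j = 0 then covered (after w Q) 0 \<or> fresh shapes w 0
     else (case states ! j of (e', Q') \<Rightarrow> j < length states \<and> e + 2 \<le> e' + 3 * stones w \<and>
       list_all (\<lambda>q. covered (after w Q) q \<or> fresh shapes w q) Q'))"

lemma bit_column: "r < 4 \<Longrightarrow> bit (column B c) r \<longleftrightarrow> (r, c) \<in> B"
proof -
  assume "r < 4"
  then consider "r = 0" | "r = 1" | "r = 2" | "r = 3" by linarith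
  then show ?thesis
    by cases (simp_all add: column_def bit_iff_odd of_bool_def)
qed

lemma column_less: "column B c < 16"
  by (simp add: column_def of_bool_def)

lemma stones_column: "stones (column B c) = card {r. r < 4 \<and> (r, c) \<in> B}"
proof -
  have "{r. r < 4 \<and> (r, c) \<in> B} = (\<Union>r\<in>{0, 1, 2, 3}. if (r, c) \<in> B then {r} else {})"
    by (auto simp: numeral_eq_Suc less_Suc_eq split: if_splits)
  also have "card \<dots> = stones (column B c)"
    by (simp add: stones_def column_def)
  finally show ?thesis by simp
qed

lemma due_after:
  assumes "due n B c s" "c < n" "and s (column B c) = 0" shows "due n B (Suc c) (s div 16)"
proof -
  have bits_q: "k \<in> bits (s div 16) \<longleftrightarrow> k + 4 \<in> bits s" for k
    by (simp add: bits_def bit_iff_odd power_add div_mult2_eq[symmetric] mult.commute)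
  have shift: "place (Suc c) k = place c (k + 4)" for k by (simp add: place_def)
  have low: "place c k \<notin> B" if "k \<in> bits s" "k < 4" for k
  proof
    assume "place c k \<in> B"
    then have "bit (column B c) k" using that bit_column[of k B c] by (simp add: place_def)
    then have "k \<in> bits (and s (column B c))" using that by (simp add: bits_def bit_and_iff)
    then show False using assms(3) by simp
  qed
  show ?thesis unfolding due_def
  proof
    assume fit: "place (Suc c) ` bits (s div 16) \<subseteq> hex_cells n"
    \<comment> \<open>Column c is on the board, so the whole shape fits as soon as its remaining
      columns do.\<close>
    have "place c k \<in> hex_cells n" if "k \<in> bits s" for k
    proof (cases "k < 4")
      case True
      then show ?thesis using assms(2) by (simp add: place_def hex_cells_def)
    next
      case False
      then have "k - 4 \<in> bits (s div 16)" using that by (simp add: bits_q)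
      then show ?thesis using fit shift[of "k - 4"] False by (auto simp: image_subset_iff)
    qed
    then obtain k where k: "k \<in> bits s" "place c k \<in> B"
      using assms(1) unfolding due_def by blast
    then have "k = (k - 4) + 4" using low[of k] by linarith
    then have "k - 4 \<in> bits (s div 16)" "place (Suc c) (k - 4) \<in> B"
      using k bits_q[of "k - 4"] shift[of "k - 4"] by simp_all
    then show "B \<inter> place (Suc c) ` bits (s div 16) \<noteq> {}" by blast
  qed
qed

text \<open>If q fits on the board, so does its subset p, and a stone in p is a stone in q. Thus a
  state may record a larger shape than the one known to be due.\<close>

lemma due_covered:
  assumes "covered ps q" "\<And>p. p \<in> set ps \<Longrightarrow> due n B c p" shows "due n B c q"
proof -
  obtain p where p: "p \<in> set ps" "and p q = p"
    using assms(1) by (induction ps) (auto split: if_splits)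
  then have "bits p \<subseteq> bits q" using bits_and[of p q] by auto
  then show ?thesis using assms(2)[OF p(1)] unfolding due_def by blast
qed

text \<open>The empty shape fits everywhere and is never hit; it is what remains of a shape passed
  without a stone. This refutes the columns marked 0. The number 0 is free for this mark, since a
  return to the initial state is recognised by the first test of \<open>column_ok\<close>.\<close>

lemma not_due_0: "\<not> due n B c 0"
  by (simp add: due_def)

lemma card_columns:
  assumes "B \<subseteq> hex_cells n"
  shows "card B = (\<Sum>c<n. stones (column B c))"
proof -
  have "B = (\<Union>c\<in>{..<n}. (\<lambda>r. (r, c)) ` {r. r < 4 \<and> (r, c) \<in> B})"
    using assms by (auto simp: hex_cells_def)
  then have "card B = card (\<Union>c\<in>{..<n}. (\<lambda>r. (r, c)) ` {r. r < 4 \<and> (r, c) \<in> B})" by simp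
  also have "\<dots> = (\<Sum>c<n. card ((\<lambda>r. (r, c)) ` {r. r < 4 \<and> (r, c) \<in> B}))"
    by (rule card_UN_disjoint) auto
  also have "\<dots> = (\<Sum>c<n. stones (column B c))"
    by (simp add: stones_column card_image inj_on_def)
  finally show ?thesis .
qed

text \<open>Induction on the number of columns read, with the inequality scaled by three to stay in
  the natural numbers. After the last column only the bound on e is used.\<close>

lemma stones_bound_from_states:
  assumes B: "B \<subseteq> hex_cells n"
    and shapes: "\<And>s c. s \<in> set shapes \<Longrightarrow> due n B c s"
    and start: "states \<noteq> []" "states ! 0 = (0, [])"
    and deficit: "\<And>e Q. (e, Q) \<in> set states \<Longrightarrow> e \<le> 6"
    and step: "\<And>w i. w < 16 \<Longrightarrow> i < length states \<Longrightarrow> \<exists>j. column_ok shapes states w (states ! i) j"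
  shows "2 * n \<le> 3 * card B + 6"
proof -
  have "\<exists>(e, Q)\<in>set states. (\<forall>q\<in>set Q. due n B c q) \<and> 2 * c \<le> 3 * (\<Sum>i<c. stones (column B i)) + e"
    if "c \<le> n" for c
    using that
  proof (induction c)
    case 0
    have "(0, []) \<in> set states" using start by (metis length_greater_0_conv nth_mem)
    then show ?case by (intro bexI[of _ "(0, [])"]) auto
  next
    case (Suc c)
    then obtain e Q where st: "(e, Q) \<in> set states" "\<And>q. q \<in> set Q \<Longrightarrow> due n B c q"
      "2 * c \<le> 3 * (\<Sum>i<c. stones (column B i)) + e" by auto
    let ?w = "column B c"
    obtain j where j: "column_ok shapes states ?w (e, Q) j"
      using step[OF column_less] st(1) by (metis in_set_conv_nth)
    have due: "due n B (Suc c) q" if "covered (after ?w Q) q \<or> fresh shapes ?w q" for q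
    proof -
      have "due n B (Suc c) p" if "p \<in> set (after ?w Q) \<union> set (after ?w shapes)" for p
        using that st(2) shapes due_after[of n B c] Suc.prems by (auto simp: after_def)
      then show ?thesis using that due_covered unfolding fresh_def by blast
    qed
    consider "e + 2 \<le> 3 * stones ?w" | "due n B (Suc c) 0"
      | e' Q' where "(e', Q') \<in> set states" "e + 2 \<le> e' + 3 * stones ?w"
        "list_all (\<lambda>q. covered (after ?w Q) q \<or> fresh shapes ?w q) Q'"
      using j due unfolding column_ok_def by (auto split: if_splits prod.splits) (metis nth_mem)
    then show ?case
    proof cases
      \<comment> \<open>The stones of this column make up for the deficit, so the due shapes are
        forgotten and the count restarts in the initial state.\<close>
      case 1
      have "(0, []) \<in> set states" using start by (metis length_greater_0_conv nth_mem)
      then show ?thesis using st(3) 1 by (intro bexI[of _ "(0, [])"]) auto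
    next
      case 2
      then show ?thesis using not_due_0 by blast
    next
      case (3 e' Q')
      have "due n B (Suc c) q" if "q \<in> set Q'" for q
        using 3(3) that due by (auto simp: list_all_iff)
      then show ?thesis using st(3) 3 by (intro bexI[of _ "(e', Q')"]) auto
    qed
  qed
  from this[of n] obtain e Q where "(e, Q) \<in> set states"
    "2 * n \<le> 3 * (\<Sum>i<n. stones (column B i)) + e" by auto
  then show ?thesis using deficit card_columns[OF B] by fastforce
qed

section \<open>The shapes and the automaton\<close>

text \<open>With these definitions unfolded, rewriting evaluates a strategy. Local definitions in
  the certificates name repeated subtrees.\<close>

lemmas carrier_eval = first_carrier_def Join_def Bridge_def code_adj_def

section \<open>Certificates: White's openings and strategies, shape by shape\<close>

text \<open>The simplest pattern: White opens at 6, the cell (2, 1), keeps the bridge {3, 7} to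
  \<open>Bottom\<close>, and has two disjoint threats 9 and 1 towards \<open>Top\<close>.\<close>

lemma carrier_1:
  "first_carrier 6 (Via 6 (Threats [Join 9 (Bridge 12 8) Adj, Join 1 (Bridge 4 0) (Bridge 5 2)])
    (Bridge 7 3)) = Some 5119"
  by (simp add: carrier_eval)

text \<open>A threat such as 13 may be followed by another list: it is enough that the position
  after it withstands Black's next move.\<close>

lemma carrier_2:
  "first_carrier 12 (Threats [(13, Threats [(14, Via 12 Adj (Via 13 Adj (Via 14 Adj (Bridge 15
    11)))), Join 6 (Threats [Join 1 (Bridge 0 4) (Bridge 5 2), (10, Via 12 Adj (Via 13 Adj (Via 10
    Adj Adj)))]) (Bridge 3 7)]), Join 6 (Threats [(9, Via 12 Adj (Via 9 Adj Adj)), Join 1 (Bridge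
    4 0) (Bridge 5 2)]) (Bridge 7 3), Join 10 (Via 12 Adj (Bridge 9 13)) (Bridge 11 7), (9,
    Threats [(14, Via 9 (Via 12 Adj Adj) (Via 14 (Bridge 10 13) (Bridge 11 15))), Join 3 (Threats
    [Join 2 (Threats [(1, Threats [Join 0 Adj (Via 1 Adj Adj), Join 4 Adj (Via 1 Adj Adj)]), (5,
    Via 12 Adj (Via 9 Adj (Via 5 Adj Adj)))]) Adj, (6, Via 12 Adj (Via 9 Adj (Via 6 Adj Adj)))])
    Adj])]) = Some 65279"
  by (simp add: carrier_eval)

lemma carrier_3:
  "first_carrier 6 (Via 6 (Threats [Join 13 (Bridge 16 12) (Bridge 10 9), Join 5 (Bridge 8 4)
    Adj]) (Bridge 7 3)) = Some 79864"
  by (simp add: carrier_eval)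

text \<open>The opening and the threat 1 are those of \<open>carrier_1\<close>, but the other threat
  is moved to 13 and joined to 6 by a bridge. The new shape avoids cell 8 and uses cell 16, so
  neither shape contains the other.\<close>

lemma carrier_4:
  "first_carrier 6 (Via 6 (Threats [Join 13 (Bridge 16 12) (Bridge 10 9), Join 1 (Bridge 4 0)
    (Bridge 5 2)]) (Bridge 7 3)) = Some 79615"
  by (simp add: carrier_eval)

text \<open>Move 9 is listed twice because 13 can then be joined to \<open>Top\<close> inside {8,
  16} or inside {8, 12}. Only the intersection of all listed carriers has to be empty.\<close>

lemma carrier_5:
  defines "s1 \<equiv> Threats [(6, Via 9 Adj (Threats [(7, Via 6 Adj (Via 7 Adj Adj)), (3, Via 6
    Adj (Via 3 Adj Adj))])), Join 14 Adj (Bridge 15 11)]"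
  shows "first_carrier 13 (Threats [Join 6 (Threats [Join 9 (Via 13 (Bridge 12 16) Adj) Adj, Join
    5 (Bridge 8 4) Adj]) (Bridge 3 7), Join 14 (Threats [Join 12 Adj (Via 13 Adj Adj), Join 16 Adj
    (Via 13 Adj Adj)]) (Bridge 11 15), (9, Via 13 (Threats [Join 16 Adj Adj, Join 8 Adj (Via 9 Adj
    Adj)]) s1), (9, Via 13 (Via 9 (Bridge 12 8) Adj) s1)]) = Some 130040"
  by (simp add: carrier_eval assms)

lemma carrier_6:
  defines "s1 \<equiv> Via 1 (Bridge 0 4) (Bridge 2 5)"
  shows "first_carrier 13 (Threats [Join 14 (Via 13 (Bridge 12 16) Adj) (Bridge 11 15), (12,
    Threats [Join 14 (Via 12 Adj (Via 13 Adj Adj)) (Bridge 11 15), (7, Threats [Join 10 (Via 12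
    Adj (Via 13 Adj Adj)) (Via 7 Adj Adj), Join 6 (Threats [Join 9 (Via 12 Adj Adj) Adj, (1, s1)])
    (Via 7 Adj Adj)])]), (16, Threats [Join 14 (Via 13 (Via 16 Adj Adj) Adj) (Bridge 11 15), (7,
    Threats [Join 10 (Via 16 Adj (Via 13 Adj Adj)) (Via 7 Adj Adj), Join 6 (Threats [Join 9 (Via
    16 Adj (Via 13 Adj Adj)) Adj, (1, s1)]) (Via 7 Adj Adj)])]), (7, Threats [Join 10 (Via 13
    (Bridge 12 16) Adj) (Via 7 Adj Adj), Join 6 (Threats [Join 16 Adj (Via 13 Adj (Bridge 9 10)),
    (1, s1)]) (Via 7 Adj Adj), Join 6 (Threats [Join 9 (Threats [Join 12 Adj Adj, Join 16 Adj (Via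
    13 Adj Adj)]) Adj, (1, s1)]) (Via 7 Adj Adj), Join 6 (Threats [Join 12 Adj (Via 13 Adj (Bridge
    9 10)), (1, s1)]) (Via 7 Adj Adj)])]) = Some 130807"
  by (simp add: carrier_eval assms)

lemma carrier_7:
  "first_carrier 16 (Threats [(17, Threats [(18, Via 16 Adj (Via 17 Adj (Via 18 Adj (Bridge 15
    19)))), (14, Threats [Join 6 (Threats [Join 1 (Bridge 0 4) (Bridge 5 2), (10, Via 16 Adj (Via
    17 Adj (Via 14 Adj (Via 10 Adj Adj))))]) (Bridge 7 3), (11, Via 16 Adj (Via 17 Adj (Via 14 Adj
    (Via 11 Adj Adj))))])]), Join 6 (Threats [Join 1 (Bridge 0 4) (Bridge 2 5), (13, Via 16 Adj
    (Threats [(10, Via 13 Adj (Via 10 Adj Adj)), (9, Via 13 Adj (Via 9 Adj Adj))]))]) (Bridge 3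
    7), Join 14 (Via 16 Adj (Bridge 17 13)) (Bridge 11 15)]) = Some 1044223"
  by (simp add: carrier_eval)

lemma carrier_8:
  defines "s1 \<equiv> Via 10 (Threats [Join 12 Adj (Via 9 Adj Adj), Join 8 Adj (Via 9 Adj Adj)])
    Adj"
  shows "first_carrier 14 (Threats [Join 9 (Bridge 8 12) (Threats [Join 6 Adj (Bridge 7 3), Join
    10 Adj (Via 14 Adj (Bridge 11 15))]), (10, Via 14 (Threats [(9, s1), Join 17 (Bridge 20 16)
    Adj]) (Threats [(7, Via 10 Adj (Via 7 Adj Adj)), Join 15 Adj Adj])), Join 17 (Bridge 20 16)
    (Threats [(15, Via 14 Adj (Via 15 Adj Adj)), (11, Via 14 Adj (Via 11 Adj Adj))]), (10, Via 14
    (Threats [Join 17 (Bridge 20 16) Adj, (9, s1)]) (Threats [Join 11 Adj Adj, (7, Via 10 Adj (Via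
    7 Adj Adj))]))]) = Some 1302472"
  by (simp add: carrier_eval assms)

lemma carrier_9:
  "first_carrier 17 (Threats [Join 18 (Via 17 (Bridge 16 20) Adj) (Bridge 15 19), Join 6 (Threats
    [Join 5 (Bridge 4 8) Adj, Join 13 (Threats [Join 16 Adj Adj, Join 20 Adj (Via 17 Adj Adj)])
    (Bridge 9 10)]) (Bridge 3 7), (16, Threats [Join 18 (Via 16 Adj (Via 17 Adj Adj)) (Bridge 15
    19), Join 6 (Threats [Join 5 (Bridge 4 8) Adj, Join 13 (Via 16 Adj Adj) (Bridge 9 10)])
    (Bridge 3 7)]), (20, Threats [Join 18 (Via 17 (Via 20 Adj Adj) Adj) (Bridge 15 19), Join 6
    (Threats [Join 5 (Bridge 4 8) Adj, Join 13 (Via 20 Adj (Via 17 Adj Adj)) (Bridge 9 10)])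
    (Bridge 3 7)])]) = Some 2074616"
  by (simp add: carrier_eval)

lemma carrier_10:
  defines "s1 \<equiv> Via 13 Adj (Via 14 Adj (Via 11 Adj Adj))"
  shows "first_carrier 11 (Threats [(14, Threats [(13, Threats [Join 5 (Bridge 4 8) (Threats [Join
    3 (Bridge 6 2) Adj, Join 9 Adj s1]), Join 12 Adj s1]), (17, Via 11 (Via 14 (Via 17 (Bridge 16
    20) Adj) Adj) Adj)]), Join 6 (Threats [Join 1 (Bridge 0 4) (Bridge 2 5), Join 9 (Bridge 8 12)
    Adj]) (Threats [Join 3 Adj Adj, Join 10 Adj (Via 11 Adj Adj)]), (10, Via 11 (Threats [Join 17
    (Bridge 16 20) (Via 10 (Bridge 14 13) Adj), Join 5 (Bridge 4 8) (Via 10 (Bridge 6 9) Adj)])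
    Adj), (13, Via 11 (Via 13 (Bridge 12 16) (Bridge 10 14)) Adj)]) = Some 1277823"
  by (simp add: carrier_eval assms)

lemma carrier_11:
  defines "s1 \<equiv> Via 7 (Via 6 (Via 9 Adj Adj) Adj) Adj"
  defines "s2 \<equiv> Threats [Join 8 Adj s1, Join 17 (Bridge 16 20) (Threats [Join 13 Adj s1,
    Join 14 Adj (Threats [Join 15 Adj Adj, Join 10 Adj (Via 7 Adj Adj)])])]"
  defines "s3 \<equiv> Threats [Join 8 Adj (Via 6 (Via 9 Adj Adj) (Via 3 Adj Adj)), Join 17
    (Bridge 16 20) (Threats [Join 13 Adj (Via 3 (Via 9 Adj (Via 6 Adj Adj)) Adj), Join 14 Adj
    (Threats [Join 15 Adj Adj, Join 10 Adj (Via 3 (Via 6 Adj Adj) Adj)])])]"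
  defines "s4 \<equiv> Via 6 (Threats [Join 10 Adj Adj, Join 13 Adj (Via 9 Adj Adj)]) Adj"
  shows "first_carrier 6 (Threats [Join 1 (Bridge 0 4) (Via 6 (Bridge 2 5) (Bridge 3 7)), (7,
    Threats [Join 1 (Bridge 0 4) (Via 7 (Via 6 (Bridge 2 5) Adj) Adj), (9, s2)]), (3, Threats
    [Join 1 (Bridge 0 4) (Via 6 (Bridge 2 5) (Via 3 Adj Adj)), (9, s3)]), (9, Threats [Join 8 Adj
    (Via 6 (Via 9 Adj Adj) (Bridge 3 7)), (7, s2), (3, s3), Join 17 (Bridge 16 20) (Threats [Join
    13 Adj (Via 9 Adj (Via 6 Adj (Bridge 3 7))), Join 14 Adj (Threats [Join 15 Adj Adj, Join 10
    Adj (Via 6 Adj (Bridge 3 7))]), Join 14 Adj (Threats [Join 15 Adj Adj, Join 3 s4 Adj]), Join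
    14 Adj (Threats [Join 15 Adj Adj, Join 7 s4 Adj])])])]) = Some 1304575"
  by (simp add: carrier_eval assms)

lemma carrier_12:
  defines "s1 \<equiv> Threats [Join 17 (Bridge 16 20) (Bridge 13 14), Join 1 (Bridge 0 4) (Via 6
    (Bridge 2 5) Adj)]"
  shows "first_carrier 6 (Threats [Join 1 (Bridge 0 4) (Via 6 (Bridge 2 5) (Bridge 3 7)), Join 17
    (Bridge 16 20) (Threats [Join 14 Adj (Bridge 11 15), Join 13 Adj (Via 6 (Bridge 9 10) (Bridge
    3 7))]), Join 10 s1 (Bridge 7 11), Join 10 s1 (Threats [Join 11 Adj Adj, Join 3 (Via 6 Adj
    Adj) Adj])]) = Some 1306367"
  by (simp add: carrier_eval assms)

lemma carrier_13:
  defines "s1 \<equiv> Via 10 Adj (Via 6 Adj (Via 3 Adj Adj))"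
  shows "first_carrier 6 (Threats [Join 1 (Bridge 4 0) (Via 6 (Bridge 5 2) (Bridge 7 3)), Join 17
    (Bridge 20 16) (Threats [Join 18 Adj (Bridge 19 15), Join 14 Adj (Threats [(10, Via 17 Adj
    (Threats [(7, Via 14 Adj (Via 10 Adj (Via 7 Adj Adj))), (3, Via 14 Adj s1)])), Join 11 Adj
    Adj])]), (11, Threats [Join 17 (Bridge 20 16) (Threats [Join 18 Adj (Bridge 19 15), Join 14
    Adj (Via 11 Adj Adj)]), Join 1 (Bridge 0 4) (Via 6 (Bridge 2 5) (Via 11 (Bridge 7 10) Adj))]),
    (3, Threats [Join 17 (Bridge 20 16) (Threats [Join 18 Adj (Bridge 15 19), Join 14 Adj (Threats
    [(10, s1), Join 11 Adj Adj])]), Join 1 (Bridge 4 0) (Via 3 (Via 6 (Bridge 5 2) Adj) Adj)])]) =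
    Some 2084095"
  by (simp add: carrier_eval assms)

lemma carrier_14:
  defines "s1 \<equiv> Via 3 (Via 2 (Via 9 Adj (Via 5 Adj Adj)) Adj) Adj"
  defines "s2 \<equiv> Threats [Join 11 Adj Adj, Join 6 Adj (Via 3 Adj Adj)]"
  defines "s3 \<equiv> Threats [Join 10 Adj s2, Join 18 (Via 17 Adj Adj) (Bridge 15 19)]"
  shows "first_carrier 3 (Threats [Join 5 (Bridge 4 8) (Via 3 (Bridge 2 6) Adj), Join 6 (Threats
    [Join 1 (Bridge 0 4) (Bridge 2 5), Join 13 (Bridge 12 16) (Bridge 9 10)]) (Via 3 Adj Adj), (2,
    Threats [Join 1 (Bridge 0 4) (Via 3 (Via 2 Adj Adj) Adj), (5, Threats [Join 8 Adj (Via 3 (Via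
    2 (Via 5 Adj Adj) Adj) Adj), (9, Threats [Join 12 Adj s1, Join 17 (Bridge 16 20) (Threats
    [Join 13 Adj s1, Join 18 Adj (Bridge 15 19)])])])]), (17, Threats [Join 18 (Via 17 (Bridge 16
    20) Adj) (Bridge 15 19), Join 13 (Bridge 12 16) s3, Join 10 (Threats [Join 9 (Bridge 8 12)
    Adj, Join 13 (Via 17 (Bridge 16 20) Adj) Adj]) s2, Join 13 (Threats [Join 12 Adj Adj, Join 20
    Adj (Via 17 Adj Adj)]) s3])]) = Some 2080639"
  by (simp add: carrier_eval assms)

lemma carrier_15:
  "first_carrier 11 (Threats [Join 17 (Bridge 16 20) (Threats [Join 14 Adj (Via 11 Adj Adj), Join
    18 Adj (Bridge 15 19)]), Join 6 (Threats [Join 9 (Bridge 8 12) Adj, Join 1 (Bridge 0 4)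
    (Bridge 2 5)]) (Threats [Join 3 Adj Adj, Join 10 Adj (Via 11 Adj Adj)])]) = Some 2088831"
  by (simp add: carrier_eval)

lemma carrier_16:
  defines "s1 \<equiv> Threats [Join 14 Adj (Via 11 Adj Adj), Join 18 Adj (Bridge 15 19)]"
  shows "first_carrier 11 (Threats [Join 13 (Bridge 12 16) (Via 11 (Bridge 10 14) Adj), Join 17
    (Bridge 16 20) s1, (12, Threats [Join 17 (Threats [Join 20 Adj Adj, Join 13 (Via 12 Adj Adj)
    Adj]) s1, Join 6 (Threats [Join 9 (Via 12 Adj Adj) Adj, Join 1 (Bridge 0 4) (Bridge 2 5)])
    (Threats [Join 3 Adj Adj, Join 10 Adj (Via 11 Adj Adj)])]), (10, Threats [Join 17 (Bridge 16
    20) (Threats [Join 13 Adj (Via 10 Adj (Via 11 Adj Adj)), Join 18 Adj (Bridge 15 19)]), (9,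
    Threats [Join 12 Adj (Via 9 Adj (Via 11 (Via 10 Adj Adj) Adj)), Join 1 (Bridge 0 4) (Threats
    [Join 5 Adj (Via 11 (Via 10 (Via 9 Adj Adj) Adj) Adj), Join 2 Adj (Threats [Join 3 Adj Adj,
    Join 6 Adj (Via 11 (Via 10 Adj Adj) Adj)])])])])]) = Some 2096767"
  by (simp add: carrier_eval assms)

lemma carrier_17:
  defines "s1 \<equiv> Threats [Join 1 (Bridge 0 4) (Bridge 2 5), (9, Via 12 Adj (Via 9 Adj
    Adj))]"
  defines "s2 \<equiv> Via 22 (Bridge 21 18) (Bridge 19 23)"
  shows "first_carrier 17 (Threats [Join 6 (Threats [Join 9 (Threats [Join 13 (Via 17 (Bridge 20
    16) Adj) Adj, Join 12 Adj Adj]) Adj, Join 1 (Bridge 4 0) (Bridge 2 5)]) (Bridge 3 7), (12,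
    Threats [Join 6 s1 (Bridge 7 3), (22, Via 12 Adj (Via 17 (Bridge 13 16) s2))]), (22, Via 17
    (Bridge 16 20) (Via 22 (Bridge 18 21) (Bridge 19 23))), (12, Threats [(22, Via 17 (Threats
    [Join 20 Adj Adj, (13, Via 12 Adj (Via 13 Adj Adj))]) s2), Join 6 s1 (Bridge 3 7)])]) = Some
    16724735"
  by (simp add: carrier_eval assms)

lemma carrier_18:
  defines "s1 \<equiv> Via 3 (Via 2 (Via 5 Adj Adj) Adj) Adj"
  defines "s2 \<equiv> Threats [Join 6 (Via 9 Adj Adj) (Via 3 Adj Adj), Join 11 (Bridge 10 14)
    Adj]"
  defines "s3 \<equiv> Threats [Join 16 Adj Adj, Join 8 Adj (Via 9 Adj Adj)]"
  shows "first_carrier 3 (Threats [Join 5 (Bridge 4 8) (Via 3 (Bridge 2 6) Adj), Join 6 (Threats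
    [Join 1 (Bridge 0 4) (Bridge 2 5), Join 13 (Bridge 12 16) (Bridge 9 10)]) (Via 3 Adj Adj), (2,
    Threats [Join 1 (Bridge 0 4) (Via 3 (Via 2 Adj Adj) Adj), (5, Threats [Join 8 Adj s1, Join 13
    (Bridge 12 16) (Threats [Join 9 Adj s1, Join 11 (Bridge 10 14) Adj])])]), (9, Threats [Join 6
    (Via 9 (Bridge 8 12) Adj) (Via 3 Adj Adj), Join 13 (Bridge 12 16) s2, Join 13 s3 s2, (11,
    Threats [Join 10 (Via 9 (Bridge 8 12) Adj) (Via 11 Adj Adj), Join 13 (Bridge 12 16) (Via 11
    (Bridge 10 14) Adj), Join 13 s3 (Via 11 (Bridge 10 14) Adj), Join 17 (Threats [Join 16 Adj
    Adj, Join 13 (Via 9 (Bridge 8 12) Adj) Adj]) (Threats [Join 14 Adj (Via 11 Adj Adj), Join 22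
    (Bridge 18 21) (Bridge 19 23)])])])]) = Some 15695743"
  by (simp add: carrier_eval assms)

lemma carrier_19:
  "first_carrier 16 (Threats [Join 6 (Threats [Join 9 (Threats [Join 8 Adj Adj, (13, Via 16 Adj
    (Via 13 Adj Adj))]) Adj, Join 1 (Bridge 0 4) (Bridge 5 2)]) (Bridge 3 7), (17, Via 16 Adj (Via
    17 Adj (Threats [Join 22 (Bridge 21 18) (Bridge 23 19), (14, Via 16 Adj (Threats [(11, Via 17
    Adj (Via 14 Adj (Via 11 Adj Adj))), (15, Via 17 Adj (Via 14 Adj (Via 15 Adj Adj)))]))])))]) =
    Some 15723519"
  by (simp add: carrier_eval)

text \<open>A frequent pattern: the threats 21 and 9 overlap in the bridge {11, 15}. If Black
  intrudes there, White takes its other cell, and both threats are renewed on disjoint cells. This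
  explains the threats 15 and 11.\<close>

lemma carrier_20:
  defines "s1 \<equiv> Via 21 (Bridge 24 20) (Bridge 18 17)"
  shows "first_carrier 14 (Threats [(21, Via 14 s1 (Bridge 15 11)), Join 9 (Bridge 12 8) (Threats
    [Join 13 Adj (Via 14 Adj (Bridge 15 11)), Join 6 Adj (Bridge 7 3)]), (15, Threats [Join 9
    (Bridge 12 8) (Threats [Join 6 Adj (Bridge 7 3), Join 13 Adj (Via 14 Adj (Via 15 Adj Adj))]),
    (21, Via 14 s1 (Via 15 Adj Adj))]), (11, Threats [Join 9 (Bridge 12 8) (Threats [Join 6 Adj
    (Bridge 7 3), Join 13 Adj (Via 14 Adj (Via 11 Adj Adj))]), (21, Via 11 (Via 21 (Bridge 24 20)
    (Via 14 (Bridge 18 17) Adj)) Adj)])]) = Some 20380616"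
  by (simp add: carrier_eval assms)

lemma carrier_21:
  "first_carrier 12 (Threats [(9, Threats [(6, Via 12 Adj (Threats [(3, Via 9 Adj (Via 6 Adj (Via
    3 Adj Adj))), (7, Via 9 Adj (Via 6 Adj (Via 7 Adj Adj)))])), Join 14 (Threats [Join 21 (Bridge
    20 24) (Bridge 17 18), (10, Via 12 Adj (Via 9 Adj (Via 10 Adj Adj)))]) (Bridge 15 11)]), Join
    14 (Threats [(13, Via 12 Adj (Via 13 Adj Adj)), Join 21 (Bridge 20 24) (Bridge 18 17)])
    (Bridge 15 11), Join 10 (Via 12 Adj (Bridge 9 13)) (Bridge 11 7), (13, Threats [Join 15
    (Threats [Join 18 (Threats [Join 21 (Bridge 24 20) Adj, (17, Via 12 Adj (Via 13 Adj (Via 17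
    Adj Adj)))]) Adj, (14, Via 12 Adj (Via 13 Adj (Via 14 Adj Adj)))]) Adj, Join 6 (Via 12 Adj
    (Via 13 Adj (Bridge 10 9))) (Bridge 7 3)])]) = Some 20381384"
  by (simp add: carrier_eval)

lemma carrier_22:
  defines "s1 \<equiv> Via 21 (Bridge 20 24) (Via 18 Adj (Bridge 15 19))"
  defines "s2 \<equiv> Threats [Join 16 Adj (Via 13 Adj Adj), Join 21 (Bridge 20 24) (Via 18 Adj
    Adj)]"
  defines "s3 \<equiv> Via 14 Adj (Via 18 Adj (Bridge 15 19))"
  defines "s4 \<equiv> Via 14 Adj (Threats [Join 11 Adj Adj, Join 6 (Via 13 Adj (Bridge 9 10))
    (Bridge 3 7)])"
  shows "first_carrier 13 (Threats [Join 6 (Threats [Join 5 (Bridge 4 8) Adj, Join 16 Adj (Via 13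
    Adj (Bridge 9 10))]) (Bridge 3 7), Join 9 (Threats [Join 8 Adj Adj, Join 16 Adj (Via 13 Adj
    Adj)]) (Threats [Join 6 Adj (Bridge 3 7), Join 14 (Via 13 Adj Adj) (Bridge 11 15)]), (16,
    Threats [Join 10 (Via 16 Adj (Via 13 Adj Adj)) (Bridge 7 11), Join 18 (Threats [Join 14 (Via
    13 (Via 16 Adj Adj) Adj) Adj, Join 21 (Bridge 20 24) Adj]) (Bridge 15 19)]), (18, Threats
    [(21, s1), Join 14 s2 (Bridge 11 15), Join 14 s2 (Threats [Join 11 Adj Adj, Join 19 (Via 18
    Adj Adj) Adj]), Join 10 (Threats [Join 16 Adj (Via 13 Adj Adj), Join 5 (Bridge 4 8) (Bridge 6
    9)]) (Threats [Join 11 Adj Adj, (14, s3)])]), (18, Threats [(21, s1), Join 21 (Bridge 20 24)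
    (Via 18 Adj (Threats [Join 19 Adj Adj, (14, s4)])), Join 21 (Bridge 20 24) (Via 18 Adj
    (Threats [Join 15 Adj Adj, (14, s4)])), Join 5 (Bridge 4 8) (Threats [Join 6 Adj (Bridge 3 7),
    Join 6 Adj (Threats [Join 3 Adj Adj, Join 14 (Via 13 (Bridge 9 10) Adj) (Bridge 11 15)]), Join
    9 Adj (Via 13 Adj (Threats [Join 10 Adj (Bridge 7 11), (14, s3)]))])])]) = Some 20836344"
  by (simp add: carrier_eval assms)

lemma carrier_23:
  defines "s1 \<equiv> Threats [Join 12 Adj (Bridge 9 13), Join 5 (Bridge 4 8) (Via 6 Adj Adj)]"
  defines "s2 \<equiv> Threats [Join 11 Adj Adj, Join 3 (Via 6 Adj Adj) Adj]"
  shows "first_carrier 6 (Threats [Join 5 (Bridge 4 8) (Via 6 Adj (Bridge 3 7)), Join 10 s1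
    (Bridge 7 11), Join 10 s1 s2, (12, Threats [Join 9 (Via 12 Adj Adj) (Via 6 Adj (Bridge 3 7)),
    Join 10 (Via 12 Adj (Bridge 9 13)) s2, (13, Threats [Join 10 (Via 12 Adj (Via 13 Adj Adj))
    (Bridge 7 11), Join 18 (Threats [Join 17 (Via 12 Adj (Via 13 Adj Adj)) Adj, Join 21 (Bridge 20
    24) Adj]) (Bridge 15 19)])])]) = Some 20889592"
  by (simp add: carrier_eval assms)

lemma carrier_24:
  defines "s1 \<equiv> Via 12 Adj (Via 13 Adj Adj)"
  defines "s2 \<equiv> Via 5 (Bridge 4 8) (Via 6 Adj (Bridge 3 7))"
  defines "s3 \<equiv> Threats [(12, s1), Join 5 (Bridge 4 8) (Via 6 Adj Adj)]"
  defines "s4 \<equiv> Via 10 Adj (Via 6 Adj (Bridge 3 7))"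
  defines "s5 \<equiv> Threats [Join 11 Adj Adj, (10, s4)]"
  defines "s6 \<equiv> Via 10 Adj (Threats [Join 11 Adj Adj, Join 18 (Threats [Join 14 Adj Adj,
    Join 17 (Via 13 Adj Adj) Adj]) (Bridge 15 19)])"
  shows "first_carrier 13 (Threats [Join 18 (Threats [Join 21 (Bridge 20 24) Adj, Join 12 Adj (Via
    13 Adj (Bridge 14 17))]) (Bridge 15 19), Join 17 (Threats [Join 20 Adj Adj, (12, s1)])
    (Threats [Join 18 Adj (Bridge 15 19), Join 10 (Via 13 Adj Adj) (Bridge 7 11)]), (12, Threats
    [Join 14 s1 (Bridge 11 15), Join 6 (Threats [Join 10 s1 Adj, Join 5 (Bridge 4 8) Adj]) (Bridge
    3 7)]), (6, Threats [(5, s2), Join 10 s3 (Bridge 7 11), Join 10 s3 (Threats [Join 11 Adj Adj,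
    Join 3 (Via 6 Adj Adj) Adj]), Join 14 (Threats [(12, s1), Join 21 (Bridge 20 24) (Bridge 17
    18)]) s5]), (6, Threats [(5, s2), Join 5 (Bridge 4 8) (Via 6 Adj (Threats [Join 3 Adj Adj,
    (10, s6)])), Join 5 (Bridge 4 8) (Via 6 Adj (Threats [Join 7 Adj Adj, (10, s6)])), Join 21
    (Bridge 20 24) (Threats [Join 18 Adj (Bridge 15 19), Join 18 Adj (Threats [Join 19 Adj Adj,
    Join 14 Adj s5]), Join 17 Adj (Via 13 Adj (Threats [Join 14 Adj (Bridge 11 15), (10,
    s4)]))])])]) = Some 20905464"
  by (simp add: carrier_eval assms)

lemma carrier_25:
  defines "s1 \<equiv> Via 7 (Via 6 (Via 13 Adj (Via 9 Adj Adj)) Adj) Adj"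
  defines "s2 \<equiv> Threats [Join 12 Adj (Via 7 (Via 6 (Via 9 Adj Adj) Adj) Adj), (13, Threats
    [Join 16 Adj s1, Join 21 (Bridge 20 24) (Threats [Join 17 Adj s1, Join 18 Adj (Threats [Join
    19 Adj Adj, Join 14 Adj s1])])])]"
  defines "s3 \<equiv> Via 3 (Via 13 Adj (Via 9 Adj (Via 6 Adj Adj))) Adj"
  defines "s4 \<equiv> Threats [Join 12 Adj (Via 3 (Via 9 Adj (Via 6 Adj Adj)) Adj), (13, Threats
    [Join 16 Adj s3, Join 21 (Bridge 20 24) (Threats [Join 17 Adj s3, Join 18 Adj (Threats [Join
    19 Adj Adj, Join 14 Adj s3])])])]"
  defines "s5 \<equiv> Via 9 Adj (Via 6 Adj (Bridge 3 7))"
  defines "s6 \<equiv> Threats [Join 16 Adj (Via 13 Adj Adj), Join 21 (Bridge 20 24) (Bridge 17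
    18)]"
  defines "s7 \<equiv> Threats [Join 11 Adj Adj, (3, s3)]"
  defines "s8 \<equiv> Threats [Join 11 Adj Adj, (7, s1)]"
  shows "first_carrier 6 (Threats [Join 5 (Bridge 4 8) (Via 6 Adj (Bridge 3 7)), (7, Threats [Join
    5 (Bridge 4 8) (Via 7 (Via 6 Adj Adj) Adj), (9, s2)]), (3, Threats [Join 5 (Bridge 4 8) (Via 3
    (Via 6 Adj Adj) Adj), (9, s4)]), (9, Threats [Join 12 Adj s5, (7, s2), (3, s4), (13, Threats
    [Join 16 Adj (Via 13 Adj s5), Join 14 s6 s7, Join 14 s6 s8, Join 21 (Bridge 20 24) (Threats
    [Join 17 Adj (Via 13 Adj s5), Join 14 (Bridge 17 18) s7, Join 18 Adj (Threats [Join 19 Adj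
    Adj, Join 14 Adj s8])])])])]) = Some 20937720"
  by (simp add: carrier_eval assms)

lemma carrier_26:
  defines "s1 \<equiv> Via 17 (Via 13 Adj Adj) (Via 15 (Via 18 Adj Adj) Adj)"
  defines "s2 \<equiv> Threats [Join 16 Adj (Via 17 Adj (Via 15 (Via 18 Adj Adj) Adj)), (13,
    Threats [Join 12 Adj s1, Join 5 (Bridge 4 8) (Threats [Join 9 Adj s1, Join 6 Adj (Threats
    [Join 3 Adj Adj, Join 10 Adj s1])])])]"
  defines "s3 \<equiv> Via 19 (Via 18 (Via 17 (Via 13 Adj Adj) Adj) Adj) Adj"
  defines "s4 \<equiv> Threats [Join 16 Adj (Via 19 (Via 18 (Via 17 Adj Adj) Adj) Adj), (13,
    Threats [Join 12 Adj s3, Join 5 (Bridge 4 8) (Threats [Join 9 Adj s3, Join 6 Adj (Threats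
    [Join 3 Adj Adj, Join 10 Adj s3])])])]"
  defines "s5 \<equiv> Via 18 (Via 17 (Via 13 Adj Adj) Adj) (Bridge 15 19)"
  defines "s6 \<equiv> Threats [Join 12 Adj (Via 13 Adj Adj), Join 5 (Bridge 4 8) (Bridge 6 9)]"
  defines "s7 \<equiv> Threats [Join 11 Adj Adj, (19, s3)]"
  shows "first_carrier 18 (Threats [Join 21 (Bridge 20 24) (Via 18 Adj (Bridge 15 19)), (15,
    Threats [Join 21 (Bridge 20 24) (Via 15 (Via 18 Adj Adj) Adj), (17, s2)]), (19, Threats [Join
    21 (Bridge 20 24) (Via 18 Adj (Via 19 Adj Adj)), (17, s4)]), (17, Threats [Join 16 Adj (Via 18
    (Via 17 Adj Adj) (Bridge 15 19)), (15, s2), (19, s4), (13, Threats [Join 12 Adj s5, Join 10 s6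
    s7, Join 10 s6 (Threats [Join 11 Adj Adj, Join 15 (Via 17 (Via 13 Adj Adj) (Via 18 Adj Adj))
    Adj]), Join 5 (Bridge 4 8) (Threats [Join 9 Adj s5, Join 6 Adj (Threats [Join 3 Adj Adj, Join
    10 Adj s7]), Join 6 Adj (Threats [Join 3 Adj Adj, Join 15 (Via 17 (Via 13 (Bridge 9 10) Adj)
    (Via 18 Adj Adj)) Adj])])])])]) = Some 20955000"
  by (simp add: carrier_eval assms)

lemma carrier_27:
  "first_carrier 12 (Threats [Join 18 (Threats [(13, Via 12 Adj (Via 13 Adj (Bridge 14 17))), Join
    21 (Bridge 20 24) Adj]) (Bridge 15 19), Join 6 (Threats [Join 1 (Bridge 4 0) (Bridge 5 2), (9,
    Via 12 Adj (Via 9 Adj Adj))]) (Bridge 3 7)]) = Some 20902655"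
  by (simp add: carrier_eval)

lemma carrier_28:
  defines "s1 \<equiv> Threats [Join 24 Adj Adj, Join 16 Adj (Via 17 Adj Adj)]"
  defines "s2 \<equiv> Threats [Join 22 Adj (Bridge 19 23), Join 14 (Via 17 Adj Adj) (Bridge 11
    15)]"
  defines "s3 \<equiv> Via 5 (Bridge 4 8) (Bridge 6 9)"
  defines "s4 \<equiv> Via 24 Adj (Via 21 Adj (Via 17 Adj Adj))"
  defines "s5 \<equiv> Threats [Join 22 (Via 21 (Via 24 Adj Adj) Adj) (Bridge 19 23), Join 6
    (Threats [Join 5 (Bridge 4 8) Adj, Join 13 s4 (Bridge 9 10)]) (Bridge 3 7)]"
  defines "s6 \<equiv> Via 22 (Via 21 (Via 17 (Bridge 13 14) Adj) Adj) (Bridge 19 23)"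
  shows "first_carrier 17 (Threats [Join 21 s1 s2, Join 10 (Threats [Join 16 Adj (Via 17 Adj
    (Bridge 13 14)), (5, s3)]) (Bridge 7 11), (21, Threats [Join 22 (Via 21 s1 Adj) (Bridge 19
    23), Join 6 (Threats [Join 5 (Bridge 4 8) Adj, Join 13 (Threats [Join 16 Adj Adj, (24, s4)])
    (Bridge 9 10)]) (Bridge 3 7), (16, Threats [Join 22 (Via 16 Adj (Via 21 (Via 17 Adj Adj) Adj))
    (Bridge 19 23), Join 6 (Threats [Join 5 (Bridge 4 8) Adj, Join 13 (Via 16 Adj Adj) (Bridge 9
    10)]) (Bridge 3 7)]), (24, s5)]), (21, Threats [Join 24 Adj (Via 21 Adj s2), Join 10 (Threats
    [Join 24 Adj (Via 21 Adj (Via 17 Adj (Bridge 13 14))), (5, s3)]) (Bridge 7 11), (24, s5), Join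
    5 (Bridge 4 8) (Threats [Join 6 Adj (Bridge 3 7), Join 10 (Bridge 6 9) (Threats [Join 11 Adj
    Adj, (22, s6)]), Join 9 Adj (Threats [Join 10 Adj (Bridge 7 11), Join 13 Adj (Via 17 Adj
    (Threats [Join 14 Adj (Bridge 11 15), Join 22 (Via 21 Adj Adj) (Bridge 19 23)])), Join 10 Adj
    (Threats [Join 7 Adj Adj, (22, s6)])])])])]) = Some 32239608"
  by (simp add: carrier_eval assms)

lemma carrier_29:
  defines "s1 \<equiv> Via 5 (Bridge 4 8) (Via 6 Adj (Bridge 3 7))"
  defines "s2 \<equiv> Via 5 (Bridge 4 8) (Via 6 Adj Adj)"
  defines "s3 \<equiv> Threats [(5, s2), Join 17 (Via 20 Adj Adj) (Bridge 13 14)]"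
  defines "s4 \<equiv> Threats [Join 14 Adj (Bridge 11 15), Join 10 Adj (Via 6 Adj (Bridge 3 7))]"
  defines "s5 \<equiv> Threats [Join 11 Adj Adj, Join 3 (Via 6 Adj Adj) Adj]"
  defines "s6 \<equiv> Threats [Join 20 Adj Adj, Join 24 Adj (Via 21 Adj Adj)]"
  defines "s7 \<equiv> Threats [(5, s2), Join 17 s6 (Bridge 13 14)]"
  defines "s8 \<equiv> Threats [(5, s2), Join 17 (Via 24 Adj (Via 21 Adj Adj)) (Bridge 13 14)]"
  shows "first_carrier 21 (Threats [Join 22 (Via 21 (Bridge 20 24) Adj) (Bridge 19 23), (20,
    Threats [Join 22 (Via 20 Adj (Via 21 Adj Adj)) (Bridge 19 23), (6, Threats [(5, s1), Join 10
    s3 (Bridge 7 11), Join 13 (Threats [Join 12 Adj Adj, Join 17 (Via 20 Adj Adj) Adj]) s4, Join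
    10 s3 s5])]), (6, Threats [(5, s1), Join 10 s7 (Bridge 7 11), Join 13 (Threats [Join 12 Adj
    Adj, Join 17 s6 Adj]) s4, Join 10 s7 s5]), (24, Threats [Join 22 (Via 21 (Via 24 Adj Adj) Adj)
    (Bridge 19 23), (6, Threats [(5, s1), Join 10 s8 (Bridge 7 11), Join 13 (Threats [Join 12 Adj
    Adj, Join 17 (Via 24 Adj (Via 21 Adj Adj)) Adj]) s4, Join 10 s8 s5])])]) = Some 33226232"
  by (simp add: carrier_eval assms)

lemma carrier_30:
  defines "s1 \<equiv> Threats [Join 9 (Via 12 Adj Adj) Adj, Join 21 (Bridge 20 24) (Via 14
    (Bridge 17 18) Adj)]"
  shows "first_carrier 12 (Threats [Join 10 (Via 12 Adj (Bridge 9 13)) (Bridge 7 11), Join 18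
    (Threats [Join 21 (Bridge 20 24) Adj, Join 13 (Via 12 Adj Adj) (Bridge 14 17)]) (Bridge 15
    19), (14, Threats [Join 21 (Bridge 20 24) (Via 14 (Bridge 17 18) (Bridge 11 15)), Join 10 s1
    (Bridge 7 11), Join 10 s1 (Threats [Join 7 Adj Adj, Join 15 (Via 14 Adj Adj) Adj]), Join 6
    (Threats [Join 9 (Via 12 Adj Adj) Adj, Join 1 (Bridge 0 4) (Bridge 2 5)]) (Threats [Join 7 Adj
    Adj, Join 10 Adj (Via 14 Adj (Bridge 11 15))])])]) = Some 20905719"
  by (simp add: carrier_eval assms)

text \<open>A ladder along row 2: from 6, 10 and 14 White threatens 3, 11 and 15 in the bottom row,
  until 18 meets the opening stone 22, which has the bridge {19, 23} to
  \<open>Bottom\<close>.\<close>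

lemma carrier_31:
  defines "s1 \<equiv> Threats [Join 9 (Bridge 8 12) Adj, Join 1 (Bridge 0 4) (Bridge 2 5)]"
  shows "first_carrier 22 (Threats [Join 24 Adj (Via 22 (Bridge 21 25) (Bridge 19 23)), Join 6 s1
    (Threats [Join 3 Adj Adj, Join 10 Adj (Threats [Join 11 Adj Adj, Join 14 Adj (Threats [Join 15
    Adj Adj, Join 18 Adj (Via 22 Adj (Bridge 19 23))])])]), (19, Threats [Join 24 Adj (Via 22
    (Bridge 21 25) (Via 19 Adj Adj)), Join 6 s1 (Threats [Join 3 Adj Adj, Join 10 Adj (Threats
    [Join 11 Adj Adj, Join 14 Adj (Via 19 (Bridge 15 18) Adj)])])]), (11, Threats [Join 24 Adj
    (Via 22 (Bridge 21 25) (Threats [Join 23 Adj Adj, Join 18 Adj (Via 11 (Bridge 14 15) Adj)])),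
    Join 6 s1 (Threats [Join 3 Adj Adj, Join 10 Adj (Via 11 Adj Adj)])])]) = Some 65855359"
  by (simp add: carrier_eval assms)

lemma carrier_32:
  defines "s1 \<equiv> Via 22 (Via 24 Adj (Via 25 Adj Adj)) (Via 18 Adj (Via 14 Adj Adj))"
  defines "s2 \<equiv> Threats [Join 16 Adj Adj, Join 21 (Via 24 Adj Adj) Adj]"
  shows "first_carrier 24 (Threats [Join 22 (Via 24 Adj (Bridge 21 25)) (Bridge 19 23), Join 21
    (Via 24 Adj Adj) (Threats [Join 14 (Bridge 17 18) (Bridge 11 15), Join 26 (Bridge 22 25)
    (Bridge 23 27)]), (25, Threats [Join 26 (Via 24 Adj (Via 25 Adj Adj)) (Bridge 23 27), (22,
    Threats [Join 19 (Via 22 (Via 24 Adj (Via 25 Adj Adj)) Adj) Adj, (18, Threats [Join 15 (Via 22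
    (Via 24 Adj (Via 25 Adj Adj)) (Via 18 Adj Adj)) Adj, (14, Threats [Join 11 s1 Adj, Join 6
    (Threats [Join 10 s1 Adj, Join 1 (Bridge 0 4) (Bridge 2 5)]) (Bridge 3 7)])])])]), (6, Threats
    [Join 1 (Bridge 0 4) (Via 6 (Bridge 2 5) (Bridge 3 7)), Join 17 s2 (Threats [Join 18 Adj
    (Bridge 15 19), Join 14 Adj (Threats [Join 11 Adj Adj, Join 10 Adj (Via 6 Adj (Bridge 3
    7))])]), (7, Threats [Join 1 (Bridge 0 4) (Via 7 (Via 6 (Bridge 2 5) Adj) Adj), Join 17 s2
    (Threats [Join 18 Adj (Bridge 15 19), Join 14 Adj (Via 7 (Bridge 10 11) Adj)])]), (3, Threats
    [Join 1 (Bridge 0 4) (Via 6 (Bridge 2 5) (Via 3 Adj Adj)), Join 17 s2 (Threats [Join 18 Adj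
    (Bridge 15 19), Join 14 Adj (Threats [Join 11 Adj Adj, Join 10 Adj (Via 3 (Via 6 Adj Adj)
    Adj)])])])])]) = Some 267373823"
  by (simp add: carrier_eval assms)

lemma carrier_33:
  "first_carrier 18 (Threats [Join 9 (Bridge 8 12) (Threats [Join 6 Adj (Bridge 3 7), Join 10 Adj
    (Threats [Join 14 Adj (Via 18 Adj (Bridge 15 19)), Join 11 Adj Adj])]), (25, Via 18 (Via 25
    (Bridge 28 24) (Bridge 22 21)) (Bridge 19 15)), (11, Threats [Join 9 (Bridge 8 12) (Threats
    [Join 6 Adj (Bridge 3 7), Join 10 Adj (Via 11 Adj Adj)]), (25, Via 11 (Via 18 (Via 25 (Bridge
    24 28) (Bridge 21 22)) (Bridge 15 14)) Adj)]), (19, Threats [Join 9 (Bridge 12 8) (Threats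
    [Join 10 Adj (Threats [Join 11 Adj Adj, Join 14 Adj (Via 18 Adj (Via 19 Adj Adj))]), Join 6
    Adj (Bridge 7 3)]), (25, Via 19 (Via 25 (Bridge 24 28) (Via 18 (Bridge 22 21) Adj)) Adj)])]) =
    Some 325902280"
  by (simp add: carrier_eval)

lemma carrier_34:
  defines "s1 \<equiv> Via 12 Adj (Via 13 Adj (Via 17 Adj Adj))"
  shows "first_carrier 5 (Threats [Join 18 (Threats [Join 25 (Bridge 24 28) (Bridge 21 22), Join
    17 (Threats [(13, Via 18 (Threats [(9, Via 17 (Threats [Join 4 Adj (Via 5 Adj (Via 9 Adj (Via
    13 Adj Adj))), Join 8 Adj (Via 9 Adj (Via 13 Adj Adj))]) Adj), (12, s1)]) Adj), Join 16 Adj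
    Adj]) Adj]) (Bridge 19 15), Join 3 (Via 5 (Bridge 4 8) (Bridge 6 2)) Adj, (12, Threats [Join
    18 (Threats [Join 25 (Bridge 28 24) (Bridge 21 22), (17, Via 12 Adj (Threats [Join 13 Adj (Via
    17 Adj Adj), Join 16 Adj (Via 17 Adj Adj)]))]) (Bridge 15 19), Join 3 (Via 5 (Via 12 Adj
    (Bridge 9 8)) (Bridge 6 2)) Adj]), (4, Threats [Join 18 (Threats [Join 17 (Threats [(13, Via
    18 (Threats [(12, s1), (9, Via 4 Adj (Via 5 Adj (Via 9 Adj (Via 13 Adj (Via 17 Adj Adj)))))])
    Adj), Join 16 Adj Adj]) Adj, Join 25 (Bridge 28 24) (Bridge 22 21)]) (Bridge 15 19), Join 3
    (Via 4 Adj (Via 5 Adj (Bridge 2 6))) Adj])]) = Some 326087548"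
  by (simp add: carrier_eval assms)

lemma carrier_35:
  defines "s1 \<equiv> Via 21 (Via 17 (Via 13 Adj Adj) Adj) (Via 19 (Via 22 Adj Adj) Adj)"
  defines "s2 \<equiv> Threats [Join 12 Adj s1, Join 5 (Bridge 4 8) (Threats [Join 9 Adj s1, Join
    6 Adj (Threats [Join 3 Adj Adj, Join 10 Adj s1])])]"
  defines "s3 \<equiv> Threats [Join 16 Adj (Via 21 (Via 17 Adj Adj) (Via 19 (Via 22 Adj Adj)
    Adj)), (13, s2)]"
  defines "s4 \<equiv> Threats [Join 20 Adj (Via 21 Adj (Via 19 (Via 22 Adj Adj) Adj)), (17, s3)]"
  defines "s5 \<equiv> Via 21 (Via 17 (Via 13 Adj Adj) Adj) Adj"
  defines "s6 \<equiv> Threats [Join 12 Adj (Via 23 (Via 22 s5 Adj) Adj), Join 5 (Bridge 4 8)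
    (Threats [Join 9 Adj (Via 23 (Via 22 s5 Adj) Adj), Join 6 Adj (Threats [Join 3 Adj Adj, Join
    10 Adj (Via 23 (Via 22 s5 Adj) Adj)])])]"
  defines "s7 \<equiv> Threats [Join 16 Adj (Via 23 (Via 22 (Via 21 (Via 17 Adj Adj) Adj) Adj)
    Adj), (13, s6)]"
  defines "s8 \<equiv> Threats [Join 20 Adj (Via 23 (Via 22 (Via 21 Adj Adj) Adj) Adj), (17, s7)]"
  defines "s9 \<equiv> Via 17 (Via 13 (Bridge 9 10) Adj) Adj"
  shows "first_carrier 22 (Threats [Join 25 (Bridge 24 28) (Via 22 Adj (Bridge 19 23)), (19,
    Threats [Join 25 (Bridge 24 28) (Via 19 (Via 22 Adj Adj) Adj), (21, s4)]), (23, Threats [Join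
    25 (Bridge 24 28) (Via 22 Adj (Via 23 Adj Adj)), (21, s8)]), (21, Threats [Join 20 Adj (Via 22
    (Via 21 Adj Adj) (Bridge 19 23)), (19, s4), (23, s8), (17, Threats [Join 16 Adj (Via 22 (Via
    21 (Via 17 Adj Adj) Adj) (Bridge 19 23)), (19, s3), (23, s7), (13, Threats [Join 12 Adj (Via
    22 s5 (Bridge 19 23)), (19, s2), (23, s6), Join 5 (Bridge 4 8) (Threats [Join 9 Adj (Via 22 s5
    (Bridge 19 23)), Join 6 Adj (Threats [Join 3 Adj Adj, Join 23 (Via 22 (Via 21 s9 Adj) Adj)
    Adj]), Join 6 Adj (Threats [Join 3 Adj Adj, Join 19 (Via 21 s9 (Via 22 Adj Adj)) Adj]), Join 6
    Adj (Threats [Join 3 Adj Adj, Join 10 Adj (Via 22 s5 (Bridge 19 23))])])])])])]) = Some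
    335230840"
  by (simp add: carrier_eval assms)

text \<open>A ladder along row 1: 9, 13 and 17 threaten 12, 16 and 20 in the top row, and 21 meets
  the opening stone 25, the ladder escape.\<close>

lemma carrier_36:
  defines "s1 \<equiv> Threats [Join 4 Adj (Via 5 Adj Adj), Join 8 Adj (Via 5 Adj Adj)]"
  shows "first_carrier 25 (Threats [Join 6 (Threats [(5, s1), Join 9 (Threats [Join 13 (Threats
    [Join 17 (Threats [Join 21 (Via 25 (Bridge 28 24) Adj) Adj, Join 20 Adj Adj]) Adj, Join 16 Adj
    Adj]) Adj, Join 12 Adj Adj]) Adj]) (Bridge 3 7), Join 26 (Threats [Join 24 Adj (Via 25 Adj
    Adj), Join 28 Adj (Via 25 Adj Adj)]) (Bridge 23 27), (24, Threats [Join 6 (Threats [Join 5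
    (Bridge 4 8) Adj, Join 9 (Threats [Join 13 (Threats [(17, Via 24 Adj (Threats [Join 20 Adj
    (Via 17 Adj Adj), Join 21 Adj (Via 17 Adj Adj)])), Join 16 Adj Adj]) Adj, Join 12 Adj Adj])
    Adj]) (Bridge 3 7), (26, Via 24 Adj (Via 25 Adj (Via 26 Adj (Bridge 27 23))))]), (28, Threats
    [Join 6 (Threats [Join 9 (Threats [Join 13 (Threats [(17, Threats [Join 20 Adj (Via 17 Adj
    Adj), (21, Via 28 Adj (Via 25 Adj (Via 21 Adj (Via 17 Adj Adj))))]), Join 16 Adj Adj]) Adj,
    Join 12 Adj Adj]) Adj, (5, s1)]) (Bridge 3 7), (26, Via 28 Adj (Threats [(27, Via 25 Adj (Via
    26 Adj (Via 27 Adj Adj))), (23, Via 25 Adj (Via 26 Adj (Via 23 Adj Adj)))]))])]) = Some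
    531837944"
  by (simp add: carrier_eval assms)

lemma carrier_37:
  defines "s1 \<equiv> Threats [Join 17 (Via 16 Adj Adj) Adj, Join 5 (Bridge 4 8) (Via 10 (Bridge
    6 9) Adj)]"
  shows "first_carrier 16 (Threats [Join 14 (Via 16 Adj (Bridge 13 17)) (Bridge 11 15), Join 6
    (Threats [Join 5 (Bridge 4 8) Adj, Join 13 (Via 16 Adj Adj) (Bridge 9 10)]) (Bridge 3 7), (10,
    Threats [Join 5 (Bridge 4 8) (Via 10 (Bridge 6 9) (Bridge 7 11)), Join 14 s1 (Bridge 11 15),
    Join 14 s1 (Threats [Join 15 Adj Adj, Join 7 (Via 10 Adj Adj) Adj]), Join 18 (Threats [Join 17
    (Via 16 Adj Adj) Adj, Join 25 (Bridge 24 28) (Bridge 21 22)]) (Threats [Join 15 Adj Adj, Join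
    14 Adj (Via 10 Adj (Bridge 7 11))])])]) = Some 325578744"
  by (simp add: carrier_eval assms)

lemma carrier_38:
  defines "s1 \<equiv> Threats [Join 6 (Via 9 Adj Adj) (Bridge 3 7), Join 18 (Bridge 14 17) (Via
    19 Adj Adj)]"
  shows "first_carrier 19 (Threats [Join 25 (Bridge 24 28) (Threats [Join 22 Adj (Via 19 Adj Adj),
    Join 26 Adj (Bridge 23 27)]), (9, Threats [Join 6 (Via 9 (Bridge 8 12) Adj) (Bridge 3 7), Join
    13 (Bridge 12 16) s1, Join 14 (Threats [Join 17 (Bridge 16 20) Adj, Join 13 (Via 9 (Bridge 8
    12) Adj) Adj]) (Threats [Join 11 Adj Adj, Join 18 Adj (Via 19 Adj Adj)]), Join 13 (Threats
    [Join 16 Adj Adj, Join 8 Adj (Via 9 Adj Adj)]) s1])]) = Some 534739912"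
  by (simp add: carrier_eval assms)

lemma carrier_39:
  defines "s1 \<equiv> Via 14 Adj (Via 10 Adj (Via 6 Adj (Via 3 Adj Adj)))"
  defines "s2 \<equiv> Via 14 Adj (Via 10 Adj (Via 7 Adj Adj))"
  defines "s3 \<equiv> Via 17 Adj (Via 14 Adj (Via 11 Adj Adj))"
  defines "s4 \<equiv> Via 18 Adj (Threats [(14, Via 17 Adj (Threats [(10, Via 18 Adj (Threats
    [(3, s1), (7, s2)])), (11, Via 14 Adj (Via 11 Adj Adj))])), Join 15 Adj Adj])"
  defines "s5 \<equiv> Via 10 Adj (Threats [Join 14 Adj (Threats [Join 18 Adj (Threats [Join 19
    Adj Adj, (23, Via 22 Adj (Via 23 Adj Adj))]), Join 15 Adj Adj]), Join 11 Adj Adj])"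
  defines "s6 \<equiv> Via 25 Adj (Via 22 Adj (Via 18 Adj Adj))"
  defines "s7 \<equiv> Threats [Join 17 (Threats [Join 16 Adj Adj, (21, Via 24 Adj (Via 21 Adj
    Adj))]) Adj, (18, Via 24 Adj s6)]"
  defines "s8 \<equiv> Via 25 Adj (Via 22 Adj (Via 23 Adj Adj))"
  defines "s9 \<equiv> Via 19 (Via 22 (Via 25 (Bridge 28 24) Adj) Adj) Adj"
  shows "first_carrier 6 (Threats [(17, Threats [Join 25 (Bridge 28 24) (Threats [Join 21 Adj
    (Threats [(18, Via 25 Adj (Threats [(15, Via 21 Adj (Via 18 Adj (Via 15 Adj Adj))), (19, Via
    21 Adj (Via 18 Adj (Via 19 Adj Adj)))])), (14, Via 25 Adj (Threats [(10, Via 21 Adj (Threats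
    [(3, Via 17 Adj s1), (7, Via 17 Adj s2)])), (11, Via 21 Adj s3)]))]), (18, Via 17 (Via 18
    (Bridge 22 21) Adj) s4), Join 22 Adj (Bridge 19 23)]), Join 16 Adj (Via 17 Adj (Threats [Join
    18 Adj (Bridge 19 15), (14, Via 16 Adj (Threats [(10, Via 17 Adj (Threats [(3, s1), (7,
    s2)])), (11, s3)]))])), (18, Via 17 (Via 18 (Threats [Join 25 (Bridge 24 28) (Bridge 22 21),
    Join 16 Adj (Via 17 Adj Adj)]) Adj) s4), Join 22 (Threats [Join 25 (Bridge 28 24) Adj, Join 16
    Adj (Via 17 Adj (Bridge 18 21))]) (Bridge 19 23), Join 21 (Threats [Join 16 Adj (Via 17 Adj
    Adj), Join 24 Adj Adj]) (Via 17 Adj (Threats [(22, Via 21 Adj (Via 22 Adj (Bridge 19 23))),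
    (14, Threats [(15, Via 14 Adj (Via 15 Adj Adj)), (11, Via 14 Adj (Via 11 Adj Adj))])]))]),
    Join 1 (Bridge 0 4) (Via 6 (Bridge 2 5) (Bridge 3 7)), (22, Threats [Join 1 (Bridge 0 4) (Via
    6 (Bridge 2 5) (Threats [(10, s5), Join 3 Adj Adj])), (25, Threats [Join 14 (Threats [Join 17
    (Threats [Join 21 (Via 25 (Bridge 24 28) Adj) Adj, Join 16 Adj Adj]) Adj, Join 18 (Via 22 (Via
    25 (Bridge 24 28) Adj) Adj) Adj, (24, s7), (28, Threats [Join 17 (Threats [(21, Via 28 Adj
    (Via 25 Adj (Via 21 Adj Adj))), Join 16 Adj Adj]) Adj, (18, Via 28 Adj s6)])]) (Bridge 15 11),
    (28, Threats [(15, Threats [Join 1 (Bridge 0 4) (Via 6 (Bridge 2 5) (Threats [Join 10 Adj (Via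
    15 (Bridge 11 14) Adj), Join 3 Adj Adj])), (18, Via 28 Adj (Via 25 Adj (Via 22 Adj (Via 18 Adj
    (Via 15 Adj Adj)))))]), (23, Via 28 Adj s8)]), (23, Via 22 (Via 25 (Bridge 24 28) Adj) (Via 23
    Adj Adj)), (24, Threats [Join 14 s7 (Bridge 15 11), (23, Via 24 Adj s8)])]), (19, Threats
    [Join 1 (Bridge 4 0) (Via 6 (Bridge 2 5) (Threats [Join 10 Adj (Threats [Join 14 Adj (Via 19
    (Via 22 (Threats [Join 18 Adj Adj, Join 15 Adj (Via 19 Adj Adj)]) Adj) Adj), Join 11 Adj
    Adj]), Join 3 Adj Adj])), (25, s9)]), (24, Via 22 (Via 24 Adj (Bridge 25 21)) (Bridge 19
    23))]), (22, Threats [Join 1 (Bridge 0 4) (Via 6 (Bridge 2 5) (Threats [(10, s5), Join 7 Adj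
    Adj])), (19, Threats [(1, Via 6 (Via 1 (Bridge 0 4) (Bridge 2 5)) (Threats [Join 10 Adj
    (Threats [Join 14 Adj (Via 19 (Via 22 (Threats [Join 15 Adj (Via 19 Adj Adj), Join 18 Adj
    Adj]) Adj) Adj), Join 11 Adj Adj]), Join 7 Adj Adj])), (25, s9)]), (23, Threats [Join 1
    (Bridge 0 4) (Via 6 (Bridge 2 5) (Threats [Join 10 Adj (Threats [Join 14 Adj (Threats [Join 15
    Adj Adj, Join 18 Adj (Via 22 Adj (Via 23 Adj Adj))]), Join 11 Adj Adj]), Join 7 Adj Adj])),
    (24, Via 22 (Via 24 Adj (Bridge 25 21)) (Via 23 Adj Adj))]), (24, Via 22 (Via 24 Adj (Bridge
    25 21)) (Bridge 23 19))])]) = Some 334482687"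
  by (simp add: carrier_eval assms)

lemma carrier_40:
  defines "s1 \<equiv> Via 1 (Bridge 0 4) (Bridge 2 5)"
  defines "s2 \<equiv> Threats [Join 3 Adj Adj, Join 11 (Via 10 Adj Adj) Adj]"
  defines "s3 \<equiv> Threats [Join 13 (Bridge 12 16) (Via 10 Adj Adj), (1, s1)]"
  defines "s4 \<equiv> Via 11 (Via 10 (Via 17 Adj (Via 13 Adj Adj)) Adj) Adj"
  defines "s5 \<equiv> Threats [Join 16 Adj (Via 11 (Via 10 (Via 13 Adj Adj) Adj) Adj), (17,
    Threats [Join 20 Adj s4, Join 25 (Bridge 24 28) (Threats [Join 21 Adj s4, Join 22 Adj (Threats
    [Join 23 Adj Adj, Join 18 Adj s4])])])]"
  defines "s6 \<equiv> Via 13 Adj (Via 10 Adj (Via 6 Adj Adj))"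
  defines "s7 \<equiv> Via 13 Adj (Via 9 Adj (Via 5 Adj Adj))"
  defines "s8 \<equiv> Via 3 (Via 2 (Via 17 Adj s7) Adj) Adj"
  shows "first_carrier 10 (Threats [Join 6 (Threats [Join 9 (Bridge 8 12) Adj, (1, s1)]) s2, Join
    6 s3 s2, (11, Threats [Join 9 (Bridge 8 12) (Via 11 (Via 10 Adj Adj) Adj), (13, s5)]), (11,
    Threats [Join 5 (Bridge 4 8) (Via 11 (Via 10 (Bridge 6 9) Adj) Adj), (13, s5)]), (3, Threats
    [Join 5 (Bridge 4 8) (Via 3 (Bridge 2 6) Adj), Join 6 s3 (Via 3 Adj Adj), (6, Threats [Join 9
    (Bridge 8 12) (Via 3 (Via 6 Adj Adj) Adj), (13, Threats [Join 16 Adj (Via 3 s6 Adj), (17,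
    Threats [Join 20 Adj (Via 3 (Via 17 Adj s6) Adj), Join 25 (Bridge 24 28) (Threats [Join 21 Adj
    (Via 3 (Via 17 Adj s6) Adj), Join 22 Adj (Threats [Join 23 Adj Adj, Join 18 Adj (Via 3 (Via 17
    Adj s6) Adj)])])])])]), (2, Threats [Join 1 (Bridge 0 4) (Via 3 (Via 2 Adj Adj) Adj), (5,
    Threats [Join 8 Adj (Via 3 (Via 2 (Via 5 Adj Adj) Adj) Adj), (9, Threats [Join 12 Adj (Via 3
    (Via 2 (Via 9 Adj (Via 5 Adj Adj)) Adj) Adj), (13, Threats [Join 16 Adj (Via 3 (Via 2 s7 Adj)
    Adj), (17, Threats [Join 20 Adj s8, Join 25 (Bridge 24 28) (Threats [Join 21 Adj s8, Join 22
    Adj (Threats [Join 23 Adj Adj, Join 18 Adj s8])])])])])])])])]) = Some 334970751"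
  by (simp add: carrier_eval assms)

text \<open>Part of the strategy is a ladder in row 2: 14 and 18 threaten 15 and 19 until White
  reaches 26, which has the bridge {23, 27} to \<open>Bottom\<close>.\<close>

lemma carrier_41:
  defines "s1 \<equiv> Via 14 (Via 13 Adj Adj) (Bridge 11 15)"
  defines "s2 \<equiv> Via 16 Adj (Via 13 Adj (Via 18 (Via 14 Adj Adj) Adj))"
  defines "s3 \<equiv> Threats [Join 3 Adj Adj, Join 14 (Via 13 (Bridge 9 10) Adj) (Bridge 11
    15)]"
  defines "s4 \<equiv> Via 14 (Via 13 (Via 9 Adj Adj) Adj) Adj"
  defines "s5 \<equiv> Threats [Join 15 (Via 8 Adj s4) Adj, (18, Threats [Join 19 (Via 8 Adj (Via
    18 s4 Adj)) Adj, Join 26 (Threats [Join 22 (Via 8 Adj (Via 18 s4 Adj)) Adj, Join 25 (Threats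
    [Join 28 Adj Adj, Join 21 (Via 8 Adj (Via 18 s4 Adj)) Adj]) Adj]) (Bridge 23 27)])]"
  defines "s6 \<equiv> Threats [Join 10 (Via 8 Adj (Via 9 Adj Adj)) (Bridge 7 11), (14, s5)]"
  defines "s7 \<equiv> Via 14 (Via 13 (Via 9 (Via 5 Adj Adj) Adj) Adj) Adj"
  defines "s8 \<equiv> Threats [Join 15 (Via 4 Adj s7) Adj, (18, Threats [Join 19 (Via 4 Adj (Via
    18 s7 Adj)) Adj, Join 26 (Threats [Join 22 (Via 4 Adj (Via 18 s7 Adj)) Adj, Join 25 (Threats
    [Join 28 Adj Adj, Join 21 (Via 4 Adj (Via 18 s7 Adj)) Adj]) Adj]) (Bridge 23 27)])]"
  defines "s9 \<equiv> Threats [Join 10 (Via 4 Adj (Via 9 (Via 5 Adj Adj) Adj)) (Bridge 7 11),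
    (14, s8)]"
  defines "s10 \<equiv> Via 9 (Via 5 (Bridge 4 8) Adj) Adj"
  defines "s11 \<equiv> Via 18 (Via 14 (Via 13 s10 Adj) Adj) Adj"
  defines "s12 \<equiv> Threats [Join 20 Adj Adj, Join 8 Adj (Via 18 s4 Adj)]"
  defines "s13 \<equiv> Threats [Join 19 (Via 18 Adj Adj) Adj, Join 26 (Bridge 22 25) (Bridge 23
    27)]"
  defines "s14 \<equiv> Threats [Join 20 Adj Adj, Join 4 Adj (Via 18 s7 Adj)]"
  shows "first_carrier 13 (Threats [Join 6 (Threats [Join 5 (Bridge 4 8) Adj, Join 16 Adj (Via 13
    Adj (Bridge 9 10))]) (Bridge 3 7), Join 9 (Threats [Join 8 Adj Adj, Join 16 Adj (Via 13 Adj
    Adj)]) (Threats [Join 6 Adj (Bridge 3 7), (14, s1)]), (16, Threats [Join 10 (Via 16 Adj (Via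
    13 Adj Adj)) (Bridge 7 11), (14, Threats [Join 15 (Via 14 (Via 13 (Via 16 Adj Adj) Adj) Adj)
    Adj, (18, Threats [Join 19 s2 Adj, Join 26 (Threats [Join 22 s2 Adj, Join 25 (Threats [Join 28
    Adj Adj, Join 21 s2 Adj]) Adj]) (Bridge 23 27)])])]), (14, Threats [Join 16 Adj (Via 13 Adj
    (Via 14 Adj (Bridge 11 15))), (11, Threats [Join 16 Adj (Via 11 (Via 13 Adj (Via 14 Adj Adj))
    Adj), Join 5 (Bridge 4 8) (Threats [Join 9 Adj (Via 13 Adj (Via 11 (Via 14 Adj Adj) Adj)),
    Join 6 Adj (Threats [Join 3 Adj Adj, Join 10 Adj (Via 11 Adj Adj)])])]), (15, Threats [Join 16
    Adj (Via 13 Adj (Via 15 (Via 14 Adj Adj) Adj)), Join 5 (Bridge 4 8) (Threats [Join 9 Adj (Via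
    15 (Via 14 (Via 13 Adj Adj) Adj) Adj), Join 6 Adj (Threats [Join 3 Adj Adj, Join 10 Adj (Via
    15 (Via 14 Adj Adj) Adj)])])]), Join 5 (Bridge 4 8) (Threats [Join 9 Adj s1, Join 6 Adj
    (Threats [Join 3 Adj Adj, Join 10 Adj (Threats [Join 11 Adj Adj, Join 15 (Via 14 Adj Adj)
    Adj])]), Join 6 Adj (Threats [Join 3 Adj Adj, Join 15 (Via 14 (Via 13 (Bridge 9 10) Adj) Adj)
    Adj]), Join 6 Adj (Threats [Join 3 Adj Adj, Join 11 (Via 13 (Bridge 9 10) (Via 14 Adj Adj))
    Adj])])]), (5, Threats [Join 6 (Via 5 (Bridge 4 8) Adj) (Bridge 3 7), Join 6 (Via 5 (Bridge 4
    8) Adj) s3, (8, Threats [Join 6 (Via 5 (Via 8 Adj Adj) Adj) (Bridge 3 7), Join 6 (Via 5 (Via 8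
    Adj Adj) Adj) s3, (9, s6)]), (4, Threats [Join 6 (Via 4 Adj (Via 5 Adj Adj)) (Bridge 3 7),
    Join 6 (Via 4 Adj (Via 5 Adj Adj)) s3, (9, s9)]), (9, Threats [Join 10 s10 (Bridge 7 11), (8,
    s6), (4, s9), (14, Threats [Join 15 (Via 14 (Via 13 s10 Adj) Adj) Adj, (8, s5), (4, s8), (18,
    Threats [Join 19 s11 Adj, Join 21 s12 s13, Join 21 s14 s13, Join 26 (Threats [Join 22 s11 Adj,
    Join 25 (Threats [Join 28 Adj Adj, Join 21 s12 Adj]) Adj, Join 25 (Threats [Join 28 Adj Adj,
    Join 21 s14 Adj]) Adj]) (Bridge 23 27)])])])])]) = Some 519958520"
  by (simp add: carrier_eval assms)

lemma carrier_42:
  defines "s1 \<equiv> Via 26 (Via 25 (Bridge 24 28) Adj) (Bridge 23 27)"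
  defines "s2 \<equiv> Threats [Join 19 Adj Adj, Join 14 Adj (Via 11 Adj Adj)]"
  defines "s3 \<equiv> Via 26 (Via 25 Adj Adj) (Bridge 23 27)"
  defines "s4 \<equiv> Threats [Join 18 Adj s2, (26, s3)]"
  defines "s5 \<equiv> Threats [Join 17 (Bridge 16 20) Adj, Join 21 (Via 25 (Bridge 24 28) Adj)
    Adj]"
  defines "s6 \<equiv> Threats [Join 20 Adj Adj, Join 28 Adj (Via 25 Adj Adj)]"
  defines "s7 \<equiv> Threats [(26, s1), Join 21 (Bridge 20 24) s4, Join 18 s5 s2, Join 21 s6
    s4]"
  defines "s8 \<equiv> Threats [Join 19 Adj Adj, Join 14 Adj (Threats [Join 11 Adj Adj, Join 10
    Adj (Via 6 Adj (Bridge 3 7))])]"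
  defines "s9 \<equiv> Threats [(26, s3), Join 18 Adj s8]"
  shows "first_carrier 6 (Threats [Join 1 (Bridge 0 4) (Via 6 (Bridge 2 5) (Bridge 3 7)), (11,
    Threats [Join 1 (Bridge 0 4) (Via 6 (Bridge 2 5) (Threats [Join 3 Adj Adj, Join 10 Adj (Via 11
    Adj Adj)])), (25, s7)]), (11, Threats [Join 1 (Bridge 0 4) (Via 6 (Bridge 2 5) (Via 11 (Bridge
    7 10) Adj)), (25, s7)]), (25, Threats [(26, s1), Join 21 (Bridge 20 24) s9, Join 18 s5 s8,
    Join 21 s6 s9])]) = Some 532630783"
  by (simp add: carrier_eval assms)

lemma carrier_43:
  defines "s1 \<equiv> Via 18 (Via 20 Adj (Via 21 Adj Adj)) (Via 14 Adj Adj)"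
  defines "s2 \<equiv> Via 18 (Via 20 Adj (Bridge 17 21)) Adj"
  defines "s3 \<equiv> Threats [Join 5 (Bridge 4 8) (Via 6 Adj Adj), Join 17 (Via 20 Adj Adj)
    (Bridge 13 14)]"
  shows "first_carrier 20 (Threats [(17, Threats [Join 10 (Via 20 Adj (Via 17 Adj (Bridge 13 14)))
    (Bridge 7 11), Join 26 (Threats [Join 28 Adj (Bridge 25 29), Join 22 (Via 20 Adj (Via 17 Adj
    (Bridge 18 21))) Adj]) (Bridge 23 27)]), (21, Threats [Join 26 (Via 20 Adj (Via 21 Adj (Bridge
    22 25))) (Bridge 23 27), (18, Threats [Join 15 (Via 18 (Via 20 Adj (Via 21 Adj Adj)) Adj) Adj,
    (14, Threats [Join 11 s1 Adj, Join 6 (Threats [Join 10 s1 Adj, Join 5 (Bridge 4 8) Adj])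
    (Bridge 3 7)])])]), (18, Threats [Join 15 s2 Adj, Join 21 (Via 20 Adj Adj) (Threats [Join 15
    (Via 18 Adj Adj) Adj, Join 26 (Bridge 22 25) (Bridge 23 27)]), Join 26 (Threats [Join 28 Adj
    (Bridge 25 29), Join 22 s2 Adj]) (Bridge 23 27), (17, Threats [Join 15 (Via 20 Adj (Via 17 Adj
    (Via 18 Adj Adj))) Adj, Join 26 (Threats [Join 22 (Via 18 (Via 17 (Via 20 Adj Adj) Adj) Adj)
    Adj, Join 28 Adj (Bridge 25 29)]) (Bridge 23 27)])]), (6, Threats [Join 5 (Bridge 4 8) (Via 6
    Adj (Bridge 3 7)), Join 10 s3 (Bridge 7 11), Join 13 (Threats [Join 12 Adj Adj, Join 17 (Via
    20 Adj Adj) Adj]) (Threats [Join 14 Adj (Bridge 11 15), Join 10 Adj (Via 6 Adj (Bridge 3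
    7))]), Join 10 s3 (Threats [Join 11 Adj Adj, Join 3 (Via 6 Adj Adj) Adj])])]) = Some
    1056374264"
  by (simp add: carrier_eval assms)

lemma carrier_44:
  defines "s1 \<equiv> Threats [Join 20 Adj Adj, Join 28 Adj (Via 25 Adj Adj)]"
  defines "s2 \<equiv> Threats [Join 19 (Bridge 18 22) Adj, Join 26 (Via 25 Adj Adj) (Bridge 23
    27)]"
  defines "s3 \<equiv> Via 26 (Via 25 (Via 28 Adj Adj) Adj) (Bridge 23 27)"
  defines "s4 \<equiv> Via 1 (Bridge 0 4) (Bridge 2 5)"
  defines "s5 \<equiv> Via 6 (Threats [(1, s4), Join 13 (Threats [Join 12 Adj Adj, Join 17 (Via 20
    Adj Adj) Adj]) (Bridge 9 10)]) (Bridge 3 7)"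
  defines "s6 \<equiv> Via 28 Adj (Via 25 Adj (Via 22 Adj Adj))"
  defines "s7 \<equiv> Via 28 Adj (Via 25 Adj (Via 21 Adj Adj))"
  shows "first_carrier 25 (Threats [Join 21 s1 s2, (28, Threats [(26, s3), Join 6 (Threats [(1,
    s4), Join 13 (Threats [Join 12 Adj Adj, Join 17 (Threats [Join 20 Adj Adj, Join 21 (Via 28 Adj
    (Via 25 Adj Adj)) Adj]) Adj]) (Bridge 9 10)]) (Bridge 3 7)]), (20, Threats [Join 21 (Via 20
    Adj Adj) s2, (6, s5)]), (28, Threats [(26, s3), (22, Threats [Join 19 s6 Adj, Join 6 (Threats
    [(1, s4), Join 13 (Threats [Join 12 Adj Adj, Join 18 s6 (Bridge 14 17)]) (Bridge 9 10)])
    (Bridge 3 7)])]), (21, Threats [Join 19 (Via 21 s1 (Bridge 18 22)) Adj, Join 6 (Threats [(1,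
    s4), Join 13 (Threats [Join 12 Adj Adj, Join 17 (Threats [Join 20 Adj Adj, (28, s7)]) Adj])
    (Bridge 9 10)]) (Bridge 3 7), (20, Threats [Join 19 (Via 21 (Via 20 Adj Adj) (Bridge 18 22))
    Adj, (6, s5)]), (28, Threats [Join 19 (Via 28 Adj (Via 25 Adj (Via 21 Adj (Bridge 18 22))))
    Adj, Join 6 (Threats [(1, s4), Join 13 (Threats [Join 12 Adj Adj, Join 17 s7 Adj]) (Bridge 9
    10)]) (Bridge 3 7)])])]) = Some 519993087"
  by (simp add: carrier_eval assms)

lemma carrier_45:
  defines "s1 \<equiv> Via 14 (Via 13 Adj Adj) (Bridge 11 15)"
  defines "s2 \<equiv> Via 14 (Via 13 (Via 16 Adj Adj) Adj) Adj"
  defines "s3 \<equiv> Via 18 Adj (Threats [Join 15 Adj Adj, Join 14 Adj (Threats [Join 11 Adj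
    Adj, Join 6 (Via 13 Adj (Bridge 9 10)) (Bridge 3 7)])])"
  shows "first_carrier 13 (Threats [Join 6 (Threats [Join 5 (Bridge 4 8) Adj, Join 16 Adj (Via 13
    Adj (Bridge 9 10))]) (Bridge 3 7), Join 9 (Threats [Join 8 Adj Adj, Join 16 Adj (Via 13 Adj
    Adj)]) (Threats [Join 6 Adj (Bridge 3 7), (14, s1)]), (16, Threats [Join 10 (Via 16 Adj (Via
    13 Adj Adj)) (Bridge 7 11), (14, Threats [Join 15 s2 Adj, Join 22 (Threats [Join 18 s2 Adj,
    Join 29 (Bridge 28 32) (Bridge 25 26)]) (Bridge 19 23)])]), (14, Threats [Join 16 Adj (Via 13
    Adj (Via 14 Adj (Bridge 11 15))), (11, Threats [Join 16 Adj (Via 11 (Via 13 Adj (Via 14 Adj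
    Adj)) Adj), Join 5 (Bridge 4 8) (Threats [Join 9 Adj (Via 13 Adj (Via 11 (Via 14 Adj Adj)
    Adj)), Join 6 Adj (Threats [Join 3 Adj Adj, Join 10 Adj (Via 11 Adj Adj)])])]), (15, Threats
    [Join 16 Adj (Via 13 Adj (Via 15 (Via 14 Adj Adj) Adj)), Join 5 (Bridge 4 8) (Threats [Join 9
    Adj (Via 15 (Via 14 (Via 13 Adj Adj) Adj) Adj), Join 6 Adj (Threats [Join 3 Adj Adj, Join 10
    Adj (Via 15 (Via 14 Adj Adj) Adj)])])]), Join 5 (Bridge 4 8) (Threats [Join 9 Adj s1, Join 6
    Adj (Threats [Join 3 Adj Adj, Join 10 Adj (Threats [Join 11 Adj Adj, Join 15 (Via 14 Adj Adj)
    Adj])]), Join 6 Adj (Threats [Join 3 Adj Adj, Join 15 (Via 14 (Via 13 (Bridge 9 10) Adj) Adj)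
    Adj]), Join 6 Adj (Threats [Join 3 Adj Adj, Join 11 (Via 13 (Bridge 9 10) (Via 14 Adj Adj))
    Adj])])]), (22, Threats [Join 29 (Bridge 28 32) (Via 22 (Bridge 25 26) (Bridge 19 23)), Join
    29 (Bridge 28 32) (Via 22 (Bridge 25 26) (Threats [Join 23 Adj Adj, (18, s3)])), Join 29
    (Bridge 28 32) (Via 22 (Bridge 25 26) (Threats [Join 19 Adj Adj, (18, s3)])), Join 5 (Bridge 4
    8) (Threats [Join 6 Adj (Bridge 3 7), Join 6 Adj (Threats [Join 3 Adj Adj, Join 14 (Via 13
    (Bridge 9 10) Adj) (Bridge 11 15)]), Join 9 Adj (Via 13 Adj (Threats [Join 10 Adj (Bridge 7
    11), Join 14 Adj (Threats [Join 15 Adj Adj, Join 18 Adj (Via 22 Adj (Bridge 19 23))])]))])])])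
    = Some 5214433272"
  by (simp add: carrier_eval assms)

lemma carrier_46:
  defines "s1 \<equiv> Threats [Join 29 (Bridge 28 32) Adj, Join 20 Adj (Via 21 Adj (Bridge 22
    25))]"
  defines "s2 \<equiv> Via 20 Adj (Via 21 Adj Adj)"
  defines "s3 \<equiv> Threats [Join 27 Adj Adj, Join 18 (Threats [Join 22 Adj Adj, Join 25 Adj
    (Via 21 Adj Adj)]) (Bridge 15 19)]"
  defines "s4 \<equiv> Via 25 Adj (Via 21 Adj (Via 18 Adj Adj))"
  defines "s5 \<equiv> Via 21 Adj (Via 18 Adj (Via 14 Adj Adj))"
  defines "s6 \<equiv> Threats [Join 15 (Via 28 Adj s4) Adj, (14, Threats [Join 11 (Via 28 Adj
    (Via 25 Adj s5)) Adj, Join 6 (Threats [Join 10 (Via 28 Adj (Via 25 Adj s5)) Adj, Join 9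
    (Threats [Join 8 Adj Adj, Join 13 (Via 28 Adj (Via 25 Adj s5)) Adj]) Adj]) (Bridge 3 7)])]"
  defines "s7 \<equiv> Threats [Join 22 (Via 28 Adj (Via 25 Adj Adj)) (Bridge 19 23), (18, s6)]"
  defines "s8 \<equiv> Via 32 Adj (Via 29 Adj (Via 25 Adj s5))"
  defines "s9 \<equiv> Threats [Join 15 (Via 32 Adj (Via 29 Adj s4)) Adj, (14, Threats [Join 11 s8
    Adj, Join 6 (Threats [Join 10 s8 Adj, Join 9 (Threats [Join 8 Adj Adj, Join 13 s8 Adj]) Adj])
    (Bridge 3 7)])]"
  defines "s10 \<equiv> Threats [Join 22 (Via 32 Adj (Via 29 Adj (Via 25 Adj Adj))) (Bridge 19
    23), (18, s9)]"
  defines "s11 \<equiv> Threats [Join 28 Adj Adj, Join 32 Adj (Via 29 Adj Adj)]"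
  defines "s12 \<equiv> Threats [Join 16 Adj Adj, Join 28 Adj (Via 25 Adj s5)]"
  defines "s13 \<equiv> Threats [Join 11 (Via 14 Adj Adj) Adj, Join 6 (Bridge 9 10) (Bridge 3 7)]"
  shows "first_carrier 21 (Threats [Join 26 s1 (Bridge 23 27), (25, Via 21 (Threats [Join 20 Adj
    Adj, Join 28 Adj (Via 25 Adj Adj)]) (Threats [Join 18 Adj (Bridge 15 19), Join 26 (Via 25 Adj
    Adj) (Bridge 23 27)])), (20, Threats [Join 22 s2 (Bridge 19 23), (18, Threats [Join 15 (Via 18
    s2 Adj) Adj, (14, Threats [Join 11 (Via 18 s2 (Via 14 Adj Adj)) Adj, Join 6 (Threats [Join 10
    (Via 18 s2 (Via 14 Adj Adj)) Adj, Join 9 (Threats [Join 8 Adj Adj, Join 13 (Via 18 s2 (Via 14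
    Adj Adj)) Adj]) Adj]) (Bridge 3 7)])])]), (26, Threats [Join 20 Adj (Via 21 Adj (Threats [Join
    18 Adj (Bridge 15 19), Join 27 (Via 26 (Bridge 22 25) Adj) Adj])), Join 27 (Via 26 s1 Adj)
    Adj, Join 22 (Threats [(20, s2), Join 29 (Bridge 28 32) (Via 26 Adj Adj)]) (Threats [Join 19
    Adj Adj, Join 27 (Via 26 Adj Adj) Adj]), Join 25 (Threats [Join 28 Adj Adj, (20, s2)])
    (Threats [Join 27 (Via 26 Adj Adj) Adj, Join 18 (Via 21 Adj Adj) (Bridge 15 19)]), Join 18
    (Via 21 (Threats [Join 20 Adj Adj, Join 29 (Bridge 28 32) (Via 26 Adj (Bridge 22 25))]) Adj)
    (Bridge 15 19), Join 29 (Bridge 28 32) (Via 26 Adj s3)]), (29, Threats [Join 26 (Via 29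
    (Bridge 28 32) Adj) (Bridge 23 27), Join 26 (Via 29 (Bridge 28 32) Adj) s3, (28, Threats [Join
    26 (Via 28 Adj (Via 29 Adj Adj)) (Bridge 23 27), Join 26 (Via 28 Adj (Via 29 Adj Adj)) s3,
    (25, s7)]), (32, Threats [Join 26 (Via 32 Adj (Via 29 Adj Adj)) (Bridge 23 27), Join 26 (Via
    32 Adj (Via 29 Adj Adj)) s3, (25, s10)]), (25, Threats [Join 22 (Via 25 s11 Adj) (Bridge 19
    23), (28, s7), (32, s10), (18, Threats [Join 15 (Via 25 s11 (Via 21 Adj (Via 18 Adj Adj)))
    Adj, (28, s6), (32, s9), (14, Threats [Join 11 (Via 25 s11 s5) Adj, Join 13 s12 s13, Join 13
    (Threats [Join 16 Adj Adj, (32, s8)]) s13, Join 6 (Threats [Join 10 (Via 25 s11 s5) Adj, Join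
    9 (Threats [Join 8 Adj Adj, Join 13 s12 Adj]) Adj, Join 9 (Threats [Join 8 Adj Adj, Join 32
    Adj (Via 29 Adj (Via 25 Adj (Via 21 Adj (Via 18 Adj (Via 14 Adj (Bridge 10 13))))))]) Adj])
    (Bridge 3 7)])])])])]) = Some 5351796680"
  by (simp add: carrier_eval assms)

lemma carrier_47:
  defines "s1 \<equiv> Via 27 (Via 29 (Bridge 28 32) (Bridge 26 30)) Adj"
  defines "s2 \<equiv> Threats [Join 13 (Bridge 12 16) Adj, Join 17 (Threats [Join 20 Adj Adj,
    Join 21 (Threats [Join 24 Adj Adj, Join 25 (Via 29 (Bridge 28 32) Adj) Adj]) Adj]) Adj]"
  defines "s3 \<equiv> Threats [Join 15 Adj Adj, Join 10 Adj (Via 7 Adj Adj)]"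
  defines "s4 \<equiv> Threats [Join 17 (Via 20 Adj Adj) Adj, Join 13 (Bridge 12 16) Adj]"
  defines "s5 \<equiv> Via 25 (Via 20 Adj (Bridge 21 24)) Adj"
  defines "s6 \<equiv> Via 27 (Via 29 (Threats [Join 32 Adj Adj, (25, s5)]) (Bridge 26 30)) Adj"
  defines "s7 \<equiv> Via 27 (Via 29 (Threats [Join 28 Adj Adj, (25, s5)]) (Bridge 26 30)) Adj"
  defines "s8 \<equiv> Threats [Join 15 Adj Adj, Join 10 Adj (Via 3 (Via 6 Adj Adj) Adj)]"
  defines "s9 \<equiv> Threats [Join 15 Adj Adj, Join 10 Adj (Via 6 Adj (Bridge 3 7))]"
  defines "s10 \<equiv> Via 29 (Via 25 Adj Adj) (Via 27 (Via 30 Adj Adj) Adj)"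
  shows "first_carrier 6 (Threats [Join 5 (Bridge 4 8) (Via 6 Adj (Bridge 3 7)), (7, Threats [Join
    5 (Bridge 4 8) (Via 7 (Via 6 Adj Adj) Adj), (29, Threats [(27, s1), Join 14 s2 s3, (20,
    Threats [Join 14 s4 s3, (27, s6)]), (20, Threats [Join 14 s4 s3, (27, s7)])])]), (3, Threats
    [Join 5 (Bridge 4 8) (Via 3 (Via 6 Adj Adj) Adj), (29, Threats [(27, s1), Join 14 s2 s8, (20,
    Threats [(27, s7), Join 14 s4 s8]), (20, Threats [(27, s6), Join 14 s4 s8])])]), (29, Threats
    [(27, s1), Join 14 s2 s9, (20, Threats [(27, s7), Join 14 s4 s9]), (27, Threats [Join 32 Adj
    (Via 27 (Via 29 Adj (Bridge 26 30)) Adj), Join 26 (Threats [Join 32 Adj (Via 29 Adj Adj), Join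
    21 (Bridge 20 24) (Bridge 22 25)]) (Via 27 Adj Adj), (24, Threats [Join 25 (Via 24 Adj Adj)
    (Via 29 Adj (Via 27 (Bridge 26 30) Adj)), Join 14 (Threats [Join 13 (Bridge 12 16) Adj, Join
    17 (Via 24 Adj (Bridge 20 21)) Adj]) s9]), (30, Threats [Join 32 Adj (Via 27 (Via 29 Adj (Via
    30 Adj Adj)) Adj), (25, Threats [Join 24 Adj s10, Join 17 (Bridge 16 20) (Threats [Join 21 Adj
    s10, Join 14 Adj s9])])])])])]) = Some 6433273336"
  by (simp add: carrier_eval assms)

text \<open>The ladder of \<open>carrier_41\<close> runs one step further, through 22 with the
  threat 23, and ends at 30.\<close>

lemma carrier_48:
  defines "s1 \<equiv> Threats [Join 5 (Bridge 4 8) Adj, Join 16 Adj (Via 13 Adj (Bridge 9 10))]"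
  defines "s2 \<equiv> Threats [Join 8 Adj Adj, Join 16 Adj (Via 13 Adj Adj)]"
  defines "s3 \<equiv> Via 14 (Via 13 Adj Adj) (Bridge 11 15)"
  defines "s4 \<equiv> Via 16 Adj (Via 13 Adj (Via 22 (Via 18 (Via 14 Adj Adj) Adj) Adj))"
  defines "s5 \<equiv> Threats [Join 3 Adj Adj, Join 14 (Via 13 (Bridge 9 10) Adj) (Bridge 11
    15)]"
  defines "s6 \<equiv> Via 14 (Via 13 (Via 9 Adj Adj) Adj) Adj"
  defines "s7 \<equiv> Via 8 Adj (Via 22 (Via 18 s6 Adj) Adj)"
  defines "s8 \<equiv> Threats [Join 23 s7 Adj, Join 30 (Threats [Join 26 s7 Adj, Join 29 (Threats
    [Join 32 Adj Adj, Join 25 s7 Adj]) Adj]) (Bridge 27 31)]"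
  defines "s9 \<equiv> Threats [Join 19 (Via 8 Adj (Via 18 s6 Adj)) Adj, (22, s8)]"
  defines "s10 \<equiv> Threats [Join 15 (Via 8 Adj s6) Adj, (18, s9)]"
  defines "s11 \<equiv> Threats [Join 10 (Via 8 Adj (Via 9 Adj Adj)) (Bridge 7 11), (14, s10)]"
  defines "s12 \<equiv> Via 14 (Via 13 (Via 9 (Via 5 Adj Adj) Adj) Adj) Adj"
  defines "s13 \<equiv> Via 4 Adj (Via 22 (Via 18 s12 Adj) Adj)"
  defines "s14 \<equiv> Threats [Join 26 s13 Adj, Join 29 (Threats [Join 32 Adj Adj, Join 25 s13
    Adj]) Adj]"
  defines "s15 \<equiv> Threats [Join 23 s13 Adj, Join 30 s14 (Bridge 27 31)]"
  defines "s16 \<equiv> Threats [Join 19 (Via 4 Adj (Via 18 s12 Adj)) Adj, (22, s15)]"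
  defines "s17 \<equiv> Threats [Join 15 (Via 4 Adj s12) Adj, (18, s16)]"
  defines "s18 \<equiv> Threats [Join 10 (Via 4 Adj (Via 9 (Via 5 Adj Adj) Adj)) (Bridge 7 11),
    (14, s17)]"
  defines "s19 \<equiv> Via 9 (Via 5 (Bridge 4 8) Adj) Adj"
  defines "s20 \<equiv> Via 18 (Via 14 (Via 13 s19 Adj) Adj) Adj"
  shows "first_carrier 13 (Threats [Join 6 s1 (Bridge 3 7), Join 9 s2 (Threats [Join 6 Adj (Bridge
    3 7), (14, s3)]), (16, Threats [Join 10 (Via 16 Adj (Via 13 Adj Adj)) (Bridge 7 11), (14,
    Threats [Join 15 (Via 14 (Via 13 (Via 16 Adj Adj) Adj) Adj) Adj, (18, Threats [Join 19 (Via 16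
    Adj (Via 13 Adj (Via 18 (Via 14 Adj Adj) Adj))) Adj, (22, Threats [Join 23 s4 Adj, Join 30
    (Threats [Join 26 s4 Adj, Join 29 (Threats [Join 32 Adj Adj, Join 25 s4 Adj]) Adj]) (Bridge 27
    31)])])])]), (6, Threats [Join 3 (Via 6 s1 Adj) Adj, Join 16 Adj (Via 13 Adj (Threats [Join 14
    Adj (Bridge 11 15), Join 3 (Via 6 (Bridge 9 10) Adj) Adj])), Join 9 s2 (Threats [Join 3 (Via 6
    Adj Adj) Adj, (14, s3)]), (10, Via 6 (Threats [Join 16 Adj (Via 13 Adj (Via 10 Adj Adj)), Join
    5 (Bridge 4 8) Adj]) (Threats [Join 3 Adj Adj, Join 11 (Via 10 Adj Adj) Adj])), Join 5 (Bridge
    4 8) (Via 6 Adj s5), Join 14 (Via 13 (Threats [Join 16 Adj Adj, Join 5 (Bridge 4 8) (Threats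
    [Join 9 Adj Adj, Join 10 (Via 6 Adj Adj) Adj])]) Adj) (Bridge 11 15)]), (5, Threats [Join 6
    (Via 5 (Bridge 4 8) Adj) (Bridge 3 7), Join 6 (Via 5 (Bridge 4 8) Adj) s5, (8, Threats [Join 6
    (Via 5 (Via 8 Adj Adj) Adj) (Bridge 3 7), Join 6 (Via 5 (Via 8 Adj Adj) Adj) s5, (9, s11)]),
    (4, Threats [Join 6 (Via 4 Adj (Via 5 Adj Adj)) (Bridge 3 7), Join 6 (Via 4 Adj (Via 5 Adj
    Adj)) s5, (9, s18)]), (9, Threats [Join 10 s19 (Bridge 7 11), (8, s11), (4, s18), (14, Threats
    [Join 15 (Via 14 (Via 13 s19 Adj) Adj) Adj, (8, s10), (4, s17), (18, Threats [Join 19 s20 Adj,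
    (8, s9), (4, s16), (22, Threats [Join 23 (Via 22 s20 Adj) Adj, (8, s8), (4, s15), Join 30
    (Threats [Join 26 (Via 22 s20 Adj) Adj, Join 29 (Threats [Join 32 Adj Adj, Join 8 Adj (Via 22
    (Via 18 s6 Adj) (Bridge 25 26))]) Adj, Join 29 (Threats [Join 32 Adj Adj, Join 25 (Via 22 s20
    Adj) Adj]) Adj, (4, s14)]) (Bridge 27 31)])])])])])]) = Some 8301441016"
  by (simp add: carrier_eval assms)

lemma carrier_49:
  defines "s1 \<equiv> Threats [Join 15 Adj Adj, Join 22 Adj (Via 23 Adj Adj)]"
  defines "s2 \<equiv> Via 18 (Threats [Join 17 (Via 16 Adj Adj) Adj, Join 21 (Bridge 20 24) Adj])
    s1"
  defines "s3 \<equiv> Via 9 (Via 16 Adj (Bridge 12 13)) Adj"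
  defines "s4 \<equiv> Via 17 Adj (Via 15 (Via 18 Adj Adj) Adj)"
  defines "s5 \<equiv> Threats [Join 12 Adj Adj, Join 9 (Via 5 (Bridge 4 8) Adj) Adj]"
  defines "s6 \<equiv> Threats [Join 16 Adj s4, Join 13 s5 s4]"
  defines "s7 \<equiv> Via 23 (Via 22 (Via 18 (Via 17 Adj Adj) Adj) Adj) Adj"
  defines "s8 \<equiv> Threats [Join 16 Adj s7, Join 13 s5 s7]"
  shows "first_carrier 23 (Threats [Join 29 (Bridge 28 32) (Threats [Join 26 Adj (Via 23 Adj Adj),
    Join 30 Adj (Bridge 27 31)]), (5, Threats [Join 3 (Via 5 (Bridge 4 8) (Bridge 2 6)) Adj, (16,
    Threats [(18, s2), Join 3 (Via 5 (Threats [Join 4 Adj Adj, (9, s3)]) (Bridge 2 6)) Adj]), (16,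
    Threats [(18, s2), Join 3 (Via 5 (Threats [Join 8 Adj Adj, (9, s3)]) (Bridge 2 6)) Adj]), (18,
    Threats [Join 21 (Bridge 20 24) (Threats [Join 15 (Via 18 Adj Adj) Adj, Join 22 Adj (Via 23
    Adj Adj)]), (15, Threats [Join 21 (Bridge 20 24) (Via 15 (Via 18 Adj Adj) Adj), (17, s6)]),
    (22, Threats [Join 21 (Bridge 20 24) (Via 23 (Via 22 Adj Adj) Adj), (17, s8)]), (17, Threats
    [Join 16 Adj (Via 18 (Via 17 Adj Adj) s1), Join 13 s5 (Via 18 (Via 17 Adj Adj) s1), (15, s6),
    (22, s8)])])])]) = Some 8555836284"
  by (simp add: carrier_eval assms)

lemma carrier_50:
  defines "s1 \<equiv> Via 15 (Via 18 (Bridge 21 22) Adj) Adj"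
  defines "s2 \<equiv> Via 30 (Bridge 26 29) (Bridge 27 31)"
  defines "s3 \<equiv> Via 15 (Via 18 Adj Adj) Adj"
  defines "s4 \<equiv> Via 9 (Threats [Join 12 Adj Adj, Join 13 (Threats [Join 16 Adj Adj, Join 17
    (Threats [Join 20 Adj Adj, Join 25 (Bridge 24 28) (Threats [Join 21 Adj Adj, Join 22 Adj (Via
    18 Adj Adj)])]) Adj]) Adj]) Adj"
  defines "s5 \<equiv> Via 17 (Bridge 16 20) (Threats [Join 21 Adj Adj, Join 22 (Via 18 Adj Adj)
    Adj])"
  shows "first_carrier 18 (Threats [Join 25 (Bridge 24 28) (Threats [(15, s1), (30, s2)]), (15,
    Threats [Join 17 (Bridge 16 20) s3, Join 29 (Bridge 28 32) (Threats [Join 27 (Bridge 26 30)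
    Adj, Join 25 Adj s1])]), (15, Threats [Join 17 (Bridge 16 20) s3, Join 25 (Bridge 24 28)
    (Threats [Join 22 Adj s3, (30, s2)])]), (15, Threats [Join 21 (Bridge 20 24) s3, (17, Threats
    [Join 16 Adj (Via 17 Adj s3), (13, Threats [Join 12 Adj (Via 17 (Via 13 Adj Adj) s3), Join 5
    (Bridge 4 8) (Threats [Join 9 Adj (Via 17 (Via 13 Adj Adj) s3), Join 3 (Bridge 2 6)
    Adj])])])]), (5, Threats [Join 3 (Via 5 (Bridge 4 8) (Bridge 2 6)) Adj, Join 3 (Via 5 (Threats
    [Join 8 Adj Adj, (9, s4)]) (Bridge 2 6)) Adj, Join 3 (Via 5 (Threats [Join 4 Adj Adj, (9,
    s4)]) (Bridge 2 6)) Adj, Join 30 (Threats [Join 29 (Bridge 28 32) Adj, Join 25 (Threats [Join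
    24 Adj Adj, (17, s5)]) (Bridge 26 29), Join 26 (Threats [Join 25 (Bridge 24 28) Adj, Join 25
    (Threats [Join 28 Adj Adj, (17, s5)]) Adj, (22, Via 30 (Threats [Join 21 (Bridge 20 24) (Via
    26 (Via 22 Adj Adj) Adj), (17, Via 26 (Via 22 (Via 18 (Via 17 (Threats [Join 16 Adj Adj, Join
    13 (Threats [Join 12 Adj Adj, Join 9 (Via 5 (Bridge 4 8) Adj) Adj]) Adj]) Adj) Adj) Adj)
    Adj)]) Adj)]) Adj]) (Bridge 27 31)])]) = Some 8581002108"
  by (simp add: carrier_eval assms)

lemma carrier_51:
  defines "s1 \<equiv> Via 16 Adj (Via 22 (Via 18 (Via 17 Adj Adj) Adj) Adj)"
  defines "s2 \<equiv> Threats [Join 19 (Via 16 Adj (Via 18 (Via 17 Adj Adj) Adj)) Adj, (22,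
    Threats [Join 23 s1 Adj, Join 30 (Threats [Join 26 s1 Adj, Join 32 Adj (Bridge 29 33)])
    (Bridge 27 31)])]"
  defines "s3 \<equiv> Via 5 (Bridge 4 8) (Via 6 Adj (Bridge 3 7))"
  defines "s4 \<equiv> Threats [Join 12 Adj Adj, Join 13 (Via 17 (Bridge 16 20) Adj) Adj]"
  defines "s5 \<equiv> Via 5 (Bridge 4 8) (Via 3 (Via 6 Adj Adj) Adj)"
  defines "s6 \<equiv> Via 5 (Bridge 4 8) (Via 7 (Via 6 Adj Adj) Adj)"
  defines "s7 \<equiv> Via 18 (Via 17 (Bridge 16 20) Adj) Adj"
  defines "s8 \<equiv> Via 20 Adj (Via 17 Adj (Via 22 (Via 18 Adj Adj) Adj))"
  defines "s9 \<equiv> Threats [Join 19 (Via 18 (Via 17 (Via 20 Adj Adj) Adj) Adj) Adj, (22,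
    Threats [Join 23 s8 Adj, Join 30 (Threats [Join 26 s8 Adj, Join 32 Adj (Bridge 29 33)])
    (Bridge 27 31)])]"
  defines "s10 \<equiv> Threats [Join 23 (Via 22 Adj Adj) Adj, Join 30 (Bridge 26 29) (Bridge 27
    31)]"
  defines "s11 \<equiv> Threats [Join 12 Adj Adj, Join 13 (Via 20 Adj (Via 17 Adj Adj)) Adj]"
  defines "s12 \<equiv> Via 7 (Via 6 (Via 9 Adj Adj) Adj) Adj"
  shows "first_carrier 17 (Threats [(16, Threats [Join 6 (Threats [Join 5 (Bridge 4 8) Adj, Join 9
    (Via 16 Adj (Bridge 12 13)) Adj]) (Bridge 3 7), (14, Threats [Join 11 (Via 14 (Via 16 Adj (Via
    17 Adj Adj)) Adj) Adj, (18, s2)])]), (6, Threats [(5, s3), Join 9 s4 (Via 6 Adj (Bridge 3 7)),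
    (3, Threats [(5, s5), Join 9 s4 (Via 3 (Via 6 Adj Adj) Adj)]), (7, Threats [(5, s6), Join 9 s4
    (Via 6 Adj (Via 7 Adj Adj))])]), (18, Threats [Join 19 s7 Adj, (20, s9), (16, s2), (22,
    Threats [Join 23 (Via 22 s7 Adj) Adj, Join 30 (Threats [Join 32 Adj (Bridge 29 33), Join 26
    (Via 22 s7 Adj) Adj]) (Bridge 27 31), Join 25 (Threats [Join 24 Adj Adj, (16, s1)]) s10, Join
    25 (Threats [Join 24 Adj Adj, (20, s8)]) s10])]), (6, Threats [(5, s3), (20, Threats [Join 9
    s11 (Via 6 Adj (Bridge 3 7)), (18, s9)]), (3, Threats [(5, s5), (20, Threats [Join 9 s11 (Via
    3 (Via 6 Adj Adj) Adj), (18, s9)])]), (7, Threats [(5, s6), (9, Threats [Join 12 Adj s12, (20,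
    Threats [Join 13 (Via 20 Adj (Via 17 Adj Adj)) s12, (14, Threats [Join 11 (Via 20 Adj (Via 17
    Adj (Via 14 Adj Adj))) Adj, (18, s9)])])])])])]) = Some 16909302776"
  by (simp add: carrier_eval assms)

lemma carrier_52:
  defines "s1 \<equiv> Via 19 (Via 18 (Via 21 Adj Adj) Adj) Adj"
  defines "s2 \<equiv> Via 34 (Bridge 30 33) (Bridge 31 35)"
  defines "s3 \<equiv> Threats [Join 24 Adj s1, Join 29 (Bridge 28 32) (Threats [Join 25 Adj s1,
    (34, s2)])]"
  defines "s4 \<equiv> Via 20 Adj (Via 17 Adj (Via 14 Adj Adj))"
  defines "s5 \<equiv> Via 1 (Bridge 0 4) (Bridge 2 5)"
  defines "s6 \<equiv> Via 14 (Via 16 Adj (Via 17 Adj Adj)) Adj"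
  defines "s7 \<equiv> Via 1 (Bridge 0 4) (Via 6 (Bridge 2 5) (Bridge 3 7))"
  defines "s8 \<equiv> Via 10 Adj (Via 6 Adj (Bridge 3 7))"
  defines "s9 \<equiv> Threats [Join 11 Adj Adj, (10, s8)]"
  defines "s10 \<equiv> Via 1 (Bridge 0 4) (Via 6 (Bridge 2 5) Adj)"
  defines "s11 \<equiv> Via 21 Adj (Via 18 Adj (Via 14 Adj Adj))"
  defines "s12 \<equiv> Threats [Join 11 (Via 24 Adj s11) Adj, Join 6 (Threats [Join 10 (Via 24
    Adj s11) Adj, (1, s5)]) (Bridge 3 7)]"
  defines "s13 \<equiv> Via 34 (Via 29 (Bridge 28 32) (Bridge 30 33)) (Bridge 31 35)"
  defines "s14 \<equiv> Via 34 (Via 28 Adj (Via 29 Adj (Bridge 30 33))) (Bridge 31 35)"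
  defines "s15 \<equiv> Threats [Join 11 (Via 28 Adj (Via 25 Adj s11)) Adj, Join 6 (Threats [Join
    10 (Via 28 Adj (Via 25 Adj s11)) Adj, (1, s5)]) (Bridge 3 7)]"
  defines "s16 \<equiv> Threats [Join 19 (Via 18 (Via 28 Adj (Via 25 Adj (Via 21 Adj Adj))) Adj)
    Adj, (14, s15)]"
  defines "s17 \<equiv> Via 34 (Via 32 Adj (Via 29 Adj (Bridge 30 33))) (Bridge 31 35)"
  defines "s18 \<equiv> Via 32 Adj (Via 29 Adj (Via 25 Adj s11))"
  defines "s19 \<equiv> Threats [Join 11 s18 Adj, Join 6 (Threats [Join 10 s18 Adj, (1, s5)])
    (Bridge 3 7)]"
  defines "s20 \<equiv> Threats [Join 19 (Via 18 (Via 32 Adj (Via 29 Adj (Via 25 Adj (Via 21 Adj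
    Adj)))) Adj) Adj, (14, s19)]"
  defines "s21 \<equiv> Threats [Join 28 Adj Adj, Join 32 Adj (Via 29 Adj Adj)]"
  defines "s22 \<equiv> Threats [Join 11 (Via 25 s21 s11) Adj, Join 6 (Threats [(1, s5), Join 10
    (Via 25 s21 s11) Adj]) (Bridge 3 7), (28, s15), (32, s19)]"
  defines "s23 \<equiv> Threats [Join 24 Adj (Via 11 s11 Adj), Join 29 (Bridge 28 32) (Threats
    [Join 25 Adj (Via 11 s11 Adj), (34, s2)])]"
  defines "s24 \<equiv> Via 1 (Bridge 0 4) (Via 7 (Via 6 (Bridge 2 5) Adj) Adj)"
  defines "s25 \<equiv> Via 7 (Via 21 Adj (Via 18 Adj (Via 14 Adj (Via 10 Adj Adj)))) Adj"
  defines "s26 \<equiv> Threats [Join 24 Adj s25, Join 29 (Bridge 28 32) (Threats [Join 25 Adj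
    s25, (34, s2)])]"
  defines "s27 \<equiv> Via 1 (Bridge 0 4) (Via 6 (Bridge 2 5) (Via 3 Adj Adj))"
  defines "s28 \<equiv> Via 14 Adj (Via 10 Adj (Via 6 Adj Adj))"
  defines "s29 \<equiv> Via 3 (Via 21 Adj (Via 18 Adj s28)) Adj"
  defines "s30 \<equiv> Threats [Join 24 Adj s29, Join 29 (Bridge 28 32) (Threats [Join 25 Adj
    s29, (34, s2)])]"
  defines "s31 \<equiv> Via 21 Adj (Via 18 Adj (Via 14 Adj s8))"
  defines "s32 \<equiv> Threats [Join 24 Adj s31, Join 29 (Bridge 28 32) (Threats [(34, s2), Join
    25 Adj s31]), (7, s26), (3, s30)]"
  defines "s33 \<equiv> Threats [Join 17 (Bridge 16 20) (Via 11 (Via 14 Adj Adj) Adj), (21, s23)]"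
  defines "s34 \<equiv> Threats [Join 17 (Bridge 16 20) (Via 7 (Via 14 Adj (Via 10 Adj Adj)) Adj),
    (21, s26)]"
  defines "s35 \<equiv> Via 7 (Via 21 Adj (Via 18 Adj (Via 14 Adj (Bridge 10 11)))) Adj"
  defines "s36 \<equiv> Via 14 Adj (Threats [Join 11 Adj Adj, Join 10 Adj (Via 3 (Via 6 Adj Adj)
    Adj)])"
  defines "s37 \<equiv> Threats [Join 17 (Bridge 16 20) (Via 3 s28 Adj), (21, s30)]"
  defines "s38 \<equiv> Via 21 Adj (Via 18 Adj (Via 14 Adj s9))"
  shows "first_carrier 18 (Threats [(19, Threats [Join 17 (Bridge 16 20) (Via 19 (Via 18 Adj Adj)
    Adj), (21, s3)]), (17, Threats [Join 19 (Via 18 (Via 17 (Bridge 16 20) Adj) Adj) Adj, (20,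
    Threats [Join 19 (Via 18 (Via 17 (Via 20 Adj Adj) Adj) Adj) Adj, (14, Threats [Join 11 s4 Adj,
    Join 6 (Threats [Join 10 s4 Adj, (1, s5)]) (Bridge 3 7)])]), (16, Threats [Join 19 (Via 16 Adj
    (Via 18 (Via 17 Adj Adj) Adj)) Adj, (14, Threats [Join 11 s6 Adj, Join 6 (Threats [Join 10 s6
    Adj, (1, s5)]) (Bridge 3 7)])]), (6, Threats [(1, s7), Join 14 (Via 17 (Bridge 16 20) Adj) s9,
    Join 7 (Threats [(1, s10), Join 14 (Via 17 (Bridge 16 20) Adj) (Bridge 10 11)]) Adj, Join 10
    (Threats [Join 14 (Via 17 (Bridge 16 20) Adj) Adj, (1, s10)]) (Threats [Join 11 Adj Adj, Join
    3 (Via 6 Adj Adj) Adj])])]), (21, Threats [(19, s3), (24, Threats [Join 19 (Via 18 (Via 24 Adj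
    (Via 21 Adj Adj)) Adj) Adj, (14, s12)]), (29, Threats [(34, s13), (28, Threats [(34, s14),
    (25, s16)]), (32, Threats [(34, s17), (25, s20)]), (25, Threats [Join 19 (Via 18 (Via 25 s21
    (Via 21 Adj Adj)) Adj) Adj, (28, s16), (32, s20), (14, s22)])]), (14, Threats [(11, s23), (24,
    s12), (6, Threats [(1, s7), (7, Threats [(1, s24), (10, s26)]), (3, Threats [(1, s27), (10,
    s30)]), (10, s32)]), (29, Threats [(34, s13), (28, Threats [(34, s14), (25, s15)]), (32,
    Threats [(34, s17), (25, s19)]), (25, s22)])])]), (6, Threats [(1, s7), (7, Threats [(1, s24),
    (14, Threats [Join 17 (Bridge 16 20) (Via 7 (Via 14 Adj (Bridge 10 11)) Adj), (11, s33), (10,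
    s34), (21, Threats [Join 24 Adj s35, Join 29 (Bridge 28 32) (Threats [Join 25 Adj s35, (34,
    s2)]), (11, s23), (10, s26)])])]), (3, Threats [(1, s27), (14, Threats [Join 17 (Bridge 16 20)
    s36, (11, s33), (10, s37), (21, Threats [Join 24 Adj (Via 21 Adj (Via 18 Adj s36)), Join 29
    (Bridge 28 32) (Threats [(34, s2), Join 25 Adj (Via 21 Adj (Via 18 Adj s36))]), (11, s23),
    (10, s30)])])]), (14, Threats [Join 17 (Bridge 16 20) (Via 14 Adj s9), (11, s33), (21, Threats
    [Join 24 Adj s38, (11, s23), Join 29 (Bridge 28 32) (Threats [(34, s2), Join 25 Adj s38]),
    (10, s32)]), (10, Threats [Join 17 (Bridge 16 20) (Via 14 Adj s8), (7, s34), (3, s37), (21,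
    s32)])])])]) = Some 68505521407"
  by (simp add: carrier_eval assms)

lemma carrier_53:
  defines "s1 \<equiv> Threats [Join 26 (Via 22 (Via 21 (Via 24 Adj Adj) Adj) Adj) Adj, Join 29
    (Threats [Join 32 Adj Adj, Join 25 (Via 24 Adj Adj) Adj]) Adj]"
  defines "s2 \<equiv> Threats [Join 26 (Via 20 Adj (Via 22 (Via 21 Adj Adj) Adj)) Adj, Join 29
    (Threats [Join 32 Adj Adj, Join 25 (Via 20 Adj (Via 21 Adj Adj)) Adj]) Adj]"
  defines "s3 \<equiv> Via 1 (Bridge 0 4) (Bridge 2 5)"
  defines "s4 \<equiv> Via 6 (Threats [(1, s3), Join 13 (Bridge 12 16) (Bridge 9 10)]) (Via 7 Adj
    Adj)"
  defines "s5 \<equiv> Via 25 (Bridge 24 28) (Via 19 (Via 22 Adj Adj) Adj)"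
  defines "s6 \<equiv> Threats [Join 15 Adj Adj, Join 10 Adj (Via 7 Adj Adj)]"
  defines "s7 \<equiv> Via 17 (Threats [Join 20 Adj Adj, Join 21 (Threats [Join 24 Adj Adj, Join
    29 (Bridge 28 32) (Threats [Join 25 Adj Adj, Join 26 Adj (Via 22 Adj Adj)])]) Adj]) Adj"
  defines "s8 \<equiv> Threats [Join 32 Adj Adj, Join 21 (Bridge 20 24) (Threats [Join 25 Adj Adj,
    Join 26 (Via 22 Adj Adj) Adj])]"
  defines "s9 \<equiv> Threats [Join 25 (Bridge 24 28) (Via 27 (Via 26 Adj Adj) Adj), Join 17
    (Bridge 16 20) (Threats [Join 21 Adj (Via 27 (Via 26 (Via 22 Adj Adj) Adj) Adj), Join 14 Adj
    s6])]"
  defines "s10 \<equiv> Threats [Join 25 (Bridge 24 28) (Via 31 (Via 30 (Via 26 Adj Adj) Adj)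
    Adj), Join 17 (Bridge 16 20) (Threats [Join 21 Adj (Via 31 (Via 30 (Via 26 (Via 22 Adj Adj)
    Adj) Adj) Adj), Join 14 Adj s6])]"
  defines "s11 \<equiv> Threats [Join 27 Adj Adj, Join 31 (Via 30 Adj Adj) Adj]"
  shows "first_carrier 22 (Threats [Join 29 (Bridge 28 32) (Threats [Join 30 Adj (Bridge 27 31),
    Join 19 (Via 22 (Bridge 25 26) Adj) Adj]), (26, Via 22 (Threats [Join 21 (Bridge 20 24) Adj,
    Join 29 (Bridge 28 32) (Via 26 Adj Adj)]) (Threats [Join 19 Adj Adj, Join 27 (Via 26 Adj Adj)
    Adj])), (21, Threats [Join 19 (Via 21 (Bridge 20 24) (Via 22 Adj Adj)) Adj, (24, Threats [Join
    19 (Via 24 Adj (Via 21 Adj (Via 22 Adj Adj))) Adj, Join 30 s1 (Bridge 27 31)]), (20, Threats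
    [Join 19 (Via 21 (Via 20 Adj Adj) (Via 22 Adj Adj)) Adj, Join 30 s2 (Bridge 27 31)]), Join 30
    (Threats [Join 26 (Via 22 (Via 21 (Bridge 20 24) Adj) Adj) Adj, Join 29 (Threats [Join 32 Adj
    Adj, Join 25 (Via 21 (Bridge 20 24) Adj) Adj]) Adj, (24, s1), (20, s2)]) (Bridge 27 31)]), (7,
    Threats [(6, s4), (19, Threats [(25, s5), Join 17 (Bridge 16 20) (Threats [Join 21 Adj (Via 19
    (Via 22 Adj Adj) Adj), Join 14 Adj s6])]), (20, Threats [Join 19 (Via 22 (Threats [Join 21
    (Via 20 Adj Adj) Adj, Join 25 (Bridge 24 28) Adj]) Adj) Adj, Join 6 (Threats [(1, s3), Join 9
    (Threats [Join 12 Adj Adj, Join 13 (Via 20 Adj (Bridge 16 17)) Adj]) Adj]) (Via 7 Adj Adj)]),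
    (19, Threats [(25, s5), (20, Threats [Join 21 (Via 20 Adj Adj) (Via 19 (Via 22 Adj Adj) Adj),
    Join 6 (Threats [(1, s3), Join 13 (Threats [Join 12 Adj Adj, Join 17 (Via 20 Adj Adj) Adj])
    (Bridge 9 10)]) (Via 7 Adj Adj)])])]), (7, Threats [(6, s4), Join 14 (Threats [Join 13 (Bridge
    12 16) Adj, (17, s7)]) s6, (6, Via 7 (Via 6 (Threats [(1, s3), Join 13 (Threats [Join 12 Adj
    Adj, (17, s7)]) (Bridge 9 10)]) Adj) Adj), (6, Via 7 (Via 6 (Threats [(1, s3), Join 9 (Threats
    [Join 12 Adj Adj, (13, Via 6 (Via 7 (Threats [Join 16 Adj (Via 6 (Via 13 Adj (Via 9 Adj Adj))
    Adj), (17, Via 6 (Via 9 (Via 13 s7 Adj) Adj) Adj)]) Adj) Adj)]) Adj]) Adj) Adj), (6, Threats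
    [Join 1 (Bridge 0 4) (Via 7 (Via 6 (Bridge 2 5) Adj) Adj), (30, Threats [Join 29 (Bridge 28
    32) (Via 30 Adj (Bridge 27 31)), Join 29 s8 (Via 30 Adj (Bridge 27 31)), (27, Threats [Join 29
    (Bridge 28 32) (Via 27 (Via 30 Adj Adj) Adj), Join 29 s8 (Via 27 (Via 30 Adj Adj) Adj), (26,
    s9)]), (31, Threats [Join 29 (Bridge 28 32) (Via 31 (Via 30 Adj Adj) Adj), Join 29 s8 (Via 31
    (Via 30 Adj Adj) Adj), (26, s10)]), (26, Threats [Join 25 (Bridge 24 28) (Via 26 Adj s11),
    Join 17 (Bridge 16 20) (Threats [Join 14 Adj s6, Join 21 Adj (Via 26 (Via 22 Adj Adj) s11)]),
    (27, s9), (31, s10)])])])])]) = Some 8581281527"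
  by (simp add: carrier_eval assms)

text \<open>The only shape with ten columns combines two ladders: one along row 1 through 17, 13 and
  9, with the opening stone 5 as escape, and one along row 2 through 18, 22 and 26, ending at
  34.\<close>

lemma carrier_54:
  defines "s1 \<equiv> Via 21 (Bridge 20 24) Adj"
  defines "s2 \<equiv> Via 9 (Threats [Join 12 Adj Adj, Join 13 (Threats [Join 16 Adj Adj, Join 17
    s1 Adj]) Adj]) Adj"
  defines "s3 \<equiv> Via 9 (Threats [Join 12 Adj Adj, Join 13 (Threats [Join 16 Adj Adj, Join 17
    (Via 24 Adj (Via 21 Adj Adj)) Adj]) Adj]) Adj"
  defines "s4 \<equiv> Via 24 Adj (Via 21 Adj (Via 26 (Via 22 Adj Adj) Adj))"
  defines "s5 \<equiv> Via 34 (Threats [Join 30 s4 Adj, Join 33 (Threats [Join 36 Adj Adj, Join 29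
    s4 Adj]) Adj]) (Bridge 31 35)"
  defines "s6 \<equiv> Threats [Join 27 s4 Adj, (34, s5)]"
  defines "s7 \<equiv> Threats [Join 23 (Via 22 (Via 21 (Via 24 Adj Adj) Adj) Adj) Adj, (26, s6)]"
  defines "s8 \<equiv> Via 9 (Threats [Join 12 Adj Adj, Join 13 (Via 20 Adj (Bridge 16 17)) Adj])
    Adj"
  defines "s9 \<equiv> Via 15 (Via 18 (Via 20 Adj (Via 21 Adj Adj)) Adj) Adj"
  defines "s10 \<equiv> Via 20 Adj (Via 26 (Via 22 (Via 21 Adj Adj) Adj) Adj)"
  defines "s11 \<equiv> Via 34 (Threats [Join 30 s10 Adj, Join 33 (Threats [Join 36 Adj Adj, Join
    29 s10 Adj]) Adj]) (Bridge 31 35)"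
  defines "s12 \<equiv> Threats [Join 27 s10 Adj, (34, s11)]"
  defines "s13 \<equiv> Threats [Join 23 (Via 20 Adj (Via 22 (Via 21 Adj Adj) Adj)) Adj, (26,
    s12)]"
  defines "s14 \<equiv> Threats [(15, s9), (22, s13)]"
  defines "s15 \<equiv> Via 27 (Via 26 (Via 22 s1 Adj) Adj) Adj"
  defines "s16 \<equiv> Via 15 (Via 21 (Bridge 20 24) (Via 18 Adj Adj)) Adj"
  defines "s17 \<equiv> Via 15 (Via 24 Adj (Via 21 Adj (Via 18 Adj Adj))) Adj"
  defines "s18 \<equiv> Via 30 (Via 26 (Via 22 s1 Adj) Adj) Adj"
  defines "s19 \<equiv> Via 33 (Threats [Join 36 Adj Adj, Join 29 (Via 26 (Via 22 s1 Adj) Adj)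
    Adj]) Adj"
  defines "s20 \<equiv> Via 26 (Via 22 Adj Adj) (Bridge 29 30)"
  defines "s21 \<equiv> Via 33 (Threats [Join 36 Adj Adj, Join 24 Adj (Via 21 Adj s20)]) Adj"
  defines "s22 \<equiv> Via 33 (Threats [Join 36 Adj Adj, Join 20 Adj (Via 26 (Via 22 (Via 21 Adj
    Adj) Adj) (Bridge 29 30))]) Adj"
  defines "s23 \<equiv> Via 34 (Threats [(30, s18), (33, s19), (33, s21), (33, s22)]) (Bridge 31
    35)"
  defines "s24 \<equiv> Via 9 (Via 5 (Bridge 4 8) Adj) Adj"
  defines "s25 \<equiv> Threats [Join 12 Adj Adj, (9, s24)]"
  defines "s26 \<equiv> Via 13 s25 (Via 17 Adj (Via 18 Adj Adj))"
  defines "s27 \<equiv> Via 22 (Via 18 (Via 17 Adj Adj) Adj) Adj"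
  defines "s28 \<equiv> Threats [Join 16 Adj s27, Join 13 s25 s27]"
  defines "s29 \<equiv> Threats [(27, s15), (20, s12), (24, s6), (34, s23)]"
  defines "s30 \<equiv> Via 17 (Threats [Join 16 Adj Adj, Join 13 s25 Adj]) Adj"
  defines "s31 \<equiv> Via 21 (Bridge 20 24) (Via 26 (Via 22 Adj Adj) Adj)"
  defines "s32 \<equiv> Via 22 (Threats [Join 16 Adj (Via 18 (Via 17 Adj Adj) Adj), Join 13 s25
    (Via 18 (Via 17 Adj Adj) Adj)]) Adj"
  defines "s33 \<equiv> Threats [Join 33 (Threats [Join 36 Adj Adj, Join 16 Adj (Via 26 s27
    (Bridge 29 30))]) Adj, Join 30 (Via 26 s28 Adj) Adj, Join 33 (Threats [Join 36 Adj Adj, Join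
    13 s25 (Via 26 s27 (Bridge 29 30))]) Adj, Join 33 (Threats [Join 36 Adj Adj, Join 29 (Via 26
    s28 Adj) Adj]) Adj]"
  defines "s34 \<equiv> Threats [Join 27 (Via 16 Adj (Via 26 s27 Adj)) Adj, Join 34 (Threats [Join
    30 (Via 16 Adj (Via 26 s27 Adj)) Adj, Join 33 (Threats [Join 36 Adj Adj, Join 29 (Via 16 Adj
    (Via 26 s27 Adj)) Adj]) Adj]) (Bridge 31 35)]"
  defines "s35 \<equiv> Via 22 (Via 18 (Via 17 (Via 13 s25 Adj) Adj) Adj) Adj"
  defines "s36 \<equiv> Via 22 (Via 18 (Via 17 (Via 13 Adj Adj) Adj) Adj) Adj"
  defines "s37 \<equiv> Threats [Join 27 (Via 12 Adj (Via 26 s36 Adj)) Adj, Join 34 (Threats [Join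
    30 (Via 12 Adj (Via 26 s36 Adj)) Adj, Join 33 (Threats [Join 36 Adj Adj, Join 29 (Via 12 Adj
    (Via 26 s36 Adj)) Adj]) Adj]) (Bridge 31 35)]"
  defines "s38 \<equiv> Via 22 (Via 18 (Via 17 (Via 13 s24 Adj) Adj) Adj) Adj"
  defines "s39 \<equiv> Via 22 (Via 18 (Via 17 (Via 13 (Via 9 Adj Adj) Adj) Adj) Adj) Adj"
  defines "s40 \<equiv> Threats [Join 27 (Via 8 Adj (Via 26 s39 Adj)) Adj, Join 34 (Threats [Join
    30 (Via 8 Adj (Via 26 s39 Adj)) Adj, Join 33 (Threats [Join 36 Adj Adj, Join 29 (Via 8 Adj
    (Via 26 s39 Adj)) Adj]) Adj]) (Bridge 31 35)]"
  defines "s41 \<equiv> Via 22 (Via 18 (Via 17 (Via 13 (Via 9 (Via 5 Adj Adj) Adj) Adj) Adj) Adj)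
    Adj"
  defines "s42 \<equiv> Threats [Join 27 (Via 4 Adj (Via 26 s41 Adj)) Adj, Join 34 (Threats [Join
    30 (Via 4 Adj (Via 26 s41 Adj)) Adj, Join 33 (Threats [Join 36 Adj Adj, Join 29 (Via 4 Adj
    (Via 26 s41 Adj)) Adj]) Adj]) (Bridge 31 35)]"
  defines "s43 \<equiv> Threats [Join 27 (Via 26 s38 Adj) Adj, (8, s40), (4, s42), Join 34
    (Threats [Join 30 (Via 26 s38 Adj) Adj, Join 33 (Threats [Join 36 Adj Adj, Join 8 Adj (Via 26
    s39 (Bridge 29 30))]) Adj, Join 33 (Threats [Join 36 Adj Adj, Join 29 (Via 26 s38 Adj) Adj])
    Adj, Join 33 (Threats [Join 36 Adj Adj, Join 4 Adj (Via 26 s41 (Bridge 29 30))]) Adj]) (Bridge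
    31 35)]"
  defines "s44 \<equiv> Threats [Join 27 (Via 26 s35 Adj) Adj, (12, s37), Join 34 (Threats [Join
    33 (Threats [Join 36 Adj Adj, Join 12 Adj (Via 26 s36 (Bridge 29 30))]) Adj, Join 30 (Via 26
    s35 Adj) Adj, Join 33 (Threats [Join 36 Adj Adj, Join 9 (Via 5 (Bridge 4 8) Adj) (Via 26 s36
    (Bridge 29 30))]) Adj, Join 33 (Threats [Join 36 Adj Adj, Join 29 (Via 26 s35 Adj) Adj]) Adj])
    (Bridge 31 35), (9, s43)]"
  defines "s45 \<equiv> Threats [Join 27 (Via 26 (Via 22 (Via 18 s30 Adj) Adj) Adj) Adj, (16,
    s34), Join 34 s33 (Bridge 31 35), (13, s44)]"
  defines "s46 \<equiv> Threats [Join 23 (Via 16 Adj s27) Adj, (26, s34)]"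
  defines "s47 \<equiv> Threats [Join 23 (Via 12 Adj s36) Adj, (26, s37)]"
  defines "s48 \<equiv> Threats [Join 23 (Via 8 Adj s39) Adj, (26, s40)]"
  defines "s49 \<equiv> Threats [Join 23 (Via 4 Adj s41) Adj, (26, s42)]"
  defines "s50 \<equiv> Threats [Join 23 s38 Adj, (8, s48), (4, s49), (26, s43)]"
  defines "s51 \<equiv> Threats [Join 23 s35 Adj, (12, s47), (9, s50), (26, s44)]"
  defines "s52 \<equiv> Threats [Join 23 s32 Adj, (16, s46), (26, s45), (13, s51)]"
  defines "s53 \<equiv> Via 17 (Via 13 (Via 9 Adj Adj) Adj) (Via 18 Adj Adj)"
  shows "first_carrier 5 (Threats [Join 3 (Via 5 (Bridge 4 8) (Bridge 2 6)) Adj, (21, Threats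
    [Join 3 (Via 5 (Threats [Join 8 Adj Adj, (9, s2)]) (Bridge 2 6)) Adj, (24, Threats [Join 3
    (Via 5 (Threats [Join 8 Adj Adj, (9, s3)]) (Bridge 2 6)) Adj, (22, s7)]), (20, Threats [Join 3
    (Via 5 (Threats [Join 8 Adj Adj, (9, s8)]) (Bridge 2 6)) Adj, (18, s14)]), (22, Threats [Join
    23 (Via 22 s1 Adj) Adj, (20, s13), (24, s7), (26, Threats [(27, s15), (24, s6), (20, s12),
    (18, Threats [(15, s16), (20, Threats [(15, s9), (34, s11)]), (24, Threats [(15, s17), (34,
    s5)]), (34, s23)])])])]), (21, Threats [Join 3 (Via 5 (Threats [Join 4 Adj Adj, (9, s2)])
    (Bridge 2 6)) Adj, (20, Threats [Join 3 (Via 5 (Threats [Join 4 Adj Adj, (9, s8)]) (Bridge 2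
    6)) Adj, (22, s13)]), (24, Threats [Join 3 (Via 5 (Threats [Join 4 Adj Adj, (9, s3)]) (Bridge
    2 6)) Adj, (22, s7)]), (22, Threats [Join 23 (Via 22 s1 Adj) Adj, (20, s13), (24, s7), (18,
    Threats [(15, s16), (20, Threats [(15, s9), (26, s12)]), (24, Threats [(15, s17), (26, s6)]),
    (26, Threats [(27, s15), (20, s12), (24, s6), Join 34 (Threats [(30, s18), (33, s19), (33,
    s22), (33, s21)]) (Bridge 31 35)])])])]), (18, Threats [Join 15 (Via 18 (Threats [(21, s1),
    (17, Via 15 (Threats [Join 16 Adj (Via 17 Adj (Via 18 Adj Adj)), (13, s26)]) Adj)]) Adj) Adj,
    (21, Threats [(15, s16), (24, Threats [(15, s17), (22, s7)]), (20, s14), (22, Threats [Join 23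
    (Via 22 s1 Adj) Adj, (24, s7), (20, s13), (26, Threats [(27, s15), (24, s6), (20, s12), (34,
    s23)])])]), (22, Threats [Join 23 (Via 22 (Via 18 (Threats [(21, s1), (17, Via 22 (Via 23 s28
    Adj) Adj)]) Adj) Adj) Adj, (21, Threats [Join 23 (Via 22 s1 Adj) Adj, (24, s7), (20, s13),
    (26, s29)]), (26, Threats [Join 27 (Via 26 (Via 22 (Threats [(21, s1), Join 17 (Bridge 16 20)
    (Via 18 Adj Adj), (21, Via 18 (Via 21 (Threats [Join 24 Adj Adj, (17, s30)]) Adj) Adj)]) Adj)
    Adj) Adj, (21, s29), Join 34 (Threats [Join 33 (Threats [Join 36 Adj Adj, Join 21 (Bridge 20
    24) s20]) Adj, Join 30 (Threats [(21, s31), (17, Via 26 s32 Adj)]) Adj, Join 33 (Threats [Join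
    36 Adj Adj, Join 29 (Threats [(21, s31), (17, Via 26 s28 Adj)]) Adj]) Adj, (17, s33)]) (Bridge
    31 35), (17, s45)]), (17, s52)]), (17, Threats [Join 15 (Via 18 s30 Adj) Adj, (16, Threats
    [Join 15 (Via 17 (Via 16 Adj Adj) (Via 18 Adj Adj)) Adj, (22, s46)]), (13, Threats [Join 15
    s26 Adj, (12, Threats [Join 15 (Via 13 (Via 12 Adj Adj) (Via 17 Adj (Via 18 Adj Adj))) Adj,
    (22, s47)]), (9, Threats [Join 15 (Via 5 (Bridge 4 8) s53) Adj, (8, Threats [Join 15 (Via 9
    (Via 8 Adj Adj) (Via 17 (Via 13 Adj Adj) (Via 18 Adj Adj))) Adj, (22, s48)]), (4, Threats
    [Join 15 (Via 5 (Via 4 Adj Adj) s53) Adj, (22, s49)]), (22, s50)]), (22, s51)]), (22,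
    s52)])])]) = Some 132841452412"
  by (simp add: carrier_eval assms)

lemmas carriers = carrier_1 carrier_2 carrier_3 carrier_4 carrier_5 carrier_6 carrier_7 carrier_8
  carrier_9 carrier_10 carrier_11 carrier_12 carrier_13 carrier_14 carrier_15 carrier_16
  carrier_17 carrier_18 carrier_19 carrier_20 carrier_21 carrier_22 carrier_23 carrier_24
  carrier_25 carrier_26 carrier_27 carrier_28 carrier_29 carrier_30 carrier_31 carrier_32
  carrier_33 carrier_34 carrier_35 carrier_36 carrier_37 carrier_38 carrier_39 carrier_40
  carrier_41 carrier_42 carrier_43 carrier_44 carrier_45 carrier_46 carrier_47 carrier_48
  carrier_49 carrier_50 carrier_51 carrier_52 carrier_53 carrier_54

section \<open>Data: the shapes and the states\<close>

text \<open>The winning shapes, each with its number of columns and its rotated copy.\<close>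

definition family :: "(nat \<times> nat \<times> nat) list" where
  "family = [(4, 5119, 65480), (4, 65279, 65407), (5, 79864, 130760), (5, 79615, 1046216), (5,
    130040, 130552), (5, 130807, 980984), (5, 1044223, 1046399), (6, 1302472, 1309640), (6,
    2074616, 2090488), (6, 1277823, 16711368), (6, 1304575, 16771016), (6, 1306367, 16742344), (6,
    2084095, 16724984), (6, 2080639, 16711160), (6, 2088831, 16710648), (6, 2096767, 16678904),
    (6, 16724735, 16731391), (6, 15695743, 16711415), (6, 15723519, 16766967), (7, 20380616,
    20838088), (7, 20381384, 20444872), (7, 20836344, 33520584), (7, 20889592, 33544136), (7,
    20905464, 33290184), (7, 20937720, 33419208), (7, 20955000, 32497608), (7, 20902655,
    267712456), (7, 32239608, 33521016), (7, 33226232, 33289720), (7, 20905719, 251131848), (7,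
    65855359, 267367292), (7, 267373823, 267599743), (8, 325902280, 335230664), (8, 326087548,
    1053685448), (8, 335230840, 518840264), (8, 531837944, 533515768), (8, 325578744, 536340168),
    (8, 534739912, 333380600), (8, 334482687, 4281595848), (8, 334970751, 4277989320), (8,
    519958520, 536330104), (8, 532630783, 4281531896), (8, 1056374264, 532639612), (8, 519993087,
    4285431672), (9, 5214433272, 8581232328), (9, 5351796680, 5360056264), (9, 6433273336,
    8505847784), (9, 8301441016, 8581232504), (9, 8555836284, 16858938360), (9, 8581002108,
    16858935288), (9, 16909302776, 8555315068), (9, 68505521407, 68504505599), (9, 8581281527,
    64273379320), (10, 132841452412, 269743011704)]"

definition shapes :: "nat list" where
  "shapes = concat (map (\<lambda>(w, m, m'). [m, m']) family)"

text \<open>A list is a selection of the due shapes; forgetting the others lets different histories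
  share a state. The entry 1 demands a stone in row 0 of the next column, the entry 15 a stone
  anywhere in it.\<close>

definition states :: "(nat \<times> nat list) list" where
  "states = [(0, []), (1, [4092, 4991, 8172, 8127, 8159, 81404, 1045311, 20368892, 1305599,
    2031100, 1042431, 32427516, 33344735, 325902079]), (3, [311, 255, 507, 509, 510, 4975, 5087,
    4079, 65331, 65388, 81535, 81599, 130255, 65151, 130655, 1273055, 2084045, 126943, 2026719,
    982719, 20368879, 2076639, 2080607, 16710863, 66023391, 267595743, 402079583]), (5, [19, 15,
    317, 318, 254, 491, 4967, 4084, 8140, 79565, 7933, 126669, 129788, 130036, 257246, 126951,
    1273836, 980733, 1044460, 1048188, 16724732, 16724980, 33521260]), (2, [255, 4991, 5087, 4087,
    8127, 8175, 61311, 257247, 1273779, 1309495, 1044403, 1045311, 1306607, 1308607, 1044463,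
    1047935, 16739967, 33421235, 33519539, 33520439, 33419199, 518911923, 1053683639]), (5, [19,
    15, 310, 317, 254, 5095, 5099, 8140, 4071, 8165, 79565, 7933, 130252, 126669, 61419, 1273054,
    129789, 130037, 1273836, 1044428, 1048188, 4126461, 16724733, 25129973, 33521260]), (4, [19,
    508, 4972, 495, 7916, 8111, 81852, 61295, 65511, 1045295, 2095036, 2095078, 267374332]), (4,
    [1, 318, 7934]), (4, [15, 311, 317, 507, 510, 3831, 16077, 65331, 65388, 79611, 81852, 81662,
    81787, 65275, 65278, 65495, 1277804, 1302380, 131047, 1046247, 1046396, 2080636, 2088700,
    2095027, 2095036, 2088699, 2088827, 2094971, 2095063, 65855340, 15695740, 32431995, 65855227,
    33289975, 267599740, 267374332, 334487292, 335003516]), (4, [19, 508, 4972, 495, 7916, 8140,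
    8111, 81852, 65511, 257903, 1045295, 2095036, 2095078, 267374332]), (3, [1, 4094, 130942]),
    (6, [1, 30, 310, 494, 506, 3830, 8172, 65330, 65388, 20951916, 536327020]), (3, [19, 495,
    8172, 65388, 20951916, 536327020]), (3, [31, 4086, 5103, 5115, 8172, 4079, 65388, 79862,
    81398, 65399, 130039, 130543, 130939, 4115958, 20951916, 980983, 20380471, 20951927, 16710455,
    16724983, 16710895, 20905455, 20937719, 536327020, 267839479, 534739767, 536312631, 536327031,
    534707191, 8302590775, 16858938231]), (6, [1, 310, 254, 506, 5086, 5102, 8140, 4078, 7870,
    65330, 65356, 79486, 81650, 130252, 1273054, 126942, 2026718, 2080588, 2031222, 2076622,
    4115950, 15691742, 267595724, 267599692]), (3, [31, 4975, 4083, 5111, 8172, 4079, 65388,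
    130543, 130551, 130935, 130939, 2026999, 4115951, 20951927, 267839479, 536327031]), (3, [19,
    239, 4093, 8190, 65390, 130941, 2080623, 536330095]), (3, [19, 239, 506, 8189, 65359, 130941,
    130942, 2080623, 536330095]), (6, [1, 30, 310, 494, 506, 508, 16118, 65330, 65388, 20951916,
    536327020]), (5, [1, 30, 4086, 8172, 1273836, 1309494, 1044460, 33520438]), (5, [1, 318, 254,
    4086, 8172, 8158, 1273836, 1309494, 1044430, 1048188, 1306590, 33520438, 33521260]), (5, [1,
    310, 254, 8172, 8158, 257246, 1273836, 1044460, 1048188, 33521260]), (2, [319, 255, 8159,
    8175, 8183, 126687, 1309495, 1306607, 1044463, 16739967, 33520439]), (5, [1, 14, 4086, 130038,
    33520630]), (2, [319, 255, 8115, 8159, 8175, 1309495, 258015, 1306607, 1044463, 16739967,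
    33520439]), (2, [511, 4991, 8172, 8127, 8159, 8183, 61311, 129663, 1273788, 1273836, 1044460,
    1045311, 1302271, 1306591, 1308607, 1309687, 2096508, 1044415, 1044447, 2014975, 16732028,
    33239871, 33344735, 20348671, 33521260, 20836287, 33421244, 325902079, 32497407, 33520631,
    518840063, 531615486, 1053683455, 1053683647, 1056831423, 4017086207]), (4, [15, 311, 507,
    509, 510, 3831, 16077, 65331, 65388, 79611, 81779, 81852, 81662, 65275, 65278, 65495, 1277804,
    1302380, 131047, 1046247, 1046396, 2080636, 2088700, 2095027, 2095036, 2088699, 2088827,
    2094971, 2095063, 65855340, 15695740, 32431995, 65855227, 33289975, 267599740, 267374332,
    334487292, 335003516]), (4, [19, 15, 509, 510, 65388, 79614, 81852, 65276, 81661, 65511,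
    1277804, 1302380, 1046396, 2080636, 2088700, 2095036, 2095078, 65855340, 15695740, 267599740,
    267374332, 334487292, 335003516]), (1, [511, 81855, 2095039]), (4, [19, 15, 509, 510, 16077,
    65388, 79614, 81852, 65278, 65511, 1277804, 1302380, 1046396, 2080636, 2088700, 2095036,
    2095078, 65855340, 15695740, 267599740, 267374332, 334487292, 335003516]), (4, [19, 15, 509,
    510, 16125, 65388, 81852, 81662, 65278, 1277804, 1302380, 131047, 1046247, 1046396, 2080636,
    2088700, 2095036, 65855340, 15695740, 267599740, 267374332, 334487292, 335003516]), (4, [31,
    311, 507, 509, 510, 4975, 3831, 8103, 4079, 65331, 65388, 79611, 79614, 81852, 81391, 81647,
    81661, 81787, 130255, 65263, 65275, 65277, 65278, 125935, 1277804, 1302380, 2077491, 2084045,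
    131031, 1045295, 1045711, 1271791, 1306415, 1045751, 1046396, 1302267, 2080636, 2088700,
    2095036, 2095078, 20368879, 2031087, 2088827, 2095063, 65855340, 15695740, 32427503, 33289423,
    32499567, 33225967, 65855215, 65855227, 33289975, 267599740, 66051963, 267374332, 334487292,
    335003516, 251067887, 4281531599, 4281595087]), (3, [31, 4975, 5115, 8172, 4079, 4087, 65388,
    79863, 130255, 65399, 130039, 130551, 130939, 980983, 4115959, 20380471, 20905167, 20951927,
    16710455, 16710863, 16724983, 20935671, 267839479, 534739767, 536312631, 536327031, 534707191,
    8302590775, 16858938231]), (2, [255, 4991, 4087, 8127, 8159, 8175, 61311, 257247, 1273779,
    1309495, 1044403, 1045311, 1308479, 1306607, 1044463, 1047935, 16739967, 33421235, 33519539,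
    33520439, 33419199, 518911923, 1053683639]), (3, [31, 4975, 4083, 5111, 8172, 4079, 65388,
    129843, 81391, 130551, 4115951, 20951927, 4128247, 267839479, 536327031])]"

lemma length_states: "length states = 35"
  by (simp add: states_def)

text \<open>One rewrite rule per index, so that the table checks do not traverse the list.\<close>

lemma states_nth:
  "states ! 0 = (0, [])"
  "states ! 1 = (1, [4092, 4991, 8172, 8127, 8159, 81404, 1045311, 20368892, 1305599, 2031100,
    1042431, 32427516, 33344735, 325902079])"
  "states ! 2 = (3, [311, 255, 507, 509, 510, 4975, 5087, 4079, 65331, 65388, 81535, 81599,
    130255, 65151, 130655, 1273055, 2084045, 126943, 2026719, 982719, 20368879, 2076639, 2080607,
    16710863, 66023391, 267595743, 402079583])"
  "states ! 3 = (5, [19, 15, 317, 318, 254, 491, 4967, 4084, 8140, 79565, 7933, 126669, 129788,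
    130036, 257246, 126951, 1273836, 980733, 1044460, 1048188, 16724732, 16724980, 33521260])"
  "states ! 4 = (2, [255, 4991, 5087, 4087, 8127, 8175, 61311, 257247, 1273779, 1309495, 1044403,
    1045311, 1306607, 1308607, 1044463, 1047935, 16739967, 33421235, 33519539, 33520439, 33419199,
    518911923, 1053683639])"
  "states ! 5 = (5, [19, 15, 310, 317, 254, 5095, 5099, 8140, 4071, 8165, 79565, 7933, 130252,
    126669, 61419, 1273054, 129789, 130037, 1273836, 1044428, 1048188, 4126461, 16724733,
    25129973, 33521260])"
  "states ! 6 = (4, [19, 508, 4972, 495, 7916, 8111, 81852, 61295, 65511, 1045295, 2095036,
    2095078, 267374332])"
  "states ! 7 = (4, [1, 318, 7934])"
  "states ! 8 = (4, [15, 311, 317, 507, 510, 3831, 16077, 65331, 65388, 79611, 81852, 81662,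
    81787, 65275, 65278, 65495, 1277804, 1302380, 131047, 1046247, 1046396, 2080636, 2088700,
    2095027, 2095036, 2088699, 2088827, 2094971, 2095063, 65855340, 15695740, 32431995, 65855227,
    33289975, 267599740, 267374332, 334487292, 335003516])"
  "states ! 9 = (4, [19, 508, 4972, 495, 7916, 8140, 8111, 81852, 65511, 257903, 1045295, 2095036,
    2095078, 267374332])"
  "states ! 10 = (3, [1, 4094, 130942])"
  "states ! 11 = (6, [1, 30, 310, 494, 506, 3830, 8172, 65330, 65388, 20951916, 536327020])"
  "states ! 12 = (3, [19, 495, 8172, 65388, 20951916, 536327020])"
  "states ! 13 = (3, [31, 4086, 5103, 5115, 8172, 4079, 65388, 79862, 81398, 65399, 130039,
    130543, 130939, 4115958, 20951916, 980983, 20380471, 20951927, 16710455, 16724983, 16710895,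
    20905455, 20937719, 536327020, 267839479, 534739767, 536312631, 536327031, 534707191,
    8302590775, 16858938231])"
  "states ! 14 = (6, [1, 310, 254, 506, 5086, 5102, 8140, 4078, 7870, 65330, 65356, 79486, 81650,
    130252, 1273054, 126942, 2026718, 2080588, 2031222, 2076622, 4115950, 15691742, 267595724,
    267599692])"
  "states ! 15 = (3, [31, 4975, 4083, 5111, 8172, 4079, 65388, 130543, 130551, 130935, 130939,
    2026999, 4115951, 20951927, 267839479, 536327031])"
  "states ! 16 = (3, [19, 239, 4093, 8190, 65390, 130941, 2080623, 536330095])"
  "states ! 17 = (3, [19, 239, 506, 8189, 65359, 130941, 130942, 2080623, 536330095])"
  "states ! 18 = (6, [1, 30, 310, 494, 506, 508, 16118, 65330, 65388, 20951916, 536327020])"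
  "states ! 19 = (5, [1, 30, 4086, 8172, 1273836, 1309494, 1044460, 33520438])"
  "states ! 20 = (5, [1, 318, 254, 4086, 8172, 8158, 1273836, 1309494, 1044430, 1048188, 1306590,
    33520438, 33521260])"
  "states ! 21 = (5, [1, 310, 254, 8172, 8158, 257246, 1273836, 1044460, 1048188, 33521260])"
  "states ! 22 = (2, [319, 255, 8159, 8175, 8183, 126687, 1309495, 1306607, 1044463, 16739967,
    33520439])"
  "states ! 23 = (5, [1, 14, 4086, 130038, 33520630])"
  "states ! 24 = (2, [319, 255, 8115, 8159, 8175, 1309495, 258015, 1306607, 1044463, 16739967,
    33520439])"
  "states ! 25 = (2, [511, 4991, 8172, 8127, 8159, 8183, 61311, 129663, 1273788, 1273836, 1044460,
    1045311, 1302271, 1306591, 1308607, 1309687, 2096508, 1044415, 1044447, 2014975, 16732028,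
    33239871, 33344735, 20348671, 33521260, 20836287, 33421244, 325902079, 32497407, 33520631,
    518840063, 531615486, 1053683455, 1053683647, 1056831423, 4017086207])"
  "states ! 26 = (4, [15, 311, 507, 509, 510, 3831, 16077, 65331, 65388, 79611, 81779, 81852,
    81662, 65275, 65278, 65495, 1277804, 1302380, 131047, 1046247, 1046396, 2080636, 2088700,
    2095027, 2095036, 2088699, 2088827, 2094971, 2095063, 65855340, 15695740, 32431995, 65855227,
    33289975, 267599740, 267374332, 334487292, 335003516])"
  "states ! 27 = (4, [19, 15, 509, 510, 65388, 79614, 81852, 65276, 81661, 65511, 1277804,
    1302380, 1046396, 2080636, 2088700, 2095036, 2095078, 65855340, 15695740, 267599740,
    267374332, 334487292, 335003516])"
  "states ! 28 = (1, [511, 81855, 2095039])"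
  "states ! 29 = (4, [19, 15, 509, 510, 16077, 65388, 79614, 81852, 65278, 65511, 1277804,
    1302380, 1046396, 2080636, 2088700, 2095036, 2095078, 65855340, 15695740, 267599740,
    267374332, 334487292, 335003516])"
  "states ! 30 = (4, [19, 15, 509, 510, 16125, 65388, 81852, 81662, 65278, 1277804, 1302380,
    131047, 1046247, 1046396, 2080636, 2088700, 2095036, 65855340, 15695740, 267599740, 267374332,
    334487292, 335003516])"
  "states ! 31 = (4, [31, 311, 507, 509, 510, 4975, 3831, 8103, 4079, 65331, 65388, 79611, 79614,
    81852, 81391, 81647, 81661, 81787, 130255, 65263, 65275, 65277, 65278, 125935, 1277804,
    1302380, 2077491, 2084045, 131031, 1045295, 1045711, 1271791, 1306415, 1045751, 1046396,
    1302267, 2080636, 2088700, 2095036, 2095078, 20368879, 2031087, 2088827, 2095063, 65855340,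
    15695740, 32427503, 33289423, 32499567, 33225967, 65855215, 65855227, 33289975, 267599740,
    66051963, 267374332, 334487292, 335003516, 251067887, 4281531599, 4281595087])"
  "states ! 32 = (3, [31, 4975, 5115, 8172, 4079, 4087, 65388, 79863, 130255, 65399, 130039,
    130551, 130939, 980983, 4115959, 20380471, 20905167, 20951927, 16710455, 16710863, 16724983,
    20935671, 267839479, 534739767, 536312631, 536327031, 534707191, 8302590775, 16858938231])"
  "states ! 33 = (2, [255, 4991, 4087, 8127, 8159, 8175, 61311, 257247, 1273779, 1309495, 1044403,
    1045311, 1308479, 1306607, 1044463, 1047935, 16739967, 33421235, 33519539, 33520439, 33419199,
    518911923, 1053683639])"
  "states ! 34 = (3, [31, 4975, 4083, 5111, 8172, 4079, 65388, 129843, 81391, 130551, 4115951,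
    20951927, 4128247, 267839479, 536327031])"
  by (simp_all add: states_def)

lemmas automaton_eval = column_ok_def after_def stones_def states_nth length_states

section \<open>Transition tables, one for each column with at most two stones\<close>

text \<open>An empty column hits nothing, so all shapes are continued. The list is computed once for
  all states.\<close>

lemma after_0:
  "after 0 shapes = [319, 4092, 4079, 4087, 4991, 8172, 4975, 65388, 8127, 8159, 8175, 61311,
    65263, 65399, 81404, 81852, 129663, 130655, 79863, 1044460, 81535, 1048188, 81647, 1046396,
    130255, 1045311, 130039, 1044447, 130551, 1044415, 131047, 1042431, 1045295, 1045711, 980983,
    1044463, 982719, 1047935, 1273788, 1302380, 1273836, 1277804, 1302271, 2095036, 1305599,
    2096508, 1306591, 2080636, 1308607, 2088700, 1309687, 2031100, 1306415, 16732028, 2014975,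
    2095063, 2076639, 2080607, 1306607, 15695740, 4115959, 16710455, 16710863, 16724983, 20368892,
    20951916, 20380471, 65855340, 20951927, 32427516, 33239871, 33344735, 20348671, 33521260,
    33421244, 20836287, 20905167, 267599740, 20935671, 267374332, 32497407, 33520631, 33289423,
    267595743, 66023391, 33289975, 32499567, 267839479, 325902079, 536327020, 334487292,
    335003516, 402079583, 531615486, 518840063, 536327031, 534739767, 1053683647, 536312631,
    1053683455, 1056831423, 534707191, 4281595087, 4281531599, 536330095, 4017086207, 8302590775,
    16858938231]"
  by (simp add: after_def shapes_def family_def del: One_nat_def)

text \<open>State entries that properly contain the remainder of some shape; those equal to a
  remainder are supplied by \<open>fresh_after\<close>.\<close>

lemma fresh_0:
  "fresh shapes 0 511" "fresh shapes 0 8183"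
  by (simp_all add: fresh_def after_0 del: One_nat_def)

text \<open>An empty column raises e by two. All states with \<open>e \<ge> 5\<close> have entry 0,
  that is, an empty column would complete a due shape. This keeps the deficit from passing
  six.\<close>

lemma column_0:
  "list_all (\<lambda>(i, j). column_ok shapes states 0 (states ! i) j) [(0, 25), (1, 2), (2, 5),
    (3, 0), (4, 8), (5, 0), (6, 11), (7, 0), (8, 0), (9, 18), (10, 0), (11, 0), (12, 19), (13,
    20), (14, 0), (15, 21), (16, 23), (17, 23), (18, 0), (19, 0), (20, 0), (21, 0), (22, 30), (23,
    0), (24, 30), (25, 31), (26, 0), (27, 0), (28, 32), (29, 0), (30, 0), (31, 14), (32, 20), (33,
    26), (34, 21)]"
  by (simp add: automaton_eval fresh_0 fresh_after[of shapes 0, unfolded after_0 list.pred_inject] del: One_nat_def)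

lemma after_1:
  "after 1 shapes = [4092, 4991, 8172, 65388, 8127, 8159, 61311, 81404, 81852, 129663, 130655,
    1044460, 1048188, 1046396, 1045311, 1044447, 1044415, 1042431, 1273788, 1302380, 1273836,
    1277804, 1302271, 2095036, 1305599, 2096508, 1306591, 2080636, 1308607, 2088700, 1309687,
    2031100, 16732028, 2014975, 2095063, 2076639, 2080607, 15695740, 16710455, 20368892, 20951916,
    20380471, 65855340, 20951927, 32427516, 33239871, 33344735, 20348671, 33521260, 33421244,
    20836287, 267599740, 267374332, 32497407, 33520631, 267595743, 66023391, 33289975, 267839479,
    325902079, 536327020, 334487292, 335003516, 402079583, 531615486, 518840063, 536327031,
    534739767, 1053683647, 536312631, 1053683455, 1056831423, 534707191, 4017086207, 8302590775,
    16858938231]"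
  by (simp add: after_def shapes_def family_def del: One_nat_def)

lemma fresh_1:
  "fresh shapes 1 81855" "fresh shapes 1 2095039"
  by (simp_all add: fresh_def after_1 del: One_nat_def)

text \<open>A single stone settles a deficit of at most one, hence the zeros at 0, 1 and 28. The
  zero at 23 is a refutation: the shapes 1 and 14 of that state demand two stones in one
  column.\<close>

lemma column_1:
  "list_all (\<lambda>(i, j). column_ok shapes states 1 (states ! i) j) [(0, 0), (1, 0), (2, 25),
    (3, 29), (4, 1), (5, 27), (6, 13), (7, 12), (8, 13), (9, 13), (10, 25), (11, 19), (12, 25),
    (13, 25), (14, 3), (15, 25), (16, 25), (17, 25), (18, 19), (19, 30), (20, 27), (21, 29), (22,
    1), (23, 0), (24, 1), (25, 28), (26, 13), (27, 13), (28, 0), (29, 13), (30, 13), (31, 13),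
    (32, 25), (33, 1), (34, 25)]"
  by (simp add: automaton_eval fresh_1 fresh_after[of shapes 1, unfolded after_1 list.pred_inject] del: One_nat_def)

lemma after_2:
  "after 2 shapes = [4092, 4991, 8172, 65388, 8127, 8159, 61311, 81404, 81852, 129663, 130655,
    1044460, 1048188, 1046396, 1045311, 1044447, 1044415, 1042431, 1273788, 1302380, 1273836,
    1277804, 1302271, 2095036, 1305599, 2096508, 1306591, 2080636, 1308607, 2088700, 1309687,
    2031100, 16732028, 2014975, 2095063, 2076639, 2080607, 15695740, 16710455, 20368892, 20951916,
    20380471, 65855340, 20951927, 32427516, 33239871, 33344735, 20348671, 33521260, 33421244,
    20836287, 267599740, 267374332, 32497407, 33520631, 267595743, 66023391, 33289975, 267839479,
    325902079, 536327020, 334487292, 335003516, 402079583, 531615486, 518840063, 536327031,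
    534739767, 1053683647, 536312631, 1053683455, 1056831423, 534707191, 4017086207, 8302590775,
    16858938231]"
  by (simp add: after_def shapes_def family_def del: One_nat_def)

lemma fresh_2:
  "fresh shapes 2 81855" "fresh shapes 2 2095039"
  by (simp_all add: fresh_def after_2 del: One_nat_def)

lemma column_2:
  "list_all (\<lambda>(i, j). column_ok shapes states 2 (states ! i) j) [(0, 0), (1, 0), (2, 25),
    (3, 6), (4, 1), (5, 9), (6, 13), (7, 0), (8, 13), (9, 13), (10, 0), (11, 0), (12, 25), (13,
    25), (14, 0), (15, 25), (16, 25), (17, 25), (18, 0), (19, 0), (20, 0), (21, 0), (22, 1), (23,
    0), (24, 1), (25, 28), (26, 13), (27, 13), (28, 0), (29, 13), (30, 13), (31, 13), (32, 25),
    (33, 1), (34, 25)]"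
  by (simp add: automaton_eval fresh_2 fresh_after[of shapes 2, unfolded after_2 list.pred_inject] del: One_nat_def)

lemma after_4:
  "after 4 shapes = [4092, 4991, 8172, 65388, 8127, 8159, 61311, 81404, 81852, 129663, 130655,
    1044460, 1048188, 1046396, 1045311, 1044447, 1044415, 1042431, 1273788, 1302380, 1273836,
    1277804, 1302271, 2095036, 1305599, 2096508, 1306591, 2080636, 1308607, 2088700, 1309687,
    2031100, 16732028, 2014975, 2095063, 2076639, 2080607, 15695740, 20368892, 20951916, 65855340,
    20951927, 32427516, 33239871, 33344735, 20348671, 33521260, 33421244, 20836287, 267599740,
    267374332, 32497407, 33520631, 267595743, 66023391, 267839479, 325902079, 536327020,
    334487292, 335003516, 402079583, 531615486, 518840063, 536327031, 1053683647, 1053683455,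
    1056831423, 4017086207, 16858938231]"
  by (simp add: after_def shapes_def family_def del: One_nat_def)

lemma fresh_4:
  "fresh shapes 4 4094" "fresh shapes 4 81855" "fresh shapes 4 130942" "fresh shapes 4 2095039"
  by (simp_all add: fresh_def after_4 del: One_nat_def)

lemma column_4:
  "list_all (\<lambda>(i, j). column_ok shapes states 4 (states ! i) j) [(0, 0), (1, 0), (2, 25),
    (3, 7), (4, 1), (5, 7), (6, 10), (7, 0), (8, 15), (9, 10), (10, 0), (11, 0), (12, 10), (13,
    25), (14, 0), (15, 25), (16, 10), (17, 10), (18, 0), (19, 0), (20, 0), (21, 0), (22, 1), (23,
    0), (24, 28), (25, 1), (26, 15), (27, 10), (28, 0), (29, 10), (30, 10), (31, 34), (32, 25),
    (33, 1), (34, 25)]"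
  by (simp add: automaton_eval fresh_4 fresh_after[of shapes 4, unfolded after_4 list.pred_inject] del: One_nat_def)

text \<open>Nearly every shape contains the cell of its first column in row 3, so a stone there
  leaves only five.\<close>

lemma after_8:
  "after 8 shapes = [8175, 1044463, 1047935, 1306607, 536330095]"
  by (simp add: after_def shapes_def family_def del: One_nat_def)

lemma column_8:
  "list_all (\<lambda>(i, j). column_ok shapes states 8 (states ! i) j) [(0, 0), (1, 0), (2, 22),
    (3, 7), (4, 28), (5, 7), (6, 10), (7, 0), (8, 16), (9, 10), (10, 0), (11, 0), (12, 22), (13,
    4), (14, 0), (15, 22), (16, 22), (17, 22), (18, 0), (19, 0), (20, 0), (21, 0), (22, 28), (23,
    0), (24, 28), (25, 28), (26, 16), (27, 10), (28, 0), (29, 10), (30, 16), (31, 17), (32, 33),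
    (33, 28), (34, 24)]"
  by (simp add: automaton_eval fresh_after[of shapes 8, unfolded after_8 list.pred_inject] del: One_nat_def)

lemma after_3:
  "after 3 shapes = [4092, 4991, 8172, 65388, 8127, 8159, 61311, 81404, 81852, 129663, 130655,
    1044460, 1048188, 1046396, 1045311, 1044447, 1044415, 1042431, 1273788, 1302380, 1273836,
    1277804, 1302271, 2095036, 1305599, 2096508, 1306591, 2080636, 1308607, 2088700, 1309687,
    2031100, 16732028, 2014975, 2095063, 2076639, 2080607, 15695740, 16710455, 20368892, 20951916,
    20380471, 65855340, 20951927, 32427516, 33239871, 33344735, 20348671, 33521260, 33421244,
    20836287, 267599740, 267374332, 32497407, 33520631, 267595743, 66023391, 33289975, 267839479,
    325902079, 536327020, 334487292, 335003516, 402079583, 531615486, 518840063, 536327031,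
    534739767, 1053683647, 536312631, 1053683455, 1056831423, 534707191, 4017086207, 8302590775,
    16858938231]"
  by (simp add: after_def shapes_def family_def del: One_nat_def)

lemma fresh_3:
  "fresh shapes 3 8175" "fresh shapes 3 81855" "fresh shapes 3 1044463" "fresh shapes 3 1306607"
    "fresh shapes 3 2095039"
  by (simp_all add: fresh_def after_3 del: One_nat_def)

text \<open>Two stones settle a deficit of at most four. Precisely the states with
  \<open>e \<ge> 5\<close> have a nonzero entry.\<close>

lemma column_3:
  "list_all (\<lambda>(i, j). column_ok shapes states 3 (states ! i) j) [(0, 0), (1, 0), (2, 0),
    (3, 28), (4, 0), (5, 28), (6, 0), (7, 0), (8, 0), (9, 0), (10, 0), (11, 25), (12, 0), (13, 0),
    (14, 25), (15, 0), (16, 0), (17, 0), (18, 22), (19, 28), (20, 28), (21, 28), (22, 0), (23, 1),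
    (24, 0), (25, 0), (26, 0), (27, 0), (28, 0), (29, 0), (30, 0), (31, 0), (32, 0), (33, 0), (34,
    0)]"
  by (simp add: automaton_eval fresh_3 fresh_after[of shapes 3, unfolded after_3 list.pred_inject] del: One_nat_def)

lemma after_5:
  "after 5 shapes = [4092, 4991, 8172, 65388, 8127, 8159, 61311, 81404, 81852, 129663, 130655,
    1044460, 1048188, 1046396, 1045311, 1044447, 1044415, 1042431, 1273788, 1302380, 1273836,
    1277804, 1302271, 2095036, 1305599, 2096508, 1306591, 2080636, 1308607, 2088700, 1309687,
    2031100, 16732028, 2014975, 2095063, 2076639, 2080607, 15695740, 20368892, 20951916, 65855340,
    20951927, 32427516, 33239871, 33344735, 20348671, 33521260, 33421244, 20836287, 267599740,
    267374332, 32497407, 33520631, 267595743, 66023391, 267839479, 325902079, 536327020,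
    334487292, 335003516, 402079583, 531615486, 518840063, 536327031, 1053683647, 1053683455,
    1056831423, 4017086207, 16858938231]"
  by (simp add: after_def shapes_def family_def del: One_nat_def)

lemma column_5:
  "list_all (\<lambda>(i, j). column_ok shapes states 5 (states ! i) j) [(0, 0), (1, 0), (2, 0),
    (3, 1), (4, 0), (5, 1), (6, 0), (7, 0), (8, 0), (9, 0), (10, 0), (11, 25), (12, 0), (13, 0),
    (14, 25), (15, 0), (16, 0), (17, 0), (18, 25), (19, 1), (20, 1), (21, 1), (22, 0), (23, 1),
    (24, 0), (25, 0), (26, 0), (27, 0), (28, 0), (29, 0), (30, 0), (31, 0), (32, 0), (33, 0), (34,
    0)]"
  by (simp add: automaton_eval fresh_after[of shapes 5, unfolded after_5 list.pred_inject] del: One_nat_def)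

lemma after_6:
  "after 6 shapes = [4092, 4991, 8172, 65388, 8127, 8159, 61311, 81404, 81852, 129663, 130655,
    1044460, 1048188, 1046396, 1045311, 1044447, 1044415, 1042431, 1273788, 1302380, 1273836,
    1277804, 1302271, 2095036, 1305599, 2096508, 1306591, 2080636, 1308607, 2088700, 1309687,
    2031100, 16732028, 2014975, 2095063, 2076639, 2080607, 15695740, 20368892, 20951916, 65855340,
    20951927, 32427516, 33239871, 33344735, 20348671, 33521260, 33421244, 20836287, 267599740,
    267374332, 32497407, 33520631, 267595743, 66023391, 267839479, 325902079, 536327020,
    334487292, 335003516, 402079583, 531615486, 518840063, 536327031, 1053683647, 1053683455,
    1056831423, 4017086207, 16858938231]"
  by (simp add: after_def shapes_def family_def del: One_nat_def)

text \<open>Row 0 is empty here, so the states that list shape 1 and have \<open>e \<ge> 5\<close>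
  are refuted; of the states with that deficit only 3 and 5 remain. The same happens in columns 10
  and 12.\<close>

lemma column_6:
  "list_all (\<lambda>(i, j). column_ok shapes states 6 (states ! i) j) [(0, 0), (1, 0), (2, 0),
    (3, 1), (4, 0), (5, 1), (6, 0), (7, 0), (8, 0), (9, 0), (10, 0), (11, 0), (12, 0), (13, 0),
    (14, 0), (15, 0), (16, 0), (17, 0), (18, 0), (19, 0), (20, 0), (21, 0), (22, 0), (23, 0), (24,
    0), (25, 0), (26, 0), (27, 0), (28, 0), (29, 0), (30, 0), (31, 0), (32, 0), (33, 0), (34, 0)]"
  by (simp add: automaton_eval fresh_after[of shapes 6, unfolded after_6 list.pred_inject] del: One_nat_def)

text \<open>The successors in this table and the two after it are justified through
  \<open>covered\<close>, by the shapes due in the current state.\<close>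

lemma column_9:
  "list_all (\<lambda>(i, j). column_ok shapes states 9 (states ! i) j) [(0, 0), (1, 0), (2, 0),
    (3, 28), (4, 0), (5, 28), (6, 0), (7, 0), (8, 0), (9, 0), (10, 0), (11, 22), (12, 0), (13, 0),
    (14, 22), (15, 0), (16, 0), (17, 0), (18, 22), (19, 28), (20, 28), (21, 28), (22, 0), (23,
    28), (24, 0), (25, 0), (26, 0), (27, 0), (28, 0), (29, 0), (30, 0), (31, 0), (32, 0), (33, 0),
    (34, 0)]"
  by (simp add: automaton_eval del: One_nat_def)

lemma column_10:
  "list_all (\<lambda>(i, j). column_ok shapes states 10 (states ! i) j) [(0, 0), (1, 0), (2, 0),
    (3, 28), (4, 0), (5, 28), (6, 0), (7, 0), (8, 0), (9, 0), (10, 0), (11, 0), (12, 0), (13, 0),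
    (14, 0), (15, 0), (16, 0), (17, 0), (18, 0), (19, 0), (20, 0), (21, 0), (22, 0), (23, 0), (24,
    0), (25, 0), (26, 0), (27, 0), (28, 0), (29, 0), (30, 0), (31, 0), (32, 0), (33, 0), (34, 0)]"
  by (simp add: automaton_eval del: One_nat_def)

lemma column_12:
  "list_all (\<lambda>(i, j). column_ok shapes states 12 (states ! i) j) [(0, 0), (1, 0), (2, 0),
    (3, 28), (4, 0), (5, 28), (6, 0), (7, 0), (8, 0), (9, 0), (10, 0), (11, 0), (12, 0), (13, 0),
    (14, 0), (15, 0), (16, 0), (17, 0), (18, 0), (19, 0), (20, 0), (21, 0), (22, 0), (23, 0), (24,
    0), (25, 0), (26, 0), (27, 0), (28, 0), (29, 0), (30, 0), (31, 0), (32, 0), (33, 0), (34, 0)]"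
  by (simp add: automaton_eval del: One_nat_def)

section \<open>The lower bound and the conclusion\<close>

lemma family_winning: "list_all (\<lambda>(w, m, m'). m < 2 ^ (4 * w) \<and> winning m) family"
  by (simp add: family_def carriers[THEN winningI])

text \<open>The rotated halves of \<open>shapes\<close> rest on this arithmetic and on
  \<open>first_carrier_due_rev\<close>.\<close>

lemma family_rotated: "list_all (\<lambda>(w, m, m'). rev_bits (4 * w) m 0 = m') family"
  unfolding family_def list.pred_inject prod.case
  by (intro conjI TrueI; simp add: rev_bits_numeral)

lemma shapes_due:
  assumes "virtual_connection n B" "s \<in> set shapes" shows "due n B c s"
proof -
  obtain w m m' where f: "(w, m, m') \<in> set family" and s: "s = m \<or> s = m'"
    using assms(2) unfolding shapes_def by auto
  have "m < 2 ^ (4 * w)" "winning m" using f family_winning by (auto simp: list_all_iff)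
  moreover have "m' = rev_bits (4 * w) m 0" using f family_rotated by (auto simp: list_all_iff)
  ultimately show ?thesis
    using s assms(1) first_carrier_due first_carrier_due_rev unfolding winning_def by blast
qed

lemma deficits: "list_all (\<lambda>(e, Q). e \<le> 6) states"
  by (simp add: states_def)

text \<open>Three stones are worth nine thirds, more than any e + 2. Such columns pass the first
  test of \<open>column_ok\<close>, and eleven columns are left for the tables.\<close>

lemma few_stones_cases:
  assumes "w < 16"
  shows "w \<in> {0, 1, 2, 4, 8, 3, 5, 6, 9, 10, 12} \<or> 3 \<le> stones w"
proof -
  have "w \<in> set [0..<16]" using assms by simp
  then have "w \<in> {0, 1, 2, 3, 4, 5, 6, 7, 8, 9, 10, 11, 12, 13, 14, 15}"
    by (simp add: upt_rec numeral_eq_Suc)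
  then show ?thesis by (auto simp: stones_def)
qed

lemma list_all_pairs:
  assumes "list_all (\<lambda>(i, j). P i j) ps" "map fst ps = [0..<k]" "i < k" shows "\<exists>j. P i j"
proof -
  have "i \<in> set (map fst ps)" using assms(2,3) by simp
  then show ?thesis using assms(1) by (fastforce simp: list_all_iff)
qed

lemma lower_bound:
  assumes "virtual_connection n B" shows "2 * n \<le> 3 * card B + 6"
proof (rule stones_bound_from_states[where shapes = shapes and states = states])
  fix w i :: nat assume "w < 16" and i: "i < length states"
  then consider "w \<in> {0, 1, 2, 4, 8, 3, 5, 6, 9, 10, 12}" | "3 \<le> stones w"
    using few_stones_cases by blast
  then show "\<exists>j. column_ok shapes states w (states ! i) j"
  proof cases
    case 1
    have c0: "\<exists>j. column_ok shapes states 0 (states ! i) j"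
      by (rule list_all_pairs[OF column_0 _ i]) (simp add: length_states upt_rec)
    have c1: "\<exists>j. column_ok shapes states 1 (states ! i) j"
      by (rule list_all_pairs[OF column_1 _ i]) (simp add: length_states upt_rec)
    have c2: "\<exists>j. column_ok shapes states 2 (states ! i) j"
      by (rule list_all_pairs[OF column_2 _ i]) (simp add: length_states upt_rec)
    have c4: "\<exists>j. column_ok shapes states 4 (states ! i) j"
      by (rule list_all_pairs[OF column_4 _ i]) (simp add: length_states upt_rec)
    have c8: "\<exists>j. column_ok shapes states 8 (states ! i) j"
      by (rule list_all_pairs[OF column_8 _ i]) (simp add: length_states upt_rec)
    have c3: "\<exists>j. column_ok shapes states 3 (states ! i) j"
      by (rule list_all_pairs[OF column_3 _ i]) (simp add: length_states upt_rec)
    have c5: "\<exists>j. column_ok shapes states 5 (states ! i) j"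
      by (rule list_all_pairs[OF column_5 _ i]) (simp add: length_states upt_rec)
    have c6: "\<exists>j. column_ok shapes states 6 (states ! i) j"
      by (rule list_all_pairs[OF column_6 _ i]) (simp add: length_states upt_rec)
    have c9: "\<exists>j. column_ok shapes states 9 (states ! i) j"
      by (rule list_all_pairs[OF column_9 _ i]) (simp add: length_states upt_rec)
    have c10: "\<exists>j. column_ok shapes states 10 (states ! i) j"
      by (rule list_all_pairs[OF column_10 _ i]) (simp add: length_states upt_rec)
    have c12: "\<exists>j. column_ok shapes states 12 (states ! i) j"
      by (rule list_all_pairs[OF column_12 _ i]) (simp add: length_states upt_rec)
    from 1 show ?thesis using c0 c1 c2 c4 c8 c3 c5 c6 c9 c10 c12 by blast
  next
    case 2
    obtain e Q where "states ! i = (e, Q)" by fastforce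
    moreover from this have "e \<le> 6" using deficits i by (metis (mono_tags) case_prodD list_all_length)
    ultimately show ?thesis using 2 by (simp add: column_ok_def)
  qed
next
  show "e \<le> 6" if "(e, Q) \<in> set states" for e Q using deficits that by (auto simp: list_all_iff)
  show "states \<noteq> []" using length_states by auto
qed (use assms shapes_due states_nth(1) in \<open>auto simp: virtual_connection_def\<close>)

theorem theorem12p3:
  fixes n :: nat
  assumes "n \<ge> 4"
  shows "(\<exists>B. virtual_connection n B \<and> int (card B) = \<lceil>2 / 3 * real n - 2\<rceil>) \<and>
         (\<forall>B. virtual_connection n B \<longrightarrow> int (card B) \<ge> \<lceil>2 / 3 * real n - 2\<rceil>)"
proof (intro conjI allI impI)
  show "\<exists>B. virtual_connection n B \<and> int (card B) = \<lceil>2 / 3 * real n - 2\<rceil>"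
    using assms by (rule upper_bound)
  fix B assume "virtual_connection n B"
  then have "2 * n \<le> 3 * card B + 6" by (rule lower_bound)
  \<comment> \<open>Divided by three this bounds the number of stones by 2/3 * n - 2 from below, and
    an integer above a real is above its ceiling.\<close>
  then show "\<lceil>2 / 3 * real n - 2\<rceil> \<le> int (card B)" by linarith
qed

end
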